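(* Let $H_1,H_2$ be Hilbert spaces (not necessarily separable), $\mathcal D_1\subseteq B(H_1)$, $\mathcal D_2\subseteq B(H_2)$ commutative von Neumann algebras, and let $S$ be a $\mathcal D_1\times\mathcal D_2$-bilattice. If $\mathfrak M\subseteq B(H_1,H_2)$ is an ultraweakly closed $\mathcal D_1'\times\mathcal D_2'$-bimodule such that $\operatorname{bil}\mathfrak M=S$, then $\mathfrak M_0(S)\subseteq\mathfrak M\subseteq\mathfrak M(S)$.
   Context: $\mathcal P(H)$ is the lattice of orthogonal projections on $H$, $\mathcal P_{\mathcal R}=\mathcal R\cap\mathcal P(H)$ for a von Neumann algebra $\mathcal R\subseteq B(H)$. A bilattice is a subset $S\subseteq\mathcal P(H_1)\times\mathcal P(H_2)$, assumed throughout closed in the strong operator topology, such that $(0,0),(0,1),(1,0)\in S$ and, whenever $(P_1,Q_1),(P_2,Q_2)\in S$, also $(P_1\wedge P_2,Q_1\vee Q_2)\in S$ and $(P_1\vee P_2,Q_1\wedge Q_2)\in S$. It is a $\mathcal D_1\times\mathcal D_2$-bilattice if its coordinate projections are $S_l=\mathcal P_{\mathcal D_1}$ and $S_r=\mathcal P_{\mathcal D_2}$. A $\mathcal D_1'\times\mathcal D_2'$-bimodule is a linear subspace $\mathfrak M\subseteq B(H_1,H_2)$ with $\mathcal D_2'\mathfrak M\mathcal D_1'\subseteq\mathfrak M$ ($\mathcal D_i'$ is the commutant). $\operatorname{bil}\mathfrak M=\{(P,Q)\in\mathcal P_{\mathcal D_1}\times\mathcal P_{\mathcal D_2}: QTP=0\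 \forall T\in\mathfrak M\}$. $\mathfrak M(S)=\{T\in B(H_1,H_2): QTP=0\ \forall (P,Q)\in S\}$. For a state $\varphi$ on $B(l_2)$, $L_\varphi:B(l_2\otimes H_i)\to B(H_i)$ is the slice map with $L_\varphi(A\otimes B)=\varphi(A)B$ (i.e. $\omega(L_\varphi(Z))=\varphi(R_\omega(Z))$ for every normal functional $\omega$ on $B(H_i)$, $R_\omega$ being the normal slice map with $R_\omega(A\otimes B)=\omega(B)A$). $\operatorname{Conv}S$ is the weak operator closure of the convex hull of $S$ in $B(H_1)\times B(H_2)$. $\tilde S$ is the set of pairs of projections $(P,Q)\in B(l_2\otimes H_1)\times B(l_2\otimes H_2)$ with $(L_\varphi(P),L_\varphi(Q))\in\operatorname{Conv}S$ for every state $\varphi$ on $B(l_2)$. $\mathfrak M_0(S)=\{T\in B(H_1,H_2): Q(1\otimes T)P=0\ \forall (P,Q)\in\tilde S\}$, with $1$ the identity on $l_2$. *)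

theory Defs
  imports "HOL-Analysis.Analysis"
begin

section \<open>Complex Hilbert spaces\<close>

class complex_vector = real_vector +
  fixes scaleC :: "complex \<Rightarrow> 'a \<Rightarrow> 'a"  (infixr "*\<^sub>C" 75)
  assumes scaleC_add_right: "c *\<^sub>C (x + y) = c *\<^sub>C x + c *\<^sub>C y"
    and scaleC_add_left: "(c + d) *\<^sub>C x = c *\<^sub>C x + d *\<^sub>C x"
    and scaleC_scaleC: "c *\<^sub>C (d *\<^sub>C x) = (c * d) *\<^sub>C x"
    and scaleC_of_real: "complex_of_real r *\<^sub>C x = r *\<^sub>R x"

text \<open>Inner products are linear in the first argument. No separability is assumed, and the
  zero space is allowed.\<close>

class chilbert_space = complex_vector + banach +
  fixes cinner :: "'a \<Rightarrow> 'a \<Rightarrow> complex"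
  assumes cinner_commute: "cinner x y = cnj (cinner y x)"
    and cinner_add_left: "cinner (x + y) z = cinner x z + cinner y z"
    and cinner_scaleC_left: "cinner (c *\<^sub>C x) y = c * cinner x y"
    and cinner_self: "cinner x x = complex_of_real ((norm x)\<^sup>2)"

definition clinear :: "('a::complex_vector \<Rightarrow> 'b::complex_vector) \<Rightarrow> bool" where
  "clinear f \<longleftrightarrow> (\<forall>x y. f (x + y) = f x + f y) \<and> (\<forall>c x. f (c *\<^sub>C x) = c *\<^sub>C f x)"

definition csubspace :: "'a::complex_vector set \<Rightarrow> bool" where
  "csubspace M \<longleftrightarrow>
     0 \<in> M \<and> (\<forall>x\<in>M. \<forall>y\<in>M. x + y \<in> M) \<and> (\<forall>c. \<forall>x\<in>M. c *\<^sub>C x \<in> M)"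

lemma scaleC_one [simp]: "1 *\<^sub>C x = (x::'a::complex_vector)"
  using scaleC_of_real[of 1 x] by simp

lemma scaleC_zero_left [simp]: "0 *\<^sub>C x = (0::'a::complex_vector)"
  using scaleC_of_real[of 0 x] by simp

lemma scaleC_zero_right [simp]: "c *\<^sub>C 0 = (0::'a::complex_vector)"
  using scaleC_add_right[of c 0 0] by simp

lemma scaleC_minus_right: "c *\<^sub>C (- x) = - (c *\<^sub>C (x::'a::complex_vector))"
  using scaleC_add_right[of c x "- x"] by (simp add: eq_neg_iff_add_eq_0 add.commute)

lemma scaleC_diff_right: "c *\<^sub>C (x - y) = c *\<^sub>C x - c *\<^sub>C (y::'a::complex_vector)"
  using scaleC_add_right[of c x "- y"] by (simp add: scaleC_minus_right)

lemma scaleR_scaleC: "r *\<^sub>R x = complex_of_real r *\<^sub>C (x::'a::complex_vector)"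
  by (simp add: scaleC_of_real)

lemma scaleC_scaleR_commute: "c *\<^sub>C (r *\<^sub>R x) = r *\<^sub>R (c *\<^sub>C (x::'a::complex_vector))"
  by (simp add: scaleR_scaleC scaleC_scaleC mult.commute)

lemma cinner_add_right: "cinner x (y + z) = cinner x y + cinner x (z::'a::chilbert_space)"
  using cinner_add_left[of y z x] cinner_commute[of x]
  by (metis complex_cnj_add)

lemma cinner_scaleC_right: "cinner x (c *\<^sub>C y) = cnj c * cinner x (y::'a::chilbert_space)"
  using cinner_scaleC_left[of c y x] cinner_commute[of x]
  by (metis complex_cnj_mult)

lemma norm_scaleC: "norm (c *\<^sub>C x) = cmod c * norm (x::'a::chilbert_space)"
proof -
  have "complex_of_real ((norm (c *\<^sub>C x))\<^sup>2) = c * cnj c * complex_of_real ((norm x)\<^sup>2)"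
    by (simp only: cinner_self[symmetric] cinner_scaleC_left cinner_scaleC_right mult.assoc
        mult.left_commute[of _ c])
  also have "\<dots> = complex_of_real ((cmod c * norm x)\<^sup>2)"
    by (simp add: complex_norm_square[symmetric] power_mult_distrib)
  finally have "(norm (c *\<^sub>C x))\<^sup>2 = (cmod c * norm x)\<^sup>2"
    by (simp only: of_real_eq_iff)
  then show ?thesis by simp
qed

lemma Re_cinner_le: "2 * Re (cinner x y) \<le> (norm x)\<^sup>2 + (norm (y::'a::chilbert_space))\<^sup>2"
proof -
  define z where "z = x + complex_of_real (-1) *\<^sub>C y"
  have "complex_of_real ((norm z)\<^sup>2) = cinner z z" by (simp add: cinner_self)
  also have "\<dots> = cinner x x - cinner x y - cinner y x + cinner y y"
    by (simp add: z_def cinner_add_left cinner_add_right cinner_scaleC_left cinner_scaleC_right)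
  also have "\<dots> = complex_of_real ((norm x)\<^sup>2) - cinner x y - cnj (cinner x y)
      + complex_of_real ((norm y)\<^sup>2)"
    using cinner_commute[of y x] by (simp add: cinner_self)
  finally have "Re (complex_of_real ((norm z)\<^sup>2)) =
      Re (complex_of_real ((norm x)\<^sup>2) - cinner x y - cnj (cinner x y)
      + complex_of_real ((norm y)\<^sup>2))" by (rule arg_cong)
  then have "(norm z)\<^sup>2 = (norm x)\<^sup>2 + (norm y)\<^sup>2 - 2 * Re (cinner x y)" by simp
  moreover have "0 \<le> (norm z)\<^sup>2" by simp
  ultimately show ?thesis by linarith
qed

lemma norm_cinner_le: "norm (cinner x y) \<le> (norm x)\<^sup>2 + (norm (y::'a::chilbert_space))\<^sup>2"
proof (cases "cinner x y = 0")
  case False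
  define c where "c = cnj (sgn (cinner x y))"
  have nc: "cmod c = 1" using False by (simp add: c_def norm_sgn)
  have "c * cinner x y = complex_of_real (cmod (cinner x y))"
    using False
    by (simp add: c_def sgn_eq complex_norm_square[symmetric] power2_eq_square
        mult.commute[of "cnj _"])
  then have "cmod (cinner x y) = Re (cinner (c *\<^sub>C x) y)"
    by (simp add: cinner_scaleC_left)
  moreover have "2 * Re (cinner (c *\<^sub>C x) y) \<le> (norm x)\<^sup>2 + (norm y)\<^sup>2"
    using Re_cinner_le[of "c *\<^sub>C x" y] nc by (simp add: norm_scaleC)
  moreover have "0 \<le> (norm x)\<^sup>2 + (norm y)\<^sup>2" by simp
  ultimately show ?thesis by linarith
qed simp

instantiation complex :: chilbert_space
begin
definition scaleC_complex :: "complex \<Rightarrow> complex \<Rightarrow> complex" where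
  "scaleC_complex c x = c * x"
definition cinner_complex :: "complex \<Rightarrow> complex \<Rightarrow> complex" where
  "cinner_complex x y = x * cnj y"
instance
proof
  fix x :: complex
  show "cinner x x = complex_of_real ((norm x)\<^sup>2)"
    unfolding cinner_complex_def by (rule complex_norm_square[symmetric])
qed (auto simp: scaleC_complex_def cinner_complex_def algebra_simps scaleR_conv_of_real)
end


section \<open>The Hilbert space of square summable sequences\<close>

text \<open>The type \<open>complex ell2\<close> is $l_2$, and the Hilbert space tensor product of $l_2$ with
  $H$ is realised as the space of square summable $H$-valued sequences, the elementary tensor of
  $a$ and $h$ being the sequence $(a_n h)_n$.\<close>

typedef (overloaded) ('a::chilbert_space) ell2 =
  "{x :: nat \<Rightarrow> 'a. summable (\<lambda>n. (norm (x n))\<^sup>2)}"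
  morphisms coord Abs_ell2
  by (rule exI[of _ "\<lambda>_. 0"]) simp

setup_lifting type_definition_ell2

lemma sq_summable_add:
  fixes x y :: "nat \<Rightarrow> 'a::real_normed_vector"
  assumes "summable (\<lambda>n. (norm (x n))\<^sup>2)" "summable (\<lambda>n. (norm (y n))\<^sup>2)"
  shows "summable (\<lambda>n. (norm (x n + y n))\<^sup>2)"
proof (rule summable_comparison_test')
  show "summable (\<lambda>n. 2 * (norm (x n))\<^sup>2 + 2 * (norm (y n))\<^sup>2)"
    using assms by (intro summable_add summable_mult)
  fix n
  have "(norm (x n + y n))\<^sup>2 \<le> (norm (x n) + norm (y n))\<^sup>2"
    by (intro power_mono norm_triangle_ineq) simp
  also have "\<dots> \<le> 2 * (norm (x n))\<^sup>2 + 2 * (norm (y n))\<^sup>2"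
    using sum_squares_bound[of "norm (x n)" "norm (y n)"] by (simp add: power2_sum)
  finally show "norm ((norm (x n + y n))\<^sup>2) \<le> 2 * (norm (x n))\<^sup>2 + 2 * (norm (y n))\<^sup>2"
    by simp
qed

lemma sq_summable_minus:
  fixes x y :: "nat \<Rightarrow> 'a::real_normed_vector"
  assumes "summable (\<lambda>n. (norm (x n))\<^sup>2)" "summable (\<lambda>n. (norm (y n))\<^sup>2)"
  shows "summable (\<lambda>n. (norm (x n - y n))\<^sup>2)"
  using sq_summable_add[of x "\<lambda>n. - y n"] assms by simp

instantiation ell2 :: (chilbert_space) complex_vector
begin
lift_definition zero_ell2 :: "'a ell2" is "\<lambda>_. 0" by simp
lift_definition plus_ell2 :: "'a ell2 \<Rightarrow> 'a ell2 \<Rightarrow> 'a ell2" is "\<lambda>x y n. x n + y n"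
  by (rule sq_summable_add)
lift_definition minus_ell2 :: "'a ell2 \<Rightarrow> 'a ell2 \<Rightarrow> 'a ell2" is "\<lambda>x y n. x n - y n"
  by (rule sq_summable_minus)
lift_definition uminus_ell2 :: "'a ell2 \<Rightarrow> 'a ell2" is "\<lambda>x n. - x n" by simp
lift_definition scaleR_ell2 :: "real \<Rightarrow> 'a ell2 \<Rightarrow> 'a ell2" is "\<lambda>r x n. r *\<^sub>R x n"
  by (simp add: power_mult_distrib summable_mult)
lift_definition scaleC_ell2 :: "complex \<Rightarrow> 'a ell2 \<Rightarrow> 'a ell2" is "\<lambda>c x n. c *\<^sub>C x n"
  by (simp add: norm_scaleC power_mult_distrib summable_mult)
instance
  by standard
    (transfer; simp add: fun_eq_iff algebra_simps scaleC_add_right scaleC_add_left scaleC_scaleC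
      scaleC_of_real)+
end

instantiation ell2 :: (chilbert_space) real_normed_vector
begin
lift_definition norm_ell2 :: "'a ell2 \<Rightarrow> real" is "\<lambda>x. sqrt (\<Sum>n. (norm (x n))\<^sup>2)" .
definition sgn_ell2 :: "'a ell2 \<Rightarrow> 'a ell2" where
  "sgn_ell2 x = inverse (norm x) *\<^sub>R x"
definition dist_ell2 :: "'a ell2 \<Rightarrow> 'a ell2 \<Rightarrow> real" where
  "dist_ell2 x y = norm (x - y)"
definition uniformity_ell2 :: "('a ell2 \<times> 'a ell2) filter" where
  "uniformity_ell2 = (INF e\<in>{0<..}. principal {(x, y). dist x y < e})"
definition open_ell2 :: "'a ell2 set \<Rightarrow> bool" where
  "open_ell2 U \<longleftrightarrow> (\<forall>x\<in>U. \<forall>\<^sub>F (x', y) in uniformity. x' = x \<longrightarrow> y \<in> U)"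
instance
proof
  fix x y :: "'a ell2" and r :: real
  show "norm x = 0 \<longleftrightarrow> x = 0"
    by transfer (auto simp: suminf_eq_zero_iff)
  show "norm (r *\<^sub>R x) = \<bar>r\<bar> * norm x"
    by transfer (simp add: power_mult_distrib suminf_mult real_sqrt_mult)
  show "norm (x + y) \<le> norm x + norm y"
  proof transfer
    fix x y :: "nat \<Rightarrow> 'a"
    assume x: "summable (\<lambda>n. (norm (x n))\<^sup>2)" and y: "summable (\<lambda>n. (norm (y n))\<^sup>2)"
    let ?R = "sqrt (\<Sum>n. (norm (x n))\<^sup>2) + sqrt (\<Sum>n. (norm (y n))\<^sup>2)"
    have pos: "0 \<le> ?R" by (simp add: suminf_nonneg x y)
    have "(\<Sum>n<K. (norm (x n + y n))\<^sup>2) \<le> ?R\<^sup>2" for K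
    proof -
      have "sqrt (\<Sum>n<K. (norm (x n + y n))\<^sup>2) \<le> sqrt (\<Sum>n<K. (norm (x n) + norm (y n))\<^sup>2)"
        by (intro real_sqrt_le_mono sum_mono power_mono norm_triangle_ineq) simp
      also have "\<dots> \<le> sqrt (\<Sum>n<K. (norm (x n))\<^sup>2) + sqrt (\<Sum>n<K. (norm (y n))\<^sup>2)"
        using L2_set_triangle_ineq[of "\<lambda>n. norm (x n)" "\<lambda>n. norm (y n)" "{..<K}"]
        by (simp add: L2_set_def)
      also have "\<dots> \<le> ?R"
        by (intro add_mono real_sqrt_le_mono sum_le_suminf x y) auto
      finally show ?thesis by (rule sqrt_le_D)
    qed
    then have "(\<Sum>n. (norm (x n + y n))\<^sup>2) \<le> ?R\<^sup>2"
      by (intro suminf_le_const sq_summable_add x y)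
    then show "sqrt (\<Sum>n. (norm (x n + y n))\<^sup>2) \<le> ?R"
      using pos by (rule real_le_lsqrt[rotated])
  qed
qed (simp_all add: sgn_ell2_def dist_ell2_def uniformity_ell2_def open_ell2_def)
end

lemma norm_ell2_square: "(norm x)\<^sup>2 = (\<Sum>n. (norm (coord x n))\<^sup>2)"
  by transfer (simp add: suminf_nonneg)

lemma coord_summable: "summable (\<lambda>n. (norm (coord x n))\<^sup>2)"
  by transfer

lemma norm_coord_le: "norm (coord x n) \<le> norm x"
proof -
  have "(norm (coord x n))\<^sup>2 \<le> (norm x)\<^sup>2"
    using sum_le_suminf[OF coord_summable[of x], of "{n}"] by (simp add: norm_ell2_square)
  then show ?thesis by (simp add: power2_le_iff_abs_le)
qed

lemma coord_diff: "coord (x - y) n = coord x n - coord y n"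
  by transfer simp

instance ell2 :: (chilbert_space) banach
proof
  fix X :: "nat \<Rightarrow> 'a ell2"
  assume C: "Cauchy X"
  have "Cauchy (\<lambda>m. coord (X m) n)" for n
    unfolding Cauchy_def
  proof (intro allI impI)
    fix e :: real assume "e > 0"
    then obtain M where M: "\<And>m k. m \<ge> M \<Longrightarrow> k \<ge> M \<Longrightarrow> dist (X m) (X k) < e"
      using C unfolding Cauchy_def by blast
    have "dist (coord (X m) n) (coord (X k) n) < e" if "m \<ge> M" "k \<ge> M" for m k
      using norm_coord_le[of "X m - X k" n] M[OF that] by (simp add: dist_norm coord_diff)
    then show "\<exists>M. \<forall>m\<ge>M. \<forall>k\<ge>M. dist (coord (X m) n) (coord (X k) n) < e" by blast
  qed
  then have "\<exists>l. (\<lambda>m. coord (X m) n) \<longlonglongrightarrow> l" for n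
    using Cauchy_convergent unfolding convergent_def by blast
  then obtain L where L: "\<And>n. (\<lambda>m. coord (X m) n) \<longlonglongrightarrow> L n" by metis
  have fin: "\<exists>M. \<forall>m\<ge>M. \<forall>K. (\<Sum>n<K. (norm (coord (X m) n - L n))\<^sup>2) \<le> e\<^sup>2"
    if e: "e > 0" for e
  proof -
    from e obtain M where M: "\<And>m k. m \<ge> M \<Longrightarrow> k \<ge> M \<Longrightarrow> dist (X m) (X k) < e"
      using C unfolding Cauchy_def by blast
    have "(\<Sum>n<K. (norm (coord (X m) n - L n))\<^sup>2) \<le> e\<^sup>2" if m: "m \<ge> M" for m K
    proof (rule LIMSEQ_le_const2)
      show "(\<lambda>k. \<Sum>n<K. (norm (coord (X m) n - coord (X k) n))\<^sup>2)
          \<longlonglongrightarrow> (\<Sum>n<K. (norm (coord (X m) n - L n))\<^sup>2)"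
        by (intro tendsto_intros L)
      have "(\<Sum>n<K. (norm (coord (X m) n - coord (X k) n))\<^sup>2) \<le> e\<^sup>2" if k: "k \<ge> M" for k
      proof -
        have "(\<Sum>n<K. (norm (coord (X m - X k) n))\<^sup>2) \<le> (norm (X m - X k))\<^sup>2"
          unfolding norm_ell2_square by (intro sum_le_suminf coord_summable) auto
        also have "\<dots> \<le> e\<^sup>2"
          using M[OF m k] by (intro power_mono) (simp_all add: dist_norm)
        finally show ?thesis by (simp add: coord_diff)
      qed
      then show "\<exists>N. \<forall>k\<ge>N. (\<Sum>n<K. (norm (coord (X m) n - coord (X k) n))\<^sup>2) \<le> e\<^sup>2" by blast
    qed
    then show ?thesis by blast
  qed
  obtain M1 where M1: "\<And>K. (\<Sum>n<K. (norm (coord (X M1) n - L n))\<^sup>2) \<le> 1\<^sup>2"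
    using fin[of 1] by auto
  have "summable (\<lambda>n. (norm (coord (X M1) n - L n))\<^sup>2)"
    by (rule summableI_nonneg_bounded[of _ "1\<^sup>2"]) (use M1 in auto)
  from sq_summable_minus[OF coord_summable[of "X M1"] this]
  have sL: "summable (\<lambda>n. (norm (L n))\<^sup>2)" by simp
  define Y where "Y = Abs_ell2 L"
  have Y: "coord Y n = L n" for n
    using sL by (simp add: Y_def Abs_ell2_inverse)
  have "X \<longlonglongrightarrow> Y"
  proof (rule LIMSEQ_I)
    fix e :: real assume e: "e > 0"
    then obtain M where M: "\<And>m K. m \<ge> M \<Longrightarrow> (\<Sum>n<K. (norm (coord (X m) n - L n))\<^sup>2) \<le> (e/2)\<^sup>2"
      using fin[of "e/2"] by auto
    have "norm (X m - Y) < e" if "m \<ge> M" for m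
    proof -
      have "(norm (X m - Y))\<^sup>2 \<le> (e/2)\<^sup>2"
        unfolding norm_ell2_square
      proof (rule suminf_le_const[OF coord_summable])
        show "(\<Sum>n<K. (norm (coord (X m - Y) n))\<^sup>2) \<le> (e/2)\<^sup>2" for K
          unfolding coord_diff Y by (rule M[OF that])
      qed
      then have "norm (X m - Y) \<le> e/2"
        by (rule power2_le_imp_le) (use e in simp)
      then show ?thesis using e by linarith
    qed
    then show "\<exists>M. \<forall>m\<ge>M. norm (X m - Y) < e" by blast
  qed
  then show "convergent X" unfolding convergent_def by blast
qed

lemma summable_cinner_coord: "summable (\<lambda>n. cinner (coord x n) (coord y n))"
proof (rule summable_comparison_test')
  show "summable (\<lambda>n. (norm (coord x n))\<^sup>2 + (norm (coord y n))\<^sup>2)"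
    by (intro summable_add coord_summable)
  show "norm (cinner (coord x n) (coord y n)) \<le> (norm (coord x n))\<^sup>2 + (norm (coord y n))\<^sup>2" for n
    by (rule norm_cinner_le)
qed

instantiation ell2 :: (chilbert_space) chilbert_space
begin
definition cinner_ell2 :: "'a ell2 \<Rightarrow> 'a ell2 \<Rightarrow> complex" where
  "cinner_ell2 x y = (\<Sum>n. cinner (coord x n) (coord y n))"
instance
proof
  fix x y z :: "'a ell2" and c :: complex
  have "(\<lambda>n. cnj (cinner (coord y n) (coord x n))) sums cnj (cinner y x)"
    unfolding cinner_ell2_def sums_cnj by (rule summable_sums summable_cinner_coord)+
  then show "cinner x y = cnj (cinner y x)"
    unfolding cinner_ell2_def using cinner_commute[of "coord x _" "coord y _"]
    by (simp add: sums_iff)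
  show "cinner (x + y) z = cinner x z + cinner y z"
    unfolding cinner_ell2_def
    by (simp add: plus_ell2.rep_eq cinner_add_left suminf_add summable_cinner_coord)
  show "cinner (c *\<^sub>C x) y = c * cinner x y"
    unfolding cinner_ell2_def
    by (simp add: scaleC_ell2.rep_eq cinner_scaleC_left suminf_mult summable_cinner_coord)
  show "cinner x x = complex_of_real ((norm x)\<^sup>2)"
    unfolding cinner_ell2_def norm_ell2_square cinner_self
    by (rule suminf_of_real[symmetric, OF coord_summable])
qed
end

lift_definition etensor :: "complex ell2 \<Rightarrow> 'a::chilbert_space \<Rightarrow> 'a ell2"  (infixr "\<otimes>\<^sub>v" 70)
  is "\<lambda>a h n. a n *\<^sub>C h"
  by (simp add: norm_scaleC power_mult_distrib summable_mult2)


section \<open>Bounded operators\<close>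

typedef (overloaded) ('a::chilbert_space, 'b::chilbert_space) cblinfun =
  "{f :: 'a \<Rightarrow> 'b. bounded_linear f \<and> clinear f}"
  morphisms cblinfun_apply Abs_cblinfun
  by (rule exI[of _ "\<lambda>_. 0"]) (simp add: clinear_def)

setup_lifting type_definition_cblinfun

notation cblinfun_apply  (infixr "*\<^sub>V" 75)

lemma bounded_linear_scaleC: "bounded_linear (\<lambda>x::'a::chilbert_space. c *\<^sub>C x)"
  by (rule bounded_linear_intro[of _ "cmod c"])
    (simp_all add: scaleC_add_right scaleC_scaleR_commute norm_scaleC mult.commute)

instantiation cblinfun :: (chilbert_space, chilbert_space) complex_vector
begin
lift_definition zero_cblinfun :: "('a, 'b) cblinfun" is "\<lambda>_. 0"
  by (simp add: clinear_def)
lift_definition plus_cblinfun :: "('a, 'b) cblinfun \<Rightarrow> ('a, 'b) cblinfun \<Rightarrow> ('a, 'b) cblinfun"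
  is "\<lambda>S T x. S x + T x"
  by (auto simp: clinear_def scaleC_add_right intro: bounded_linear_add)
lift_definition uminus_cblinfun :: "('a, 'b) cblinfun \<Rightarrow> ('a, 'b) cblinfun" is "\<lambda>T x. - T x"
  by (auto simp: clinear_def scaleC_minus_right intro: bounded_linear_minus)
lift_definition minus_cblinfun :: "('a, 'b) cblinfun \<Rightarrow> ('a, 'b) cblinfun \<Rightarrow> ('a, 'b) cblinfun"
  is "\<lambda>S T x. S x - T x"
  by (auto simp: clinear_def scaleC_diff_right intro: bounded_linear_sub)
lift_definition scaleR_cblinfun :: "real \<Rightarrow> ('a, 'b) cblinfun \<Rightarrow> ('a, 'b) cblinfun"
  is "\<lambda>r T x. r *\<^sub>R T x"
  by (auto simp: clinear_def scaleR_add_right scaleC_scaleR_commute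
      intro: bounded_linear_const_scaleR)
lift_definition scaleC_cblinfun :: "complex \<Rightarrow> ('a, 'b) cblinfun \<Rightarrow> ('a, 'b) cblinfun"
  is "\<lambda>c T x. c *\<^sub>C T x"
  by (simp add: clinear_def scaleC_add_right scaleC_scaleC mult.commute
      bounded_linear_compose[OF bounded_linear_scaleC])
instance
  by standard
    (transfer; simp add: fun_eq_iff algebra_simps scaleC_add_right scaleC_add_left scaleC_scaleC
      scaleC_of_real)+
end

lift_definition id_op :: "('a::chilbert_space, 'a) cblinfun" is "\<lambda>x. x"
  by (simp add: clinear_def)

lift_definition comp_op :: "('b::chilbert_space, 'c::chilbert_space) cblinfun
    \<Rightarrow> ('a::chilbert_space, 'b) cblinfun \<Rightarrow> ('a, 'c) cblinfun"  (infixl "\<cdot>" 70)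
  is "\<lambda>S T x. S (T x)"
  by (simp add: clinear_def bounded_linear_compose)

definition adj :: "('a::chilbert_space, 'b::chilbert_space) cblinfun \<Rightarrow> ('b, 'a) cblinfun" where
  "adj T = (THE R. \<forall>x y. cinner (T *\<^sub>V x) y = cinner x (R *\<^sub>V y))"

definition op_tensor :: "(complex ell2, complex ell2) cblinfun
    \<Rightarrow> ('a::chilbert_space, 'b::chilbert_space) cblinfun \<Rightarrow> ('a ell2, 'b ell2) cblinfun"
    (infixr "\<otimes>\<^sub>o" 70) where
  "A \<otimes>\<^sub>o B = (THE Z. \<forall>a h. Z *\<^sub>V (a \<otimes>\<^sub>v h) = (A *\<^sub>V a) \<otimes>\<^sub>v (B *\<^sub>V h))"


section \<open>Operator topologies\<close>

text \<open>Each topology is the initial topology for a family of maps; a function type carries the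
  product topology, so \<^const>\<open>euclidean\<close> below is the topology of pointwise convergence.\<close>

definition SOT :: "('a::chilbert_space, 'b::chilbert_space) cblinfun topology" where
  "SOT = pullback_topology UNIV (\<lambda>T x. T *\<^sub>V x) euclidean"

definition WOT :: "('a::chilbert_space, 'b::chilbert_space) cblinfun topology" where
  "WOT = pullback_topology UNIV (\<lambda>T (x, y). cinner (T *\<^sub>V x) y) euclidean"

definition ultraweak :: "('a::chilbert_space, 'b::chilbert_space) cblinfun topology" where
  "ultraweak = pullback_topology UNIV
     (\<lambda>T (x :: 'a ell2, y :: 'b ell2). \<Sum>n. cinner (T *\<^sub>V coord x n) (coord y n)) euclidean"


section \<open>Von Neumann algebras, projections, bilattices and bimodules\<close>

definition von_neumann_algebra :: "('a::chilbert_space, 'a) cblinfun set \<Rightarrow> bool" where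
  "von_neumann_algebra R \<longleftrightarrow>
     csubspace R \<and> id_op \<in> R \<and> (\<forall>A\<in>R. \<forall>B\<in>R. A \<cdot> B \<in> R) \<and> (\<forall>A\<in>R. adj A \<in> R) \<and> closedin WOT R"

definition commutative :: "('a::chilbert_space, 'a) cblinfun set \<Rightarrow> bool" where
  "commutative R \<longleftrightarrow> (\<forall>A\<in>R. \<forall>B\<in>R. A \<cdot> B = B \<cdot> A)"

definition commutant :: "('a::chilbert_space, 'a) cblinfun set \<Rightarrow> ('a, 'a) cblinfun set" where
  "commutant R = {A. \<forall>B\<in>R. A \<cdot> B = B \<cdot> A}"

definition projections :: "('a::chilbert_space, 'a) cblinfun set" where
  "projections = {P. P \<cdot> P = P \<and> adj P = P}"

definition proj_meet :: "('a::chilbert_space, 'a) cblinfun \<Rightarrow> ('a, 'a) cblinfun \<Rightarrow> ('a, 'a) cblinfun"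
    (infixl "\<sqinter>\<^sub>p" 70) where
  "P \<sqinter>\<^sub>p Q = (THE R. R \<in> projections \<and>
     range (cblinfun_apply R) = range (cblinfun_apply P) \<inter> range (cblinfun_apply Q))"

definition proj_join :: "('a::chilbert_space, 'a) cblinfun \<Rightarrow> ('a, 'a) cblinfun \<Rightarrow> ('a, 'a) cblinfun"
    (infixl "\<squnion>\<^sub>p" 65) where
  "P \<squnion>\<^sub>p Q = (THE R. R \<in> projections \<and>
     range (cblinfun_apply R) = closure {P *\<^sub>V x + Q *\<^sub>V y | x y. True})"

definition bilattice ::
    "(('a::chilbert_space, 'a) cblinfun \<times> ('b::chilbert_space, 'b) cblinfun) set \<Rightarrow> bool" where
  "bilattice S \<longleftrightarrow>
     S \<subseteq> projections \<times> projections \<and>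
     closedin (prod_topology SOT SOT) S \<and>
     (0, 0) \<in> S \<and> (0, id_op) \<in> S \<and> (id_op, 0) \<in> S \<and>
     (\<forall>P1 Q1 P2 Q2. (P1, Q1) \<in> S \<and> (P2, Q2) \<in> S \<longrightarrow>
        (P1 \<sqinter>\<^sub>p P2, Q1 \<squnion>\<^sub>p Q2) \<in> S \<and> (P1 \<squnion>\<^sub>p P2, Q1 \<sqinter>\<^sub>p Q2) \<in> S)"

definition bilattice_over :: "('a::chilbert_space, 'a) cblinfun set
    \<Rightarrow> ('b::chilbert_space, 'b) cblinfun set
    \<Rightarrow> (('a, 'a) cblinfun \<times> ('b, 'b) cblinfun) set \<Rightarrow> bool" where
  "bilattice_over D1 D2 S \<longleftrightarrow>
     bilattice S \<and> fst ` S = D1 \<inter> projections \<and> snd ` S = D2 \<inter> projections"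

text \<open>\<open>R1\<close> and \<open>R2\<close> are the algebras that act, so a $\mathcal D_1' \times \mathcal D_2'$-bimodule
  is a \<open>bimodule (commutant D1) (commutant D2)\<close>. \<open>Mmax S\<close> and \<open>Mmin S\<close> (below) stand for
  $\mathfrak M(S)$ and $\mathfrak M_0(S)$.\<close>

definition bimodule :: "('a::chilbert_space, 'a) cblinfun set
    \<Rightarrow> ('b::chilbert_space, 'b) cblinfun set \<Rightarrow> ('a, 'b) cblinfun set \<Rightarrow> bool" where
  "bimodule R1 R2 M \<longleftrightarrow> csubspace M \<and> (\<forall>A\<in>R2. \<forall>T\<in>M. \<forall>B\<in>R1. A \<cdot> T \<cdot> B \<in> M)"

definition bil :: "('a::chilbert_space, 'a) cblinfun set \<Rightarrow> ('b::chilbert_space, 'b) cblinfun set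
    \<Rightarrow> ('a, 'b) cblinfun set \<Rightarrow> (('a, 'a) cblinfun \<times> ('b, 'b) cblinfun) set" where
  "bil D1 D2 M =
     {(P, Q). P \<in> D1 \<inter> projections \<and> Q \<in> D2 \<inter> projections \<and> (\<forall>T\<in>M. Q \<cdot> T \<cdot> P = 0)}"

definition Mmax :: "(('a::chilbert_space, 'a) cblinfun \<times> ('b::chilbert_space, 'b) cblinfun) set
    \<Rightarrow> ('a, 'b) cblinfun set" where
  "Mmax S = {T. \<forall>(P, Q)\<in>S. Q \<cdot> T \<cdot> P = 0}"


section \<open>States, slice maps and the minimal bimodule\<close>

definition state :: "(('a::chilbert_space, 'a) cblinfun \<Rightarrow> complex) \<Rightarrow> bool" where
  "state \<phi> \<longleftrightarrow>
     clinear \<phi> \<and> \<phi> id_op = 1 \<and>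
     (\<forall>A :: ('a, 'a) cblinfun. \<phi> (adj A \<cdot> A) \<in> \<real> \<and> 0 \<le> Re (\<phi> (adj A \<cdot> A)))"

definition normal_functional :: "(('a::chilbert_space, 'a) cblinfun \<Rightarrow> complex) \<Rightarrow> bool" where
  "normal_functional \<omega> \<longleftrightarrow> clinear \<omega> \<and> continuous_map ultraweak euclidean \<omega>"

definition Rslice :: "(('a::chilbert_space, 'a) cblinfun \<Rightarrow> complex)
    \<Rightarrow> ('a ell2, 'a ell2) cblinfun \<Rightarrow> (complex ell2, complex ell2) cblinfun" where
  "Rslice \<omega> = (THE R. clinear R \<and> continuous_map ultraweak ultraweak R \<and>
     (\<forall>A B. R (A \<otimes>\<^sub>o B) = \<omega> B *\<^sub>C A))"

text \<open>\<open>\<phi>\<close> need not be normal, so the values of \<open>Lslice \<phi>\<close> on elementary tensors do not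
  determine it; it is determined by duality with the normal slice maps.\<close>

definition Lslice :: "((complex ell2, complex ell2) cblinfun \<Rightarrow> complex)
    \<Rightarrow> ('a::chilbert_space ell2, 'a ell2) cblinfun \<Rightarrow> ('a, 'a) cblinfun" where
  "Lslice \<phi> Z = (THE X. \<forall>\<omega>. normal_functional \<omega> \<longrightarrow> \<omega> X = \<phi> (Rslice \<omega> Z))"

definition Conv :: "(('a::chilbert_space, 'a) cblinfun \<times> ('b::chilbert_space, 'b) cblinfun) set
    \<Rightarrow> (('a, 'a) cblinfun \<times> ('b, 'b) cblinfun) set" where
  "Conv S = (prod_topology WOT WOT) closure_of (convex hull S)"

definition tilde :: "(('a::chilbert_space, 'a) cblinfun \<times> ('b::chilbert_space, 'b) cblinfun) set
    \<Rightarrow> (('a ell2, 'a ell2) cblinfun \<times> ('b ell2, 'b ell2) cblinfun) set" where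
  "tilde S = {(P, Q). P \<in> projections \<and> Q \<in> projections \<and>
     (\<forall>\<phi>. state \<phi> \<longrightarrow> (Lslice \<phi> P, Lslice \<phi> Q) \<in> Conv S)}"

definition Mmin :: "(('a::chilbert_space, 'a) cblinfun \<times> ('b::chilbert_space, 'b) cblinfun) set
    \<Rightarrow> ('a, 'b) cblinfun set" where
  "Mmin S = {T. \<forall>(P, Q)\<in>tilde S. Q \<cdot> (id_op \<otimes>\<^sub>o T) \<cdot> P = 0}"

end

theory Submission
  imports Defs
begin

text \<open>
  The inclusion \<open>M \<subseteq> Mmax S\<close> is immediate from \<open>bil M = S\<close>. For \<open>Mmin S \<subseteq> M\<close>, suppose that
  \<open>T0\<close> lies outside \<open>M\<close>. As \<open>M\<close> is an ultraweakly closed subspace, there are vectors \<open>\<xi>\<close>, \<open>\<eta>\<close>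
  such that the functional \<open>T \<mapsto> \<langle>(1 \<otimes> T) \<xi>, \<eta>\<rangle>\<close> vanishes on \<open>M\<close> but not at \<open>T0\<close>
  (\<open>ultraweak_separation\<close>). Let \<open>P\<close> and \<open>Q\<close> be the projections onto the closures of
  \<open>(1 \<otimes> D1') \<xi>\<close> and \<open>(1 \<otimes> D2') \<eta>\<close>. The bimodule property gives \<open>Q (1 \<otimes> T) P = 0\<close> for all \<open>T\<close> in
  \<open>M\<close>, whereas \<open>Q (1 \<otimes> T0) P\<close> is not zero. So \<open>T0\<close> is outside \<open>Mmin S\<close> as soon as \<open>(P, Q)\<close> lies
  in \<open>tilde S\<close>.

  If a pair of slices \<open>(L\<^sub>\<phi> P, L\<^sub>\<phi> Q)\<close> were outside \<open>Conv S\<close>, a pair of vector functionals would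
  separate it from \<open>S\<close> (\<open>separate_from_Conv\<close>). By duality the separating value is \<open>\<phi> (Z)\<close> for an
  operator \<open>Z\<close> on \<open>l\<^sub>2\<close> built from these functionals (\<open>Lslice_vector_functional\<close>), and a bound
  for the numerical range of \<open>Z\<close> is a bound for the real part of its value under every state
  (\<open>state_numerical_range\<close>). Hence vector states suffice, although \<open>\<phi>\<close> need not be normal.

  For the vector state of a unit vector \<open>e\<close> the slices are \<open>A = V\<^sup>* P V\<close> and \<open>B = V\<^sup>* Q V\<close> with
  \<open>V x = e \<otimes> x\<close>. They commute with \<open>D1'\<close> and \<open>D2'\<close>, so their spectral projections lie in \<open>D1\<close>
  and \<open>D2\<close> by the bicommutant theorem. The key point is \<open>spectral_corner_zero\<close>: if \<open>E\<close> and \<open>F\<close>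
  are the spectral projections of \<open>A\<close> for \<open>[a, \<infinity>)\<close> and of \<open>B\<close> for \<open>[b, \<infinity>)\<close> with \<open>a + b > 1\<close>, then
  \<open>F T E = 0\<close> for all \<open>T\<close> in \<open>M\<close>, that is, \<open>(E, F)\<close> belongs to \<open>bil M = S\<close>. Averaging these
  pairs for \<open>a = k/n\<close> and \<open>b = (n + 1 - k)/n\<close> gives convex combinations of elements of \<open>S\<close> that
  are within \<open>1/n\<close> of \<open>(A, B)\<close> in norm (\<open>spectral_layer_sum\<close>), so \<open>(A, B)\<close> satisfies the same
  separating inequality as \<open>S\<close>.

  The tools behind this are the nearest point theorem for closed convex sets, which gives adjoints,
  projections and separation, and the square root of a positive operator, obtained from a
  fixed point iteration, which gives spectral projections and the positivity of states on all
  positive operators.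
\<close>

section \<open>Geometry of complex Hilbert spaces\<close>

lemma cinner_zero_left [simp]: "cinner 0 (y::'a::chilbert_space) = 0"
  using cinner_add_left[of 0 0 y] by simp

lemma cinner_zero_right [simp]: "cinner (x::'a::chilbert_space) 0 = 0"
  using cinner_add_right[of x 0 0] by simp

lemma cinner_minus_left: "cinner (- x) y = - cinner x (y::'a::chilbert_space)"
  using cinner_add_left[of x "- x" y] by (simp add: eq_neg_iff_add_eq_0 add.commute)

lemma cinner_minus_right: "cinner x (- y) = - cinner x (y::'a::chilbert_space)"
  using cinner_add_right[of x y "- y"] by (simp add: eq_neg_iff_add_eq_0 add.commute)

lemma cinner_diff_left: "cinner (x - y) z = cinner x z - cinner y (z::'a::chilbert_space)"
  using cinner_add_left[of x "- y" z] by (simp add: cinner_minus_left)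

lemma cinner_diff_right: "cinner x (y - z) = cinner x y - cinner x (z::'a::chilbert_space)"
  using cinner_add_right[of x y "- z"] by (simp add: cinner_minus_right)

lemma cinner_scaleR_left: "cinner (r *\<^sub>R x) y = complex_of_real r * cinner x (y::'a::chilbert_space)"
  by (simp add: scaleR_scaleC cinner_scaleC_left)

lemma cinner_scaleR_right: "cinner x (r *\<^sub>R y) = complex_of_real r * cinner x (y::'a::chilbert_space)"
  by (simp add: scaleR_scaleC cinner_scaleC_right)

lemmas cinner_simps = cinner_add_left cinner_add_right cinner_diff_left cinner_diff_right
  cinner_minus_left cinner_minus_right cinner_scaleC_left cinner_scaleC_right
  cinner_scaleR_left cinner_scaleR_right

lemma Re_cinner_self [simp]: "Re (cinner x x) = (norm (x::'a::chilbert_space))\<^sup>2"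
  and Im_cinner_self [simp]: "Im (cinner x x) = 0"
  by (simp_all add: cinner_self)

lemma Re_cinner_commute: "Re (cinner x y) = Re (cinner y (x::'a::chilbert_space))"
  by (subst cinner_commute) simp

lemma norm_add_square:
  "(norm (x + y))\<^sup>2 = (norm x)\<^sup>2 + 2 * Re (cinner x y) + (norm (y::'a::chilbert_space))\<^sup>2"
  unfolding Re_cinner_self[symmetric] using Re_cinner_commute[of x y]
  by (simp add: cinner_simps del: Re_cinner_self)

lemma norm_diff_square:
  "(norm (x - y))\<^sup>2 = (norm x)\<^sup>2 - 2 * Re (cinner x y) + (norm (y::'a::chilbert_space))\<^sup>2"
  using norm_add_square[of x "- y"] by (simp add: cinner_minus_right)

lemma Re_cinner_le_norm: "Re (cinner x y) \<le> norm x * norm (y::'a::chilbert_space)"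
proof (cases "x = 0 \<or> y = 0")
  case False
  then have "norm x > 0" "norm y > 0" by auto
  define u where "u = (1 / norm x) *\<^sub>R x"
  define v where "v = (1 / norm y) *\<^sub>R y"
  have "norm u = 1" "norm v = 1" using False by (auto simp: u_def v_def)
  then have "Re (cinner u v) \<le> 1" using Re_cinner_le[of u v] by simp
  moreover have "Re (cinner u v) = Re (cinner x y) / (norm x * norm y)"
    by (simp add: u_def v_def cinner_simps flip: of_real_mult of_real_divide)
  ultimately show ?thesis using \<open>norm x > 0\<close> \<open>norm y > 0\<close>
    by (simp add: divide_le_eq)
qed auto

lemma complex_phase: "\<exists>c::complex. cmod c = 1 \<and> c * z = complex_of_real (cmod z)"
proof (cases "z = 0")
  case False
  then have "cmod (cnj (sgn z)) = 1" by (simp add: norm_sgn)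
  moreover have "cnj (sgn z) * z = complex_of_real (cmod z)"
    using False by (simp add: sgn_eq complex_norm_square[symmetric] power2_eq_square
        mult.commute[of "cnj _"])
  ultimately show ?thesis by blast
qed (auto intro: exI[of _ 1])

text \<open>Rotating \<open>x\<close> by a phase makes the inner product real, so the real form suffices.\<close>

lemma cinner_Cauchy_Schwarz: "cmod (cinner x y) \<le> norm x * norm (y::'a::chilbert_space)"
proof -
  obtain c where c: "cmod c = 1" "c * cinner x y = complex_of_real (cmod (cinner x y))"
    using complex_phase by blast
  have "cmod (cinner x y) = Re (cinner (c *\<^sub>C x) y)" using c by (simp add: cinner_scaleC_left)
  also have "\<dots> \<le> norm x * norm y" using Re_cinner_le_norm[of "c *\<^sub>C x" y] c by (simp add: norm_scaleC)
  finally show ?thesis .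
qed

lemma bounded_bilinear_cinner: "bounded_bilinear (cinner :: 'a::chilbert_space \<Rightarrow> 'a \<Rightarrow> complex)"
proof
  show "\<exists>K. \<forall>a b::'a. norm (cinner a b) \<le> norm a * norm b * K"
    by (intro exI[of _ 1]) (simp add: cinner_Cauchy_Schwarz)
qed (simp_all add: cinner_simps scaleR_conv_of_real)

lemmas tendsto_cinner [tendsto_intros] = bounded_bilinear.tendsto[OF bounded_bilinear_cinner]

lemma cinner_eq_zero_left: "(\<And>y. cinner x y = 0) \<Longrightarrow> (x::'a::chilbert_space) = 0"
  using cinner_self[of x] by simp

lemma cinner_ext_left: "(\<And>y. cinner x y = cinner x' y) \<Longrightarrow> x = (x'::'a::chilbert_space)"
  using cinner_eq_zero_left[of "x - x'"] by (simp add: cinner_simps)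

lemma cinner_ext_right: "(\<And>y. cinner y x = cinner y x') \<Longrightarrow> x = (x'::'a::chilbert_space)"
  by (rule cinner_ext_left) (metis cinner_commute)

text \<open>By the parallelogram law a minimising sequence for the distance from \<open>v\<close> to \<open>C\<close> is
  Cauchy, because midpoints stay in \<open>C\<close>. The variational inequality then comes from moving a
  little from the nearest point towards \<open>c\<close>.\<close>

lemma nearest_point:
  fixes v :: "'a::chilbert_space"
  assumes C: "closed C" "convex C" "C \<noteq> {}"
  obtains p where "p \<in> C" "\<And>c. c \<in> C \<Longrightarrow> Re (cinner (v - p) (c - p)) \<le> 0"
proof -
  define d where "d = infdist v C"
  have d_le: "d \<le> norm (v - c)" if "c \<in> C" for c
    using infdist_le[OF that, of v] by (simp add: d_def dist_norm)
  have d0: "d \<ge> 0" by (simp add: d_def infdist_nonneg)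
  have "\<exists>c\<in>C. norm (v - c) < d + 1 / Suc n" for n
  proof -
    have "bdd_below (dist v ` C)" by (rule bdd_belowI[of _ 0]) auto
    moreover have "(INF c\<in>C. dist v c) < d + 1 / Suc n"
      using C(3) by (simp add: d_def infdist_def)
    ultimately have "\<exists>c\<in>C. dist v c < d + 1 / Suc n"
      using C(3) by (simp add: cINF_less_iff)
    then show ?thesis by (simp add: dist_norm)
  qed
  then obtain X where X: "\<And>n. X n \<in> C" "\<And>n. norm (v - X n) < d + 1 / Suc n" by metis
  have par: "(norm (a - b))\<^sup>2 \<le> 2 * (norm (v - a))\<^sup>2 + 2 * (norm (v - b))\<^sup>2 - 4 * d\<^sup>2"
    if "a \<in> C" "b \<in> C" for a b
  proof -
    have "(1/2) *\<^sub>R a + (1/2) *\<^sub>R b \<in> C" using C(2) that by (simp add: convexD)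
    then have "d \<le> norm (v - ((1/2) *\<^sub>R a + (1/2) *\<^sub>R b))" by (rule d_le)
    also have "v - ((1/2) *\<^sub>R a + (1/2) *\<^sub>R b) = (1/2) *\<^sub>R ((v - a) + (v - b))"
      by (simp add: algebra_simps flip: scaleR_left.add)
    finally have "2 * d \<le> norm ((v - a) + (v - b))" by simp
    then have "4 * d\<^sup>2 \<le> (norm ((v - a) + (v - b)))\<^sup>2"
      using power_mono[of "2 * d" _ 2] d0 by (simp add: power_mult_distrib)
    moreover have "(norm (a - b))\<^sup>2 = (norm ((v - b) - (v - a)))\<^sup>2" by simp
    ultimately show ?thesis
      unfolding norm_diff_square[of "v - b"] norm_add_square
      using Re_cinner_commute[of "v - a" "v - b"] by linarith
  qed
  have "Cauchy X"
  proof (rule metric_CauchyI)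
    fix e :: real assume e: "e > 0"
    have "(\<lambda>n. 4 * (d + 1 / Suc n)\<^sup>2 - 4 * d\<^sup>2) \<longlonglongrightarrow> 4 * (d + 0)\<^sup>2 - 4 * d\<^sup>2"
      by (intro tendsto_intros LIMSEQ_Suc[OF lim_1_over_n])
    then have "\<forall>\<^sub>F n in sequentially. 4 * (d + 1 / Suc n)\<^sup>2 - 4 * d\<^sup>2 < e\<^sup>2"
      using e by (intro order_tendstoD(2)) auto
    then obtain N where N: "4 * (d + 1 / Suc N)\<^sup>2 - 4 * d\<^sup>2 < e\<^sup>2"
      by (auto simp: eventually_sequentially)
    have b: "(norm (v - X m))\<^sup>2 \<le> (d + 1 / Suc N)\<^sup>2" if "m \<ge> N" for m
    proof -
      have "1 / real (Suc m) \<le> 1 / real (Suc N)" using that by (simp add: frac_le)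
      then show ?thesis using X(2)[of m] by (intro power_mono) auto
    qed
    have "dist (X m) (X n) < e" if "m \<ge> N" "n \<ge> N" for m n
    proof -
      have "(norm (X m - X n))\<^sup>2 < e\<^sup>2"
        using par[OF X(1)[of m] X(1)[of n]] b[OF that(1)] b[OF that(2)] N by linarith
      then show ?thesis using e by (simp add: dist_norm power_less_imp_less_base)
    qed
    then show "\<exists>M. \<forall>m\<ge>M. \<forall>n\<ge>M. dist (X m) (X n) < e" by blast
  qed
  then obtain p where p: "X \<longlonglongrightarrow> p" using Cauchy_convergent convergent_def by blast
  have pC: "p \<in> C" using C(1) X(1) p closed_sequentially by blast
  have "(\<lambda>n. norm (v - X n)) \<longlonglongrightarrow> norm (v - p)" by (intro tendsto_intros p)
  moreover have "(\<lambda>n. d + 1 / Suc n) \<longlonglongrightarrow> d + 0"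
    by (intro tendsto_intros LIMSEQ_Suc[OF lim_1_over_n])
  ultimately have le: "norm (v - p) \<le> d"
    using X(2) by (intro LIMSEQ_le[of "\<lambda>n. norm (v - X n)" _ "\<lambda>n. d + 1 / Suc n"]) (auto intro: less_imp_le)
  have "Re (cinner (v - p) (c - p)) \<le> 0" if c: "c \<in> C" for c
  proof (rule ccontr)
    define r where "r = Re (cinner (v - p) (c - p))"
    assume "\<not> ?thesis"
    then have r: "r > 0" by (simp add: r_def)
    then have n0: "norm (c - p) > 0" by (auto simp: r_def)
    have ineq: "2 * r \<le> t * (norm (c - p))\<^sup>2" if t: "0 < t" "t \<le> 1" for t
    proof -
      have "(1 - t) *\<^sub>R p + t *\<^sub>R c \<in> C" using C(2) pC c t by (simp add: convexD)
      then have "d \<le> norm (v - ((1 - t) *\<^sub>R p + t *\<^sub>R c))" by (rule d_le)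
      also have "v - ((1 - t) *\<^sub>R p + t *\<^sub>R c) = (v - p) - t *\<^sub>R (c - p)"
        by (simp add: algebra_simps)
      finally have "(norm (v - p))\<^sup>2 \<le> (norm ((v - p) - t *\<^sub>R (c - p)))\<^sup>2"
        using le by (intro power_mono) auto
      also have "\<dots> = (norm (v - p))\<^sup>2 - 2 * t * r + t\<^sup>2 * (norm (c - p))\<^sup>2"
        by (simp add: norm_diff_square cinner_scaleR_right r_def power_mult_distrib)
      finally have "t * (2 * r) \<le> t * (t * (norm (c - p))\<^sup>2)"
        by (simp add: power2_eq_square algebra_simps)
      then show ?thesis using t by simp
    qed
    define t where "t = min 1 (r / (norm (c - p))\<^sup>2)"
    have "t > 0" "t \<le> 1" using r n0 by (auto simp: t_def)
    moreover have "t * (norm (c - p))\<^sup>2 \<le> r"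
      using n0 by (subst pos_le_divide_eq[symmetric]) (simp_all add: t_def)
    ultimately show False using ineq[of t] r by linarith
  qed
  then show ?thesis using pC that by blast
qed

lemma csubspace_minus: "csubspace N \<Longrightarrow> x \<in> N \<Longrightarrow> - x \<in> N"
  unfolding csubspace_def using scaleC_of_real[of "-1" x] by (metis scaleR_minus1_left)

lemma csubspace_diff: "csubspace N \<Longrightarrow> x \<in> N \<Longrightarrow> y \<in> N \<Longrightarrow> x - y \<in> N"
  using csubspace_minus[of N y] unfolding csubspace_def by (metis add_uminus_conv_diff)

lemma csubspace_scaleR: "csubspace N \<Longrightarrow> x \<in> N \<Longrightarrow> r *\<^sub>R x \<in> N"
  unfolding csubspace_def by (simp add: scaleR_scaleC)

lemma csubspace_convex: "csubspace N \<Longrightarrow> convex N"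
  unfolding convex_def by (simp add: csubspace_scaleR csubspace_def)

lemma csubspace_closure:
  fixes N :: "'a::chilbert_space set"
  assumes "csubspace N" shows "csubspace (closure N)"
  unfolding csubspace_def
proof (intro conjI ballI allI)
  show "0 \<in> closure N" using assms closure_subset unfolding csubspace_def by blast
next
  fix x y assume "x \<in> closure N" "y \<in> closure N"
  then obtain X Y where "\<And>n. X n \<in> N" "X \<longlonglongrightarrow> x" "\<And>n. Y n \<in> N" "Y \<longlonglongrightarrow> y"
    unfolding closure_sequential by blast
  then have "\<And>n. X n + Y n \<in> N" "(\<lambda>n. X n + Y n) \<longlonglongrightarrow> x + y"
    using assms by (auto simp: csubspace_def intro: tendsto_add)
  then show "x + y \<in> closure N"
    unfolding closure_sequential by (intro exI[of _ "\<lambda>n. X n + Y n"]) simp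
next
  fix c x assume "x \<in> closure N"
  then obtain X where X: "\<And>n. X n \<in> N" "X \<longlonglongrightarrow> x"
    unfolding closure_sequential by blast
  then have "(\<lambda>n. c *\<^sub>C X n) \<longlonglongrightarrow> c *\<^sub>C x"
    by (intro bounded_linear.tendsto[OF bounded_linear_scaleC])
  then show "c *\<^sub>C x \<in> closure N"
    unfolding closure_sequential using X assms
    by (intro exI[of _ "\<lambda>n. c *\<^sub>C X n"]) (simp add: csubspace_def)
qed

lemma orthogonal_projection:
  fixes v :: "'a::chilbert_space"
  assumes "closed N" "csubspace N"
  obtains p where "p \<in> N" "\<And>y. y \<in> N \<Longrightarrow> cinner (v - p) y = 0"
proof -
  have "N \<noteq> {}" using assms(2) by (auto simp: csubspace_def)
  then obtain p where p: "p \<in> N" and le: "\<And>c. c \<in> N \<Longrightarrow> Re (cinner (v - p) (c - p)) \<le> 0"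
    using nearest_point[OF assms(1) csubspace_convex[OF assms(2)]] by blast
  have le': "Re (cinner (v - p) y) \<le> 0" if "y \<in> N" for y
    using le[of "p + y"] p that assms(2) by (simp add: csubspace_def)
  have "cinner (v - p) y = 0" if y: "y \<in> N" for y
  proof -
    obtain c where c: "cmod c = 1" "c * cinner (v - p) y = complex_of_real (cmod (cinner (v - p) y))"
      using complex_phase by blast
    have "Re (cinner (v - p) (cnj c *\<^sub>C y)) \<le> 0"
      using y assms(2) by (intro le') (simp add: csubspace_def)
    then show ?thesis using c by (simp add: cinner_scaleC_right)
  qed
  then show ?thesis using p that by blast
qed

lemma clinear_add: "clinear f \<Longrightarrow> f (x + y) = f x + f y"
  and clinear_scaleC: "clinear f \<Longrightarrow> f (c *\<^sub>C x) = c *\<^sub>C f x"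
  by (simp_all add: clinear_def)

lemma clinear_zero: "clinear f \<Longrightarrow> f 0 = 0"
  using clinear_scaleC[of f 0 0] by simp

lemma clinear_minus: "clinear f \<Longrightarrow> f (- x) = - f x"
  using clinear_add[of f x "- x"] clinear_zero[of f] by (simp add: eq_neg_iff_add_eq_0 add.commute)

lemma clinear_diff: "clinear f \<Longrightarrow> f (x - y) = f x - f y"
  using clinear_add[of f x "- y"] clinear_minus[of f y] by simp

lemma clinear_scaleR: "clinear f \<Longrightarrow> f (r *\<^sub>R x) = r *\<^sub>R f x"
  by (simp add: scaleR_scaleC clinear_scaleC)

lemma clinear_sum: "clinear f \<Longrightarrow> f (\<Sum>i\<in>I. g i) = (\<Sum>i\<in>I. f (g i))"
  by (induction I rule: infinite_finite_induct) (simp_all add: clinear_zero clinear_add)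

lemma clinear_bounded_linear:
  assumes "clinear (f :: 'a::chilbert_space \<Rightarrow> 'b::chilbert_space)" "\<And>x. norm (f x) \<le> K * norm x"
  shows "bounded_linear f"
  using assms by (intro bounded_linear_intro[of f K])
    (auto simp: clinear_add clinear_scaleR mult.commute)

lemma Riesz_representation:
  fixes f :: "'a::chilbert_space \<Rightarrow> complex"
  assumes lin: "clinear f" and bd: "\<And>x. cmod (f x) \<le> K * norm x"
  obtains y where "\<And>x. f x = cinner x y"
proof (cases "\<forall>x. f x = 0")
  case True
  then show ?thesis using that[of 0] by simp
next
  case False
  then obtain v where v: "f v \<noteq> 0" by blast
  have bl: "bounded_linear f" by (rule clinear_bounded_linear[OF lin bd])
  define N where "N = {x. f x = 0}"
  have "closed N"
    unfolding N_def by (intro closed_Collect_eq continuous_intros linear_continuous_on bl)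
  moreover have "csubspace N"
    using lin by (auto simp: csubspace_def N_def clinear_zero clinear_add clinear_scaleC)
  ultimately obtain p where p: "p \<in> N" and orth: "\<And>y. y \<in> N \<Longrightarrow> cinner (v - p) y = 0"
    using orthogonal_projection by blast
  define w where "w = v - p"
  have fw: "f w = f v" using p lin by (simp add: w_def N_def clinear_diff)
  then have w0: "cinner w w \<noteq> 0" using v lin by (auto simp: cinner_self clinear_zero)
  have "f x = cinner x ((cnj (f w / cinner w w)) *\<^sub>C w)" for x
  proof -
    have "f (f w *\<^sub>C x - f x *\<^sub>C w) = 0"
      by (simp add: clinear_diff lin clinear_scaleC scaleC_complex_def)
    then have "cinner w (f w *\<^sub>C x - f x *\<^sub>C w) = 0" using orth by (simp add: w_def N_def)
    then have "cinner (f w *\<^sub>C x - f x *\<^sub>C w) w = 0" by (subst cinner_commute) simp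
    then show ?thesis using w0 by (simp add: cinner_simps field_simps)
  qed
  then show ?thesis by (rule that)
qed


section \<open>Bounded operators and adjoints\<close>

lemma bounded_linear_op: "bounded_linear (cblinfun_apply T)"
  using cblinfun_apply[of T] by simp

lemma clinear_op: "clinear (cblinfun_apply T)"
  using cblinfun_apply[of T] by simp

lemma op_ext: "(\<And>x. S *\<^sub>V x = T *\<^sub>V x) \<Longrightarrow> S = T"
  by (simp add: cblinfun_apply_inject[symmetric] fun_eq_iff)

lemma op_add: "T *\<^sub>V (x + y) = T *\<^sub>V x + T *\<^sub>V y"
  and op_diff: "T *\<^sub>V (x - y) = T *\<^sub>V x - T *\<^sub>V y"
  and op_minus: "T *\<^sub>V (- x) = - (T *\<^sub>V x)"
  and op_scaleC: "T *\<^sub>V (c *\<^sub>C x) = c *\<^sub>C (T *\<^sub>V x)"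
  and op_scaleR: "T *\<^sub>V (r *\<^sub>R x) = r *\<^sub>R (T *\<^sub>V x)"
  and op_zero [simp]: "T *\<^sub>V 0 = 0"
  and op_sum: "T *\<^sub>V (\<Sum>i\<in>I. g i) = (\<Sum>i\<in>I. T *\<^sub>V (g i))"
  using clinear_op[of T] by (simp_all add: clinear_add clinear_diff clinear_minus clinear_scaleC
      clinear_scaleR clinear_zero clinear_sum)

lemmas op_linear_simps = op_add op_diff op_minus op_scaleC op_scaleR op_sum

lemma add_op_apply [simp]: "(S + T) *\<^sub>V x = S *\<^sub>V x + T *\<^sub>V x"
  and diff_op_apply [simp]: "(S - T) *\<^sub>V x = S *\<^sub>V x - T *\<^sub>V x"
  and zero_op_apply [simp]: "0 *\<^sub>V x = 0"
  and scaleC_op_apply [simp]: "(c *\<^sub>C T) *\<^sub>V x = c *\<^sub>C (T *\<^sub>V x)"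
  and scaleR_op_apply [simp]: "(r *\<^sub>R T) *\<^sub>V x = r *\<^sub>R (T *\<^sub>V x)"
  and id_op_apply [simp]: "id_op *\<^sub>V z = z"
  by (transfer; simp)+

lemma comp_op_apply [simp]: "(S \<cdot> T) *\<^sub>V x = S *\<^sub>V (T *\<^sub>V x)"
  by transfer simp

lemma sum_op_apply [simp]: "(\<Sum>i\<in>I. f i) *\<^sub>V x = (\<Sum>i\<in>I. f i *\<^sub>V x)"
  by (induction I rule: infinite_finite_induct) simp_all

lemma comp_op_assoc: "(R \<cdot> S) \<cdot> T = R \<cdot> (S \<cdot> T)"
  by (rule op_ext) simp

lemma op_bound: obtains K where "K > 0" "\<And>x. norm (T *\<^sub>V x) \<le> K * norm x"
  using bounded_linear.pos_bounded[OF bounded_linear_op[of T]] by (metis mult.commute)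

lemma op_onorm: "norm (T *\<^sub>V x) \<le> onorm (cblinfun_apply T) * norm x"
  by (rule onorm[OF bounded_linear_op])

lemma tendsto_op [tendsto_intros]: "(f \<longlongrightarrow> l) F \<Longrightarrow> ((\<lambda>x. T *\<^sub>V f x) \<longlongrightarrow> T *\<^sub>V l) F"
  by (rule bounded_linear.tendsto[OF bounded_linear_op])

lemma op_exists:
  fixes f :: "'a::chilbert_space \<Rightarrow> 'b::chilbert_space"
  assumes "clinear f" "\<And>x. norm (f x) \<le> K * norm x"
  shows "cblinfun_apply (Abs_cblinfun f) = f"
  using assms clinear_bounded_linear by (intro Abs_cblinfun_inverse) auto

lemma sesquilinear_form_op:
  fixes \<beta> :: "'a::chilbert_space \<Rightarrow> 'b::chilbert_space \<Rightarrow> complex"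
  assumes l: "\<And>x x' y. \<beta> (x + x') y = \<beta> x y + \<beta> x' y" "\<And>c x y. \<beta> (c *\<^sub>C x) y = c * \<beta> x y"
    and r: "\<And>x y y'. \<beta> x (y + y') = \<beta> x y + \<beta> x y'" "\<And>c x y. \<beta> x (c *\<^sub>C y) = cnj c * \<beta> x y"
    and bd: "\<And>x y. cmod (\<beta> x y) \<le> K * norm x * norm y"
  obtains T where "\<And>x y. \<beta> x y = cinner (T *\<^sub>V x) y"
proof -
  have "\<exists>z. \<forall>y. \<beta> x y = cinner z y" for x
  proof -
    have "clinear (\<lambda>y. cnj (\<beta> x y))" by (simp add: clinear_def r scaleC_complex_def)
    moreover have "cmod (cnj (\<beta> x y)) \<le> (K * norm x) * norm y" for y using bd by simp
    ultimately obtain z where z: "\<And>y. cnj (\<beta> x y) = cinner y z"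
      using Riesz_representation by blast
    have "\<beta> x y = cinner z y" for y 
      by (subst cinner_commute) (simp flip: z)
    then show ?thesis by blast
  qed
  then have "\<exists>f. \<forall>x y. \<beta> x y = cinner (f x) y" by (intro choice allI)
  then obtain f where f: "\<And>x y. \<beta> x y = cinner (f x) y" by blast
  have "clinear f"
    unfolding clinear_def
    by (intro conjI allI; rule cinner_ext_left) (simp_all add: f[symmetric] l cinner_simps)
  moreover have "norm (f x) \<le> \<bar>K\<bar> * norm x" for x
  proof (cases "f x = 0")
    case False
    have "(norm (f x))\<^sup>2 = cmod (cinner (f x) (f x))" unfolding cinner_self by (simp add: norm_power)
    also have "\<dots> \<le> K * norm x * norm (f x)" unfolding f[symmetric] by (rule bd)
    finally have "norm (f x) \<le> K * norm x" using False by (simp add: power2_eq_square)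
    also have "\<dots> \<le> \<bar>K\<bar> * norm x" by (intro mult_right_mono) auto
    finally show ?thesis .
  qed simp
  ultimately have "cblinfun_apply (Abs_cblinfun f) = f" by (rule op_exists)
  then show ?thesis using that[of "Abs_cblinfun f"] f by simp
qed

lemma cinner_adj: "cinner (T *\<^sub>V x) y = cinner x (adj T *\<^sub>V y)"
proof -
  obtain K where K: "K > 0" "\<And>x. norm (T *\<^sub>V x) \<le> K * norm x"
    using op_bound[of T] by blast
  obtain R where R: "\<And>y x. cinner y (T *\<^sub>V x) = cinner (R *\<^sub>V y) x"
  proof (rule sesquilinear_form_op[of "\<lambda>y x. cinner y (T *\<^sub>V x)" K])
    show "cmod (cinner y (T *\<^sub>V x)) \<le> K * norm y * norm x" for x y
      using cinner_Cauchy_Schwarz[of y "T *\<^sub>V x"] K(2)[of x] mult_left_mono[of _ _ "norm y"]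
      by (fastforce simp: mult.assoc mult.left_commute)
  qed (auto simp: op_linear_simps cinner_simps)
  have ex: "\<forall>x y. cinner (T *\<^sub>V x) y = cinner x (R *\<^sub>V y)"
    by (intro allI, subst cinner_commute, subst R, subst cinner_commute) simp
  have "\<forall>x y. cinner (T *\<^sub>V x) y = cinner x (adj T *\<^sub>V y)"
    unfolding adj_def
  proof (rule theI)
    show "\<forall>x y. cinner (T *\<^sub>V x) y = cinner x (R *\<^sub>V y)" by (rule ex)
    show "R' = R" if "\<forall>x y. cinner (T *\<^sub>V x) y = cinner x (R' *\<^sub>V y)" for R'
      by (rule op_ext, rule cinner_ext_right) (use that ex in simp)
  qed
  then show ?thesis by blast
qed

lemma cinner_adj_left: "cinner (adj T *\<^sub>V x) y = cinner x (T *\<^sub>V y)"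
  by (subst (1 2) cinner_commute) (simp add: cinner_adj)

lemma adjI: "(\<And>x y. cinner (T *\<^sub>V x) y = cinner x (R *\<^sub>V y)) \<Longrightarrow> adj T = R"
  by (rule op_ext, rule cinner_ext_right) (simp add: cinner_adj[symmetric])

lemma adj_adj [simp]: "adj (adj T) = T"
  by (rule adjI) (rule cinner_adj_left)

lemma adj_comp: "adj (S \<cdot> T) = adj T \<cdot> adj S"
  by (rule adjI) (simp add: cinner_adj)

lemma adj_add: "adj (S + T) = adj S + adj T"
  and adj_diff: "adj (S - T) = adj S - adj T"
  and adj_scaleC: "adj (c *\<^sub>C T) = cnj c *\<^sub>C adj T"
  and adj_scaleR: "adj (r *\<^sub>R T) = r *\<^sub>R adj T"
  and adj_id [simp]: "adj id_op = id_op"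
  and adj_zero [simp]: "adj 0 = 0"
  by (rule adjI; simp add: cinner_simps cinner_adj)+

lemma projectionsD:
  assumes "P \<in> projections"
  shows "P *\<^sub>V (P *\<^sub>V x) = P *\<^sub>V x" "adj P = P" "cinner (P *\<^sub>V x) y = cinner x (P *\<^sub>V y)"
proof -
  from assms have 1: "P \<cdot> P = P" and 2: "adj P = P" by (auto simp: projections_def)
  show "P *\<^sub>V (P *\<^sub>V x) = P *\<^sub>V x" using arg_cong[OF 1, of "\<lambda>T. T *\<^sub>V x"] by simp
  show "adj P = P" by (rule 2)
  show "cinner (P *\<^sub>V x) y = cinner x (P *\<^sub>V y)" using cinner_adj[of P] 2 by simp
qed

lemma cinner_projection:
  assumes "P \<in> projections" shows "cinner (P *\<^sub>V x) x = complex_of_real ((norm (P *\<^sub>V x))\<^sup>2)"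
  using projectionsD(3)[OF assms, of "P *\<^sub>V x" x] by (simp add: projectionsD(1)[OF assms] cinner_self)

lemma projection_Pythagoras:
  assumes "P \<in> projections"
  shows "(norm x)\<^sup>2 = (norm (P *\<^sub>V x))\<^sup>2 + (norm (x - P *\<^sub>V x))\<^sup>2"
  unfolding norm_diff_square using Re_cinner_commute[of x "P *\<^sub>V x"]
  by (simp add: cinner_projection[OF assms])

lemma projection_norm_le:
  assumes "P \<in> projections" shows "norm (P *\<^sub>V x) \<le> norm x"
  by (rule power2_le_imp_le) (use projection_Pythagoras[OF assms, of x] in auto)

lemma id_projection: "id_op \<in> projections"
  and zero_projection: "0 \<in> projections"
  unfolding projections_def by (auto intro: op_ext)

lemma projection_onto:
  assumes N: "closed N" "csubspace N"
  obtains P where "P \<in> projections" "\<And>x. P *\<^sub>V x \<in> N" "\<And>x. x \<in> N \<Longrightarrow> P *\<^sub>V x = x"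
proof -
  have "\<exists>p. p \<in> N \<and> (\<forall>y\<in>N. cinner (v - p) y = 0)" for v
    using orthogonal_projection[OF N, of v] by metis
  then obtain f where f: "\<And>v. f v \<in> N" "\<And>v y. y \<in> N \<Longrightarrow> cinner (v - f v) y = 0" by metis
  have uniq: "f v = p" if "p \<in> N" "\<And>y. y \<in> N \<Longrightarrow> cinner (v - p) y = 0" for v p
  proof -
    have d: "f v - p \<in> N" using f(1) that(1) N(2) csubspace_diff by blast
    have "cinner (f v - p) (f v - p) = cinner (v - p) (f v - p) - cinner (v - f v) (f v - p)"
      by (simp add: cinner_simps)
    also have "\<dots> = 0" using that(2)[OF d] f(2)[OF d, of v] by simp
    finally show ?thesis by (simp add: cinner_self)
  qed
  have "clinear f"
    unfolding clinear_def
  proof (intro conjI allI)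
    show "f (x + y) = f x + f y" for x y
    proof (rule uniq)
      show "f x + f y \<in> N" using f(1) N(2) by (simp add: csubspace_def)
      show "cinner (x + y - (f x + f y)) z = 0" if "z \<in> N" for z
        using f(2)[OF that, of x] f(2)[OF that, of y] by (simp add: cinner_simps)
    qed
    show "f (c *\<^sub>C x) = c *\<^sub>C f x" for c x
    proof (rule uniq)
      show "c *\<^sub>C f x \<in> N" using f(1) N(2) by (simp add: csubspace_def)
      show "cinner (c *\<^sub>C x - c *\<^sub>C f x) z = 0" if "z \<in> N" for z
        using f(2)[OF that, of x] by (simp add: cinner_simps)
    qed
  qed
  moreover have "norm (f x) \<le> 1 * norm x" for x
  proof -
    have "cinner (x - f x) (f x) = 0" by (rule f(2)[OF f(1)])
    then have "(norm (x - f x + f x))\<^sup>2 = (norm (x - f x))\<^sup>2 + (norm (f x))\<^sup>2"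
      unfolding norm_add_square by simp
    then have "(norm (f x))\<^sup>2 \<le> (norm x)\<^sup>2" by simp
    then show ?thesis by simp
  qed
  ultimately have app: "cblinfun_apply (Abs_cblinfun f) = f" by (rule op_exists)
  let ?P = "Abs_cblinfun f"
  have fix1: "f x = x" if "x \<in> N" for x using that by (intro uniq) auto
  have "cinner (f x) y = cinner x (f y)" for x y
  proof -
    have "cinner (x - f x) (f y) = 0" "cinner (y - f y) (f x) = 0"
      by (rule f(2)[OF f(1)])+
    then have "cinner x (f y) = cinner (f x) (f y)" "cinner (f x) y = cinner (f x) (f y)"
      using cinner_commute[of "f x" "y - f y"] by (simp_all add: cinner_simps)
    then show ?thesis by simp
  qed
  then have "adj ?P = ?P" by (intro adjI) (simp add: app)
  moreover have "?P \<cdot> ?P = ?P" by (rule op_ext) (simp add: app fix1 f(1))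
  ultimately have "?P \<in> projections" by (simp add: projections_def)
  then show ?thesis using that[of ?P] f(1) fix1 by (simp add: app)
qed

text \<open>Invariance of the range under \<open>B\<close> means \<open>P B P = B P\<close>; invariance under the adjoint
  means \<open>P B P = P B\<close>.\<close>

lemma projection_commute:
  assumes P: "P \<in> projections"
    and inv: "\<And>x. P *\<^sub>V x = x \<Longrightarrow> P *\<^sub>V (B *\<^sub>V x) = B *\<^sub>V x"
    and inv': "\<And>x. P *\<^sub>V x = x \<Longrightarrow> P *\<^sub>V (adj B *\<^sub>V x) = adj B *\<^sub>V x"
  shows "P \<cdot> B = B \<cdot> P"
proof -
  have PP: "P \<cdot> P = P" "adj P = P" using P by (auto simp: projections_def)
  have 1: "P \<cdot> B \<cdot> P = B \<cdot> P" by (rule op_ext) (simp add: inv projectionsD(1)[OF P])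
  have "P \<cdot> adj B \<cdot> P = adj B \<cdot> P" by (rule op_ext) (simp add: inv' projectionsD(1)[OF P])
  from arg_cong[OF this, of adj] have "P \<cdot> B \<cdot> P = P \<cdot> B"
    by (simp add: adj_comp PP comp_op_assoc)
  with 1 show ?thesis by simp
qed

section \<open>Positive operators, square roots and spectral projections\<close>

definition positive_op :: "('a::chilbert_space, 'a) cblinfun \<Rightarrow> bool" where
  "positive_op A \<longleftrightarrow> adj A = A \<and> (\<forall>x. 0 \<le> Re (cinner (A *\<^sub>V x) x))"

text \<open>Expand the positive form at \<open>x - t A x\<close> with \<open>t = 1/c\<close>.\<close>

lemma positive_op_norm_bound:
  assumes A: "positive_op A" and c: "c \<ge> 0" and le: "\<And>x. Re (cinner (A *\<^sub>V x) x) \<le> c * (norm x)\<^sup>2"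
  shows "norm (A *\<^sub>V x) \<le> c * norm x"
proof -
  have sa: "cinner (A *\<^sub>V u) v = cinner u (A *\<^sub>V v)" for u v
    using A cinner_adj[of A] by (simp add: positive_op_def)
  define r where "r = Re (cinner (A *\<^sub>V x) x)"
  define n where "n = (norm (A *\<^sub>V x))\<^sup>2"
  define m where "m = Re (cinner (A *\<^sub>V (A *\<^sub>V x)) (A *\<^sub>V x))"
  have m: "m \<le> c * n" unfolding m_def n_def by (rule le)
  have quad: "0 \<le> r - 2 * t * n + t\<^sup>2 * m" for t
  proof -
    let ?y = "x - t *\<^sub>R (A *\<^sub>V x)"
    have "0 \<le> Re (cinner (A *\<^sub>V ?y) ?y)" using A by (simp add: positive_op_def)
    also have "cinner (A *\<^sub>V ?y) ?y = cinner (A *\<^sub>V x) x - t * cinner (A *\<^sub>V x) (A *\<^sub>V x)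
        - t * cinner (A *\<^sub>V (A *\<^sub>V x)) x + t * (t * cinner (A *\<^sub>V (A *\<^sub>V x)) (A *\<^sub>V x))"
      by (simp add: op_linear_simps cinner_simps algebra_simps)
    also have "cinner (A *\<^sub>V (A *\<^sub>V x)) x = cinner (A *\<^sub>V x) (A *\<^sub>V x)" by (rule sa)
    finally show ?thesis by (simp add: r_def n_def m_def power2_eq_square)
  qed
  have "n \<le> c * r"
  proof (cases "c = 0")
    case True
    have "m \<le> 0" using m True by simp
    have "r \<le> 0" using le[of x] True by (simp add: r_def)
    have "n \<le> 0" using quad[of 1] \<open>m \<le> 0\<close> \<open>r \<le> 0\<close> by simp
    then show ?thesis using True by simp
  next
    case False
    then have "c > 0" using c by simp
    have "(1/c)\<^sup>2 * m \<le> (1/c)\<^sup>2 * (c * n)" by (rule mult_left_mono[OF m]) simp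
    also have "\<dots> = n / c" using \<open>c > 0\<close> by (simp add: power2_eq_square)
    finally have "n / c \<le> r" using quad[of "1/c"] by simp
    then show ?thesis using \<open>c > 0\<close> by (simp add: pos_divide_le_eq mult.commute)
  qed
  also have "\<dots> \<le> c * (c * (norm x)\<^sup>2)"
    using c le[of x] by (intro mult_left_mono) (simp_all add: r_def)
  finally have "(norm (A *\<^sub>V x))\<^sup>2 \<le> (c * norm x)\<^sup>2"
    by (simp add: n_def power2_eq_square mult.assoc mult.left_commute)
  then show ?thesis using c power2_le_imp_le[of "norm (A *\<^sub>V x)" "c * norm x"] by simp
qed

text \<open>The polynomials \<open>X\<^sub>n\<close> of the iteration \<open>X \<mapsto> (A + X\<^sup>2)/2\<close> have nonnegative coefficients in
  \<open>A\<close>, so their increments are dominated by those of the scalar iteration for \<open>A = 1\<close>, which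
  increases to its fixed point \<open>1\<close>.\<close>

primrec sqrt_iter :: "nat \<Rightarrow> real" where
  "sqrt_iter 0 = 0"
| "sqrt_iter (Suc n) = (1 + (sqrt_iter n)\<^sup>2) / 2"

primrec sqrt_op_iter :: "('a::chilbert_space, 'a) cblinfun \<Rightarrow> nat \<Rightarrow> ('a, 'a) cblinfun" where
  "sqrt_op_iter A 0 = 0"
| "sqrt_op_iter A (Suc n) = (1/2) *\<^sub>R (A + sqrt_op_iter A n \<cdot> sqrt_op_iter A n)"

lemma sqrt_iter_bounds: "0 \<le> sqrt_iter n \<and> sqrt_iter n \<le> 1"
proof (induction n)
  case (Suc n)
  then have "(sqrt_iter n)\<^sup>2 \<le> 1" by (simp add: power_le_one)
  then show ?case by simp
qed simp

lemma sqrt_iter_mono: "sqrt_iter n \<le> sqrt_iter (Suc n)"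
  using sum_squares_bound[of "sqrt_iter n" 1] by simp

lemma sqrt_op_iter_Suc_apply:
  "sqrt_op_iter A (Suc n) *\<^sub>V x
    = (1/2) *\<^sub>R (A *\<^sub>V x + sqrt_op_iter A n *\<^sub>V (sqrt_op_iter A n *\<^sub>V x))"
  by simp

lemma sqrt_op_iter_norm:
  assumes A: "\<And>x. norm (A *\<^sub>V x) \<le> norm x"
  shows "norm (sqrt_op_iter A n *\<^sub>V x) \<le> sqrt_iter n * norm x"
proof (induction n arbitrary: x)
  case (Suc n)
  let ?X = "sqrt_op_iter A n" and ?a = "sqrt_iter n"
  have "norm (?X *\<^sub>V (?X *\<^sub>V x)) \<le> ?a * norm (?X *\<^sub>V x)" by (rule Suc)
  also have "\<dots> \<le> ?a * (?a * norm x)"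
    by (intro mult_left_mono Suc) (simp add: sqrt_iter_bounds)
  finally have "norm (A *\<^sub>V x + ?X *\<^sub>V (?X *\<^sub>V x)) \<le> norm x + ?a * (?a * norm x)"
    by (rule norm_triangle_le[OF add_mono[OF A]])
  then show ?case
    unfolding sqrt_op_iter_Suc_apply norm_scaleR by (simp add: power2_eq_square field_simps)
qed simp

lemma sqrt_op_iter_norm_le:
  assumes A: "\<And>x. norm (A *\<^sub>V x) \<le> norm x"
  shows "norm (sqrt_op_iter A n *\<^sub>V x) \<le> norm x"
proof -
  have "norm (sqrt_op_iter A n *\<^sub>V x) \<le> sqrt_iter n * norm x" by (rule sqrt_op_iter_norm[OF A])
  also have "\<dots> \<le> 1 * norm x" by (rule mult_right_mono) (simp_all add: sqrt_iter_bounds)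
  finally show ?thesis by simp
qed

lemma sqrt_op_iter_increment:
  assumes A: "\<And>x. norm (A *\<^sub>V x) \<le> norm x"
  shows "norm (sqrt_op_iter A (Suc n) *\<^sub>V x - sqrt_op_iter A n *\<^sub>V x)
      \<le> (sqrt_iter (Suc n) - sqrt_iter n) * norm x"
proof (induction n arbitrary: x)
  case 0
  then show ?case using A by simp
next
  case (Suc n)
  let ?X = "sqrt_op_iter A n" and ?Y = "sqrt_op_iter A (Suc n)"
  let ?a = "sqrt_iter n" and ?b = "sqrt_iter (Suc n)"
  have ab: "0 \<le> ?a" "?a \<le> ?b" "0 \<le> ?b"
    using sqrt_iter_bounds sqrt_iter_mono by blast+
  have "sqrt_op_iter A (Suc (Suc n)) *\<^sub>V x - ?Y *\<^sub>V x
      = (1/2) *\<^sub>R (A *\<^sub>V x + ?Y *\<^sub>V (?Y *\<^sub>V x)) - (1/2) *\<^sub>R (A *\<^sub>V x + ?X *\<^sub>V (?X *\<^sub>V x))"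
    by (rule arg_cong2[of _ _ _ _ minus]) (rule sqrt_op_iter_Suc_apply)+
  also have "\<dots> = (1/2) *\<^sub>R (?Y *\<^sub>V (?Y *\<^sub>V x) - ?X *\<^sub>V (?X *\<^sub>V x))"
    unfolding scaleR_right_diff_distrib[symmetric] add_diff_cancel_left ..
  also have "?Y *\<^sub>V (?Y *\<^sub>V x) - ?X *\<^sub>V (?X *\<^sub>V x)
      = ?Y *\<^sub>V (?Y *\<^sub>V x - ?X *\<^sub>V x) + (?Y *\<^sub>V (?X *\<^sub>V x) - ?X *\<^sub>V (?X *\<^sub>V x))"
    by (simp add: op_diff del: sqrt_op_iter.simps)
  finally have eq: "sqrt_op_iter A (Suc (Suc n)) *\<^sub>V x - ?Y *\<^sub>V x
      = (1/2) *\<^sub>R (?Y *\<^sub>V (?Y *\<^sub>V x - ?X *\<^sub>V x) + (?Y *\<^sub>V (?X *\<^sub>V x) - ?X *\<^sub>V (?X *\<^sub>V x)))" .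
  have "norm (?Y *\<^sub>V (?Y *\<^sub>V x - ?X *\<^sub>V x)) \<le> ?b * norm (?Y *\<^sub>V x - ?X *\<^sub>V x)"
    by (rule sqrt_op_iter_norm[OF A])
  also have "\<dots> \<le> ?b * ((?b - ?a) * norm x)" by (intro mult_left_mono Suc ab)
  finally have 1: "norm (?Y *\<^sub>V (?Y *\<^sub>V x - ?X *\<^sub>V x)) \<le> ?b * ((?b - ?a) * norm x)" .
  have "norm (?Y *\<^sub>V (?X *\<^sub>V x) - ?X *\<^sub>V (?X *\<^sub>V x)) \<le> (?b - ?a) * norm (?X *\<^sub>V x)" by (rule Suc)
  also have "\<dots> \<le> (?b - ?a) * (?a * norm x)"
    by (intro mult_left_mono sqrt_op_iter_norm[OF A]) (use ab in simp)
  finally have 2: "norm (?Y *\<^sub>V (?X *\<^sub>V x) - ?X *\<^sub>V (?X *\<^sub>V x)) \<le> (?b - ?a) * (?a * norm x)" .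
  have "norm (sqrt_op_iter A (Suc (Suc n)) *\<^sub>V x - ?Y *\<^sub>V x)
      \<le> (1/2) * (?b * ((?b - ?a) * norm x) + (?b - ?a) * (?a * norm x))"
    unfolding eq norm_scaleR using norm_triangle_le[OF add_mono[OF 1 2]]
    by (simp del: sqrt_op_iter.simps sqrt_iter.simps)
  also have "\<dots> = (1/2) * (?b\<^sup>2 - ?a\<^sup>2) * norm x"
    by (simp add: power2_eq_square algebra_simps del: sqrt_iter.simps)
  also have "(1/2) * (?b\<^sup>2 - ?a\<^sup>2) = sqrt_iter (Suc (Suc n)) - ?b"
    by (simp only: sqrt_iter.simps(2)[of "Suc n"])
      (simp add: field_simps)
  finally show ?case .
qed

text \<open>The limit \<open>X\<close> of the iteration satisfies \<open>X = (A + X\<^sup>2)/2\<close>, which is the claimed equation.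
  It exists even when \<open>\<parallel>A\<parallel> = 1\<close>, as the scalar iteration converges at \<open>1\<close>.\<close>

lemma sqrt_one_minus:
  assumes sa: "adj A = A" and A: "\<And>x. norm (A *\<^sub>V x) \<le> norm x"
  obtains X where "adj X = X" "\<And>x. norm (X *\<^sub>V x) \<le> norm x"
    "(id_op - X) \<cdot> (id_op - X) = id_op - A" "\<And>B. A \<cdot> B = B \<cdot> A \<Longrightarrow> X \<cdot> B = B \<cdot> X"
proof -
  let ?X = "sqrt_op_iter A" and ?a = "sqrt_iter"
  have "incseq ?a" by (rule incseq_SucI) (rule sqrt_iter_mono)
  then have "convergent ?a"
    using sqrt_iter_bounds by (intro Bseq_mono_convergent BseqI'[of _ 1])
      (auto simp: incseq_def)
  then have Ca: "Cauchy ?a" by (rule convergent_Cauchy)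
  have diff: "norm (?X (n + k) *\<^sub>V x - ?X n *\<^sub>V x) \<le> (?a (n + k) - ?a n) * norm x" for n k x
  proof (induction k)
    case (Suc k)
    have "norm (?X (n + Suc k) *\<^sub>V x - ?X n *\<^sub>V x)
        \<le> norm (?X (Suc (n + k)) *\<^sub>V x - ?X (n + k) *\<^sub>V x) + norm (?X (n + k) *\<^sub>V x - ?X n *\<^sub>V x)"
      using norm_triangle_ineq[of "?X (Suc (n + k)) *\<^sub>V x - ?X (n + k) *\<^sub>V x"
          "?X (n + k) *\<^sub>V x - ?X n *\<^sub>V x"] by (simp del: sqrt_op_iter.simps)
    also have "\<dots> \<le> (?a (Suc (n + k)) - ?a (n + k)) * norm x + (?a (n + k) - ?a n) * norm x"
      by (intro add_mono sqrt_op_iter_increment[OF A] Suc)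
    finally show ?case by (simp add: algebra_simps del: sqrt_iter.simps)
  qed simp
  have "Cauchy (\<lambda>n. ?X n *\<^sub>V x)" for x
  proof (rule metric_CauchyI)
    fix e :: real assume e: "e > 0"
    define e' where "e' = e / (norm x + 1)"
    have e': "e' > 0" using e by (simp add: e'_def add_nonneg_pos)
    then obtain M where M: "\<And>m n. m \<ge> M \<Longrightarrow> n \<ge> M \<Longrightarrow> dist (?a m) (?a n) < e'"
      using Ca unfolding Cauchy_def by blast
    have ord: "dist (?X m *\<^sub>V x) (?X n *\<^sub>V x) < e" if mn: "n \<ge> M" "m \<ge> n" for m n
    proof -
      have "norm (?X m *\<^sub>V x - ?X n *\<^sub>V x) \<le> (?a m - ?a n) * norm x"
        using diff[of n "m - n" x] mn by simp
      also have "\<dots> \<le> e' * norm x"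
        using M[of m n] mn by (intro mult_right_mono) (auto simp: dist_real_def)
      also have "\<dots> < e' * (norm x + 1)" using e' by simp
      also have "\<dots> = e" using norm_ge_zero[of x] by (simp add: e'_def add_nonneg_eq_0_iff)
      finally show ?thesis by (simp add: dist_norm)
    qed
    have "dist (?X m *\<^sub>V x) (?X n *\<^sub>V x) < e" if "m \<ge> M" "n \<ge> M" for m n
      using ord[of n m] ord[of m n] that by (cases "m \<ge> n") (auto simp: dist_commute)
    then show "\<exists>M. \<forall>m\<ge>M. \<forall>n\<ge>M. dist (?X m *\<^sub>V x) (?X n *\<^sub>V x) < e" by blast
  qed
  then have "\<exists>l. (\<lambda>n. ?X n *\<^sub>V x) \<longlonglongrightarrow> l" for x
    using Cauchy_convergent convergent_def by blast
  then obtain f where f: "\<And>x. (\<lambda>n. ?X n *\<^sub>V x) \<longlonglongrightarrow> f x" by metis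
  have nf: "norm (f x) \<le> 1 * norm x" for x
  proof (rule LIMSEQ_le_const2[OF tendsto_norm[OF f]])
    have "norm (?X n *\<^sub>V x) \<le> 1 * norm x" for n
      using sqrt_op_iter_norm_le[OF A] by simp
    then show "\<exists>N. \<forall>n\<ge>N. norm (?X n *\<^sub>V x) \<le> 1 * norm x" by blast
  qed
  have "clinear f"
    unfolding clinear_def
  proof (intro conjI allI)
    show "f (x + y) = f x + f y" for x y
      by (rule LIMSEQ_unique[OF f]) (simp add: op_add tendsto_add f)
    show "f (c *\<^sub>C x) = c *\<^sub>C f x" for c x
      by (rule LIMSEQ_unique[OF f])
        (simp add: op_scaleC bounded_linear.tendsto[OF bounded_linear_scaleC] f)
  qed
  then have app: "cblinfun_apply (Abs_cblinfun f) = f" using nf by (rule op_exists)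
  define X where "X = Abs_cblinfun f"
  have lim: "(\<lambda>n. ?X n *\<^sub>V x) \<longlonglongrightarrow> X *\<^sub>V x" for x using f by (simp add: X_def app)
  have nX: "norm (X *\<^sub>V x) \<le> norm x" for x using nf by (simp add: X_def app)
  have saX: "adj (?X n) = ?X n" for n
    by (induction n) (simp_all add: adj_scaleR adj_add adj_comp sa)
  have "adj X = X"
  proof (rule adjI)
    fix x y
    have "(\<lambda>n. cinner (?X n *\<^sub>V x) y) \<longlonglongrightarrow> cinner (X *\<^sub>V x) y" by (intro tendsto_intros lim)
    moreover have "(\<lambda>n. cinner (?X n *\<^sub>V x) y) \<longlonglongrightarrow> cinner x (X *\<^sub>V y)"
      unfolding cinner_adj[of "?X _"] saX by (intro tendsto_intros lim)
    ultimately show "cinner (X *\<^sub>V x) y = cinner x (X *\<^sub>V y)" by (rule LIMSEQ_unique)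
  qed
  moreover have "(id_op - X) \<cdot> (id_op - X) = id_op - A"
  proof (rule op_ext)
    fix x
    have "(\<lambda>n. ?X n *\<^sub>V (?X n *\<^sub>V x)) \<longlonglongrightarrow> X *\<^sub>V (X *\<^sub>V x)"
    proof (rule Lim_transform)
      show "(\<lambda>n. ?X n *\<^sub>V (X *\<^sub>V x)) \<longlonglongrightarrow> X *\<^sub>V (X *\<^sub>V x)" by (rule lim)
      have "(\<lambda>n. ?X n *\<^sub>V x - X *\<^sub>V x) \<longlonglongrightarrow> 0" by (rule LIM_zero[OF lim])
      then have "(\<lambda>n. ?X n *\<^sub>V (?X n *\<^sub>V x - X *\<^sub>V x)) \<longlonglongrightarrow> 0"
      proof (rule Lim_null_comparison[rotated, OF tendsto_norm_zero])
        show "\<forall>\<^sub>F n in sequentially. norm (?X n *\<^sub>V (?X n *\<^sub>V x - X *\<^sub>V x)) \<le> norm (?X n *\<^sub>V x - X *\<^sub>V x)"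
          by (intro always_eventually allI sqrt_op_iter_norm_le[OF A])
      qed
      then show "(\<lambda>n. ?X n *\<^sub>V (?X n *\<^sub>V x) - ?X n *\<^sub>V (X *\<^sub>V x)) \<longlonglongrightarrow> 0" by (simp add: op_diff)
    qed
    then have "(\<lambda>n. ?X (Suc n) *\<^sub>V x) \<longlonglongrightarrow> (1/2) *\<^sub>R (A *\<^sub>V x + X *\<^sub>V (X *\<^sub>V x))"
      by (simp, intro tendsto_intros)
    then have "X *\<^sub>V x = (1/2) *\<^sub>R (A *\<^sub>V x + X *\<^sub>V (X *\<^sub>V x))"
      using LIMSEQ_unique[OF LIMSEQ_Suc[OF lim]] by blast
    then have "2 *\<^sub>R (X *\<^sub>V x) = 2 *\<^sub>R ((1/2) *\<^sub>R (A *\<^sub>V x + X *\<^sub>V (X *\<^sub>V x)))" by simp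
    then have "X *\<^sub>V x + X *\<^sub>V x = A *\<^sub>V x + X *\<^sub>V (X *\<^sub>V x)" by (simp add: scaleR_2)
    then have "X *\<^sub>V (X *\<^sub>V x) = X *\<^sub>V x + X *\<^sub>V x - A *\<^sub>V x" by (simp add: algebra_simps)
    then show "((id_op - X) \<cdot> (id_op - X)) *\<^sub>V x = (id_op - A) *\<^sub>V x"
      by (simp add: op_diff algebra_simps)
  qed
  moreover have "X \<cdot> B = B \<cdot> X" if B: "A \<cdot> B = B \<cdot> A" for B
  proof (rule op_ext)
    fix x
    have AB: "A *\<^sub>V (B *\<^sub>V y) = B *\<^sub>V (A *\<^sub>V y)" for y
      using arg_cong[OF B, of "\<lambda>T. T *\<^sub>V y"] by simp
    have "?X n *\<^sub>V (B *\<^sub>V y) = B *\<^sub>V (?X n *\<^sub>V y)" for n y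
      by (induction n arbitrary: y) (simp_all add: AB op_linear_simps)
    moreover have "(\<lambda>n. B *\<^sub>V (?X n *\<^sub>V x)) \<longlonglongrightarrow> B *\<^sub>V (X *\<^sub>V x)" by (intro tendsto_intros lim)
    ultimately have "(\<lambda>n. ?X n *\<^sub>V (B *\<^sub>V x)) \<longlonglongrightarrow> B *\<^sub>V (X *\<^sub>V x)" by simp
    then show "(X \<cdot> B) *\<^sub>V x = (B \<cdot> X) *\<^sub>V x" using LIMSEQ_unique[OF lim] by simp
  qed
  ultimately show ?thesis by (intro that[of X] nX)
qed

text \<open>Scaling by the norm bound \<open>c\<close> writes \<open>C\<close> as \<open>c (1 - A)\<close> with a contraction \<open>A\<close>.\<close>

lemma positive_sqrt:
  assumes C: "positive_op C"
  obtains R where "positive_op R" "R \<cdot> R = C" "\<And>B. C \<cdot> B = B \<cdot> C \<Longrightarrow> R \<cdot> B = B \<cdot> R"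
proof -
  obtain c where c: "c > 0" "\<And>x. norm (C *\<^sub>V x) \<le> c * norm x"
    using op_bound[of C] by blast
  define A where "A = id_op - (1/c) *\<^sub>R C"
  have qle: "Re (cinner (C *\<^sub>V x) x) \<le> c * (norm x)\<^sup>2" for x
  proof -
    have "Re (cinner (C *\<^sub>V x) x) \<le> norm (C *\<^sub>V x) * norm x" by (rule Re_cinner_le_norm)
    also have "\<dots> \<le> c * norm x * norm x" by (rule mult_right_mono[OF c(2)]) simp
    finally show ?thesis by (simp add: power2_eq_square mult.assoc)
  qed
  have q: "Re (cinner (A *\<^sub>V x) x) = (norm x)\<^sup>2 - (1/c) * Re (cinner (C *\<^sub>V x) x)" for x
    by (simp add: A_def cinner_simps)
  have saA: "adj A = A" using C by (simp add: A_def adj_diff adj_scaleR positive_op_def)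
  moreover have "0 \<le> Re (cinner (A *\<^sub>V x) x)" for x
    using qle[of x] c(1) by (simp add: q field_simps)
  ultimately have posA: "positive_op A" by (simp add: positive_op_def)
  have nA: "norm (A *\<^sub>V x) \<le> norm x" for x
  proof -
    have "Re (cinner (A *\<^sub>V x) x) \<le> 1 * (norm x)\<^sup>2" for x
      using C c(1) by (simp add: q positive_op_def)
    then have "norm (A *\<^sub>V x) \<le> 1 * norm x" by (intro positive_op_norm_bound posA) auto
    then show ?thesis by simp
  qed
  obtain X where X: "adj X = X" "\<And>x. norm (X *\<^sub>V x) \<le> norm x"
    "(id_op - X) \<cdot> (id_op - X) = id_op - A" "\<And>B. A \<cdot> B = B \<cdot> A \<Longrightarrow> X \<cdot> B = B \<cdot> X"
    using sqrt_one_minus[OF saA nA] by blast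
  define R where "R = sqrt c *\<^sub>R (id_op - X)"
  have "positive_op R"
    unfolding positive_op_def
  proof (intro conjI allI)
    show "adj R = R" by (simp add: R_def adj_scaleR adj_diff X(1))
    fix x
    have "Re (cinner (X *\<^sub>V x) x) \<le> norm (X *\<^sub>V x) * norm x" by (rule Re_cinner_le_norm)
    also have "\<dots> \<le> norm x * norm x" by (rule mult_right_mono[OF X(2)]) simp
    finally have "Re (cinner (X *\<^sub>V x) x) \<le> (norm x)\<^sup>2" by (simp add: power2_eq_square)
    then show "0 \<le> Re (cinner (R *\<^sub>V x) x)"
      using c(1) by (simp add: R_def cinner_simps)
  qed
  moreover have "R \<cdot> R = C"
  proof (rule op_ext)
    fix x
    have "(R \<cdot> R) *\<^sub>V x = c *\<^sub>R (((id_op - X) \<cdot> (id_op - X)) *\<^sub>V x)"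
      using c(1) by (simp add: R_def op_linear_simps scaleR_diff_right)
    also have "\<dots> = C *\<^sub>V x" unfolding X(3) using c(1) by (simp add: A_def)
    finally show "(R \<cdot> R) *\<^sub>V x = C *\<^sub>V x" .
  qed
  moreover have "R \<cdot> B = B \<cdot> R" if B: "C \<cdot> B = B \<cdot> C" for B
  proof -
    have "C *\<^sub>V (B *\<^sub>V y) = B *\<^sub>V (C *\<^sub>V y)" for y
      using arg_cong[OF B, of "\<lambda>T. T *\<^sub>V y"] by simp
    then have "A \<cdot> B = B \<cdot> A" by (intro op_ext) (simp add: A_def op_linear_simps)
    from X(4)[OF this] have XB: "X *\<^sub>V (B *\<^sub>V y) = B *\<^sub>V (X *\<^sub>V y)" for y
      by (metis comp_op_apply)
    show ?thesis by (rule op_ext) (simp add: R_def op_linear_simps XB)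
  qed
  ultimately show ?thesis by (intro that[of R])
qed

text \<open>The spectral projection of \<open>A\<close> for \<open>[t, \<infinity>)\<close> projects onto the kernel of \<open>|X| - X\<close> with
  \<open>X = A - t\<close>. As \<open>(|X| - X)(|X| + X) = 0\<close>, the operator \<open>X\<close> equals \<open>|X|\<close> on this kernel and
  \<open>-|X|\<close>, in the sense of quadratic forms, on its orthogonal complement.\<close>

lemma spectral_projection:
  fixes t :: real
  assumes sa: "adj A = A"
  obtains E where "E \<in> projections" "\<And>B. A \<cdot> B = B \<cdot> A \<Longrightarrow> E \<cdot> B = B \<cdot> E"
    "\<And>x. E *\<^sub>V x = x \<Longrightarrow> t * (norm x)\<^sup>2 \<le> Re (cinner (A *\<^sub>V x) x)"
    "\<And>x. E *\<^sub>V x = 0 \<Longrightarrow> Re (cinner (A *\<^sub>V x) x) \<le> t * (norm x)\<^sup>2"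
proof -
  define X where "X = A - t *\<^sub>R id_op"
  have saX: "adj X = X" by (simp add: X_def adj_diff adj_scaleR sa)
  have qX: "Re (cinner (X *\<^sub>V x) x) = Re (cinner (A *\<^sub>V x) x) - t * (norm x)\<^sup>2" for x
    by (simp add: X_def cinner_simps)
  have "positive_op (X \<cdot> X)"
    unfolding positive_op_def
  proof (intro conjI allI)
    show "adj (X \<cdot> X) = X \<cdot> X" by (simp add: adj_comp saX)
    fix x
    have "cinner ((X \<cdot> X) *\<^sub>V x) x = cinner (X *\<^sub>V x) (X *\<^sub>V x)"
      using cinner_adj[of X "X *\<^sub>V x" x] by (simp add: saX)
    then show "0 \<le> Re (cinner ((X \<cdot> X) *\<^sub>V x) x)" by simp
  qed
  then obtain Y where Y: "positive_op Y" "Y \<cdot> Y = X \<cdot> X"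
    "\<And>B. (X \<cdot> X) \<cdot> B = B \<cdot> (X \<cdot> X) \<Longrightarrow> Y \<cdot> B = B \<cdot> Y"
    using positive_sqrt by blast
  have comX: "X *\<^sub>V (B *\<^sub>V y) = B *\<^sub>V (X *\<^sub>V y)" and comY: "Y *\<^sub>V (B *\<^sub>V y) = B *\<^sub>V (Y *\<^sub>V y)"
    if B: "A \<cdot> B = B \<cdot> A" for B y
  proof -
    have AB: "A *\<^sub>V (B *\<^sub>V y) = B *\<^sub>V (A *\<^sub>V y)" for y
      using arg_cong[OF B, of "\<lambda>T. T *\<^sub>V y"] by simp
    then show X: "X *\<^sub>V (B *\<^sub>V y) = B *\<^sub>V (X *\<^sub>V y)" for y by (simp add: X_def op_linear_simps)
    have "(X \<cdot> X) \<cdot> B = B \<cdot> (X \<cdot> X)" by (rule op_ext) (simp add: X)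
    from arg_cong[OF Y(3)[OF this], of "\<lambda>T. T *\<^sub>V y"]
    show "Y *\<^sub>V (B *\<^sub>V y) = B *\<^sub>V (Y *\<^sub>V y)" by simp
  qed
  have XY: "X *\<^sub>V (Y *\<^sub>V y) = Y *\<^sub>V (X *\<^sub>V y)" for y
    using arg_cong[OF Y(3)[OF comp_op_assoc], of "\<lambda>T. T *\<^sub>V y"] by simp
  have YY: "Y *\<^sub>V (Y *\<^sub>V y) = X *\<^sub>V (X *\<^sub>V y)" for y
    using arg_cong[OF Y(2), of "\<lambda>T. T *\<^sub>V y"] by simp
  define N where "N = {x. Y *\<^sub>V x = X *\<^sub>V x}"
  have "closed N"
    unfolding N_def by (intro closed_Collect_eq linear_continuous_on bounded_linear_op)
  moreover have "csubspace N" by (simp add: csubspace_def N_def op_linear_simps)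
  ultimately obtain E where E: "E \<in> projections" "\<And>x. E *\<^sub>V x \<in> N" "\<And>x. x \<in> N \<Longrightarrow> E *\<^sub>V x = x"
    using projection_onto by blast
  have mem: "x \<in> N" if "E *\<^sub>V x = x" for x using E(2)[of x] that by simp
  show ?thesis
  proof (rule that[OF E(1)])
    fix B assume B: "A \<cdot> B = B \<cdot> A"
    have B': "A \<cdot> adj B = adj B \<cdot> A"
      using arg_cong[OF B, of adj] by (simp add: adj_comp sa)
    show "E \<cdot> B = B \<cdot> E"
      by (rule projection_commute[OF E(1)]; rule E(3))
        (use mem in \<open>auto simp: N_def comX[OF B] comY[OF B] comX[OF B'] comY[OF B']\<close>)
  next
    fix x assume "E *\<^sub>V x = x"
    then have "X *\<^sub>V x = Y *\<^sub>V x" using mem by (simp add: N_def)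
    then have "0 \<le> Re (cinner (X *\<^sub>V x) x)" using Y(1) by (simp add: positive_op_def)
    then show "t * (norm x)\<^sup>2 \<le> Re (cinner (A *\<^sub>V x) x)" by (simp add: qX)
  next
    fix x assume x: "E *\<^sub>V x = 0"
    have "Y *\<^sub>V x + X *\<^sub>V x \<in> N" by (simp add: N_def op_add XY YY add.commute)
    then have "cinner (Y *\<^sub>V x + X *\<^sub>V x) x = cinner (E *\<^sub>V (Y *\<^sub>V x + X *\<^sub>V x)) x" by (simp add: E(3))
    also have "\<dots> = 0" by (simp add: projectionsD(3)[OF E(1)] x)
    finally have "cinner (X *\<^sub>V x) x = - cinner (Y *\<^sub>V x) x"
      by (simp add: cinner_add_left eq_neg_iff_add_eq_0 add.commute)
    then have "Re (cinner (X *\<^sub>V x) x) \<le> 0" using Y(1) by (simp add: positive_op_def)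
    then show "Re (cinner (A *\<^sub>V x) x) \<le> t * (norm x)\<^sup>2" by (simp add: qX)
  qed
qed

lemma op_commute_apply: "A \<cdot> B = B \<cdot> A \<Longrightarrow> A *\<^sub>V (B *\<^sub>V x) = B *\<^sub>V (A *\<^sub>V x)"
  by (metis comp_op_apply)

lemma adj_sum: "adj (\<Sum>i\<in>I. f i) = (\<Sum>i\<in>I. adj (f i))"
  by (induction I rule: infinite_finite_induct) (simp_all add: adj_add)

lemma cinner_sum_left: "cinner (\<Sum>i\<in>I. f i) y = (\<Sum>i\<in>I. cinner (f i) y)"
  and cinner_sum_right: "cinner y (\<Sum>i\<in>I. f i) = (\<Sum>i\<in>I. cinner y (f i))"
  by (induction I rule: infinite_finite_induct) (simp_all add: cinner_add_left cinner_add_right)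

lemma scaleC_minus_left: "(- c) *\<^sub>C x = - (c *\<^sub>C (x::'a::complex_vector))"
  using scaleC_add_left[of c "- c" x] by (simp add: eq_neg_iff_add_eq_0 add.commute)

text \<open>The operator is approximated by the average of its spectral projections for the intervals
  \<open>[k/n, \<infinity>)\<close>: on the part of the space between the projections number \<open>k\<close> and \<open>k + 1\<close> the
  average is \<open>k/n\<close> and the operator lies between \<open>k/n\<close> and \<open>(k + 1)/n\<close>. The estimate is a
  summation by parts for quadratic forms.\<close>

lemma spectral_layer_sum:
  fixes n :: nat
  assumes A: "positive_op A" and A1: "\<And>x. Re (cinner (A *\<^sub>V x) x) \<le> (norm x)\<^sup>2" and n: "n > 0"
  obtains E where "\<And>k. E k \<in> projections" "\<And>k B. A \<cdot> B = B \<cdot> A \<Longrightarrow> E k \<cdot> B = B \<cdot> E k"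
    "\<And>k x. E k *\<^sub>V x = x \<Longrightarrow> real k / real n * (norm x)\<^sup>2 \<le> Re (cinner (A *\<^sub>V x) x)"
    "\<And>x. norm ((A - (1 / real n) *\<^sub>R (\<Sum>k=1..n. E k)) *\<^sub>V x) \<le> 1 / real n * norm x"
proof -
  have saA: "adj A = A" using A by (simp add: positive_op_def)
  define q where "q x = Re (cinner (A *\<^sub>V x) x)" for x
  have q0: "0 \<le> q x" for x using A by (simp add: q_def positive_op_def)
  have "\<exists>E. E \<in> projections \<and> (\<forall>B. A \<cdot> B = B \<cdot> A \<longrightarrow> E \<cdot> B = B \<cdot> E)
      \<and> (\<forall>x. E *\<^sub>V x = x \<longrightarrow> real k / real n * (norm x)\<^sup>2 \<le> q x)
      \<and> (\<forall>x. E *\<^sub>V x = 0 \<longrightarrow> q x \<le> real k / real n * (norm x)\<^sup>2)" for k :: nat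
    unfolding q_def by (rule spectral_projection[OF saA, of "real k / real n"]) blast
  then obtain E0 where E0: "\<And>k. E0 k \<in> projections" "\<And>k B. A \<cdot> B = B \<cdot> A \<Longrightarrow> E0 k \<cdot> B = B \<cdot> E0 k"
      "\<And>k x. E0 k *\<^sub>V x = x \<Longrightarrow> real k / real n * (norm x)\<^sup>2 \<le> q x"
      "\<And>k x. E0 k *\<^sub>V x = 0 \<Longrightarrow> q x \<le> real k / real n * (norm x)\<^sup>2"
    by metis
  \<comment> \<open>The values at \<open>0\<close> and beyond \<open>n\<close> are fixed by hand so that the telescoping sums below
    start at the identity and end at zero.\<close>
  define E where "E k = (if k = 0 then id_op else if k > n then 0 else E0 k)" for k
  have pr: "E k \<in> projections" for k by (simp add: E_def E0 id_projection zero_projection)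
  have com: "E k \<cdot> B = B \<cdot> E k" if "A \<cdot> B = B \<cdot> A" for k B
  proof -
    have "id_op \<cdot> B = B \<cdot> id_op" "0 \<cdot> B = B \<cdot> 0" by (rule op_ext, simp)+
    then show ?thesis using E0(2)[OF that] by (simp add: E_def)
  qed
  have lo: "real k / real n * (norm x)\<^sup>2 \<le> q x" if "E k *\<^sub>V x = x" for k x
    using that E0(3)[of k x] q0[of x] by (auto simp: E_def split: if_splits)
  have hi: "q x \<le> real k / real n * (norm x)\<^sup>2" if x: "E k *\<^sub>V x = 0" for k x
  proof (cases "k > n")
    case True
    have "1 * (norm x)\<^sup>2 \<le> real k / real n * (norm x)\<^sup>2"
      using True n by (intro mult_right_mono) simp_all
    then show ?thesis using A1[of x] by (simp add: q_def)
  next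
    case False
    then show ?thesis using x E0(4)[of k x] by (auto simp: E_def q_def split: if_splits)
  qed
  have EA: "E k *\<^sub>V (A *\<^sub>V x) = A *\<^sub>V (E k *\<^sub>V x)" for k x
    by (rule op_commute_apply[OF com[OF refl]])
  have EE: "E j *\<^sub>V (E k *\<^sub>V x) = E k *\<^sub>V (E j *\<^sub>V x)" for j k x
    by (rule op_commute_apply[OF com]) (rule com[OF refl, symmetric])
  have mono: "E k *\<^sub>V (E (Suc k) *\<^sub>V x) = E (Suc k) *\<^sub>V x" for k x
  proof -
    define y where "y = E (Suc k) *\<^sub>V x - E k *\<^sub>V (E (Suc k) *\<^sub>V x)"
    have "E (Suc k) *\<^sub>V y = y"
      by (simp add: y_def op_diff EE[of "Suc k" k] projectionsD(1)[OF pr])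
    moreover have "E k *\<^sub>V y = 0" by (simp add: y_def op_diff projectionsD(1)[OF pr])
    ultimately have "real (Suc k) / real n * (norm y)\<^sup>2 \<le> real k / real n * (norm y)\<^sup>2"
      using lo[of "Suc k" y] hi[of k y] by linarith
    then have "1 / real n * (norm y)\<^sup>2 \<le> 0" by (simp add: add_divide_distrib algebra_simps)
    then have "y = 0" using n by (simp add: divide_le_0_iff)
    then show ?thesis by (simp add: y_def)
  qed
  define D where "D = A - (1 / real n) *\<^sub>R (\<Sum>k=1..n. E k)"
  have qD: "0 \<le> Re (cinner (D *\<^sub>V x) x) \<and> Re (cinner (D *\<^sub>V x) x) \<le> 1 / real n * (norm x)\<^sup>2" for x
  proof -
    define r where "r k = Re (cinner (A *\<^sub>V (E k *\<^sub>V x)) x)" for k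
    define s where "s k = Re (cinner (E k *\<^sub>V x) x)" for k
    have step: "real k / real n * (s k - s (Suc k)) \<le> r k - r (Suc k)"
        "r k - r (Suc k) \<le> real (Suc k) / real n * (s k - s (Suc k))" for k
    proof -
      define y where "y = E k *\<^sub>V x - E (Suc k) *\<^sub>V x"
      have y1: "E k *\<^sub>V y = y" by (simp add: y_def op_diff mono projectionsD(1)[OF pr])
      have y2: "E (Suc k) *\<^sub>V y = 0"
        by (simp add: y_def op_diff EE[of "Suc k" k] mono projectionsD(1)[OF pr])
      have "cinner z y = cinner (E k *\<^sub>V z - E (Suc k) *\<^sub>V z) x" for z
        by (simp add: y_def cinner_simps projectionsD(3)[OF pr])
      then have "cinner y y = cinner y x" "cinner (A *\<^sub>V y) y = cinner (A *\<^sub>V y) x"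
        by (simp_all add: EA y1 y2)
      then have "(norm y)\<^sup>2 = s k - s (Suc k)" "q y = r k - r (Suc k)"
        unfolding q_def Re_cinner_self[symmetric]
        by (simp_all add: y_def s_def r_def op_diff cinner_simps)
      then show "real k / real n * (s k - s (Suc k)) \<le> r k - r (Suc k)"
        "r k - r (Suc k) \<le> real (Suc k) / real n * (s k - s (Suc k))"
        using lo[OF y1] hi[OF y2] by auto
    qed
    have parts: "1 / real n * (\<Sum>k=1..m. s k) - real m / real n * s m \<le> r 0 - r m
        \<and> r 0 - r m \<le> 1 / real n * (\<Sum>k=1..m. s k) - real m / real n * s m + 1 / real n * (s 0 - s m)"
      for m
    proof (induction m)
      case (Suc m)
      then show ?case using step[of m] n by (simp add: add_divide_distrib algebra_simps)
    qed simp
    have end0: "r (Suc n) = 0" "s (Suc n) = 0" "r 0 = q x" "s 0 = (norm x)\<^sup>2"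
      by (simp_all add: r_def s_def E_def q_def)
    have "Re (cinner (D *\<^sub>V x) x) = q x - 1 / real n * (\<Sum>k=1..n. s k)"
      by (simp add: D_def cinner_simps q_def s_def cinner_sum_left)
    then show ?thesis using parts[of "Suc n"] by (simp add: end0)
  qed
  have "adj D = D"
    by (simp add: D_def adj_diff adj_scaleR adj_sum saA projectionsD(2)[OF pr])
  then have "norm (D *\<^sub>V x) \<le> 1 / real n * norm x" for x
    by (intro positive_op_norm_bound) (use qD n in \<open>auto simp: positive_op_def\<close>)
  then show ?thesis using that[of E] pr com lo by (simp add: D_def q_def)
qed

text \<open>The operator \<open>U\<close> stands for the amplification of \<open>T\<close>. For \<open>x\<close> in the range of \<open>E\<close> the
  vector \<open>U V x = W T x\<close> has a \<open>Q\<close>-component of squared norm at least \<open>b \<parallel>T x\<parallel>\<^sup>2\<close>, but only the part of \<open>V x\<close> outside \<open>P\<close>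
  contributes to it, and the squared norm of that part is at most \<open>(1 - a) \<parallel>x\<parallel>\<^sup>2\<close>. Since
  \<open>b > 1 - a\<close>, this bounds \<open>\<parallel>T\<parallel>\<close> by a proper fraction of itself.\<close>

lemma spectral_corner_zero:
  fixes T :: "('a::chilbert_space, 'b::chilbert_space) cblinfun"
    and U :: "('c::chilbert_space, 'd::chilbert_space) cblinfun"
  assumes P: "P \<in> projections" and Q: "Q \<in> projections"
    and E: "E \<in> projections" and F: "F \<in> projections"
    and V: "\<And>x. norm (V *\<^sub>V x) = norm x"
    and UV: "\<And>x. U *\<^sub>V (V *\<^sub>V x) = W *\<^sub>V (T *\<^sub>V x)"
    and U: "\<And>z. norm (U *\<^sub>V z) \<le> onorm (cblinfun_apply T) * norm z"
    and QUP: "\<And>z. Q *\<^sub>V (U *\<^sub>V (P *\<^sub>V z)) = 0"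
    and T: "F \<cdot> T \<cdot> E = T"
    and a: "\<And>x. E *\<^sub>V x = x \<Longrightarrow> a * (norm x)\<^sup>2 \<le> (norm (P *\<^sub>V (V *\<^sub>V x)))\<^sup>2"
    and b: "\<And>y. F *\<^sub>V y = y \<Longrightarrow> b * (norm y)\<^sup>2 \<le> (norm (Q *\<^sub>V (W *\<^sub>V y)))\<^sup>2"
    and ab: "a \<le> 1" "a + b > 1"
  shows "T = 0"
proof -
  define c where "c = onorm (cblinfun_apply T)"
  have c0: "c \<ge> 0" by (simp add: c_def onorm_pos_le[OF bounded_linear_op])
  have b0: "b > 0" using ab by simp
  have T_apply: "T *\<^sub>V x = F *\<^sub>V (T *\<^sub>V (E *\<^sub>V x))" for x
    using arg_cong[OF T, of "\<lambda>T. T *\<^sub>V x"] by simp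
  have main: "b * (norm (T *\<^sub>V x))\<^sup>2 \<le> c\<^sup>2 * ((1 - a) * (norm x)\<^sup>2)" for x
  proof -
    define u where "u = E *\<^sub>V x"
    have Eu: "E *\<^sub>V u = u" by (simp add: u_def projectionsD(1)[OF E])
    have "T *\<^sub>V u = F *\<^sub>V (T *\<^sub>V u)" using T_apply[of u] unfolding Eu .
    also have "\<dots> = T *\<^sub>V x" unfolding u_def by (rule T_apply[of x, symmetric])
    finally have Tu: "T *\<^sub>V u = T *\<^sub>V x" .
    have "F *\<^sub>V (T *\<^sub>V x) = T *\<^sub>V x" using T_apply[of x] projectionsD(1)[OF F] by metis
    then have "b * (norm (T *\<^sub>V x))\<^sup>2 \<le> (norm (Q *\<^sub>V (W *\<^sub>V (T *\<^sub>V x))))\<^sup>2" by (rule b)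
    also have "Q *\<^sub>V (W *\<^sub>V (T *\<^sub>V x)) = Q *\<^sub>V (U *\<^sub>V (V *\<^sub>V u - P *\<^sub>V (V *\<^sub>V u)))"
      by (simp add: op_diff UV QUP Tu)
    also have "(norm \<dots>)\<^sup>2 \<le> (c * norm (V *\<^sub>V u - P *\<^sub>V (V *\<^sub>V u)))\<^sup>2"
      using order_trans[OF projection_norm_le[OF Q] U] by (intro power_mono) (simp_all add: c_def)
    also have "\<dots> = c\<^sup>2 * ((norm u)\<^sup>2 - (norm (P *\<^sub>V (V *\<^sub>V u)))\<^sup>2)"
      using projection_Pythagoras[OF P, of "V *\<^sub>V u"] by (simp add: V power_mult_distrib)
    also have "\<dots> \<le> c\<^sup>2 * ((1 - a) * (norm u)\<^sup>2)"
      using a[OF Eu] by (intro mult_left_mono) (simp_all add: algebra_simps)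
    also have "\<dots> \<le> c\<^sup>2 * ((1 - a) * (norm x)\<^sup>2)"
      using ab(1) projection_norm_le[OF E, of x]
      by (intro mult_left_mono power_mono) (simp_all add: u_def)
    finally show ?thesis .
  qed
  define \<rho> where "\<rho> = sqrt ((1 - a) / b)"
  have \<rho>: "0 \<le> \<rho>" "\<rho> < 1" "\<rho>\<^sup>2 = (1 - a) / b"
    using ab b0 by (simp_all add: \<rho>_def real_sqrt_lt_1_iff pos_divide_less_eq)
  have "norm (T *\<^sub>V x) \<le> (c * \<rho>) * norm x" for x
  proof (rule power2_le_imp_le)
    have "(norm (T *\<^sub>V x))\<^sup>2 \<le> (c\<^sup>2 * ((1 - a) * (norm x)\<^sup>2)) / b"
      using main[of x] b0 by (simp add: pos_le_divide_eq mult.commute)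
    also have "\<dots> = (c * \<rho> * norm x)\<^sup>2" by (simp add: power_mult_distrib \<rho>(3))
    finally show "(norm (T *\<^sub>V x))\<^sup>2 \<le> (c * \<rho> * norm x)\<^sup>2" .
    show "0 \<le> c * \<rho> * norm x" using c0 \<rho> by simp
  qed
  then have "c \<le> c * \<rho>"
    unfolding c_def using c0 \<rho> by (intro onorm_bound) (simp_all add: c_def)
  then have "c * (1 - \<rho>) \<le> 0" by (simp add: algebra_simps)
  then have "c = 0" using c0 \<rho>(2) by (simp add: mult_le_0_iff)
  then show ?thesis
    using op_onorm[of T] by (intro op_ext) (simp add: c_def)
qed


section \<open>States\<close>

lemma stateD:
  fixes A :: "('a::chilbert_space, 'a) cblinfun"
  assumes "state \<phi>"
  shows "clinear \<phi>" "\<phi> id_op = 1" "Im (\<phi> (adj A \<cdot> A)) = 0" "0 \<le> Re (\<phi> (adj A \<cdot> A))"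
  using assms by (auto simp: state_def complex_is_Real_iff)

text \<open>The square root writes a positive operator in the form \<open>R\<^sup>* R\<close>.\<close>

lemma state_positive:
  assumes "state \<phi>" "positive_op A" shows "Im (\<phi> A) = 0" "0 \<le> Re (\<phi> A)"
proof -
  obtain R where "positive_op R" "R \<cdot> R = A" using positive_sqrt[OF assms(2)] by blast
  then have "adj R \<cdot> R = A" by (simp add: positive_op_def)
  then show "Im (\<phi> A) = 0" "0 \<le> Re (\<phi> A)" using stateD(3,4)[OF assms(1), of R] by auto
qed

lemma positive_shift:
  assumes "adj A = A" "\<And>x. Re (cinner (A *\<^sub>V x) x) \<le> s * (norm x)\<^sup>2"
  shows "positive_op (s *\<^sub>R id_op - A)"
  using assms by (simp add: positive_op_def adj_diff adj_scaleR cinner_simps)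

lemma state_self_adjoint:
  assumes \<phi>: "state \<phi>" and A: "adj A = A" and le: "\<And>x. Re (cinner (A *\<^sub>V x) x) \<le> s * (norm x)\<^sup>2"
  shows "Im (\<phi> A) = 0" "Re (\<phi> A) \<le> s"
proof -
  have "\<phi> (s *\<^sub>R id_op - A) = s - \<phi> A"
    by (simp add: clinear_diff[OF stateD(1)[OF \<phi>]] clinear_scaleR[OF stateD(1)[OF \<phi>]]
        stateD(2)[OF \<phi>] scaleR_conv_of_real)
  then show "Im (\<phi> A) = 0" "Re (\<phi> A) \<le> s"
    using state_positive[OF \<phi> positive_shift[OF A le]] by auto
qed

text \<open>The numerical range of an operator determines an upper bound for the real parts of its
  values under all states, since only the self-adjoint part contributes to them.\<close>

lemma state_numerical_range:
  assumes \<phi>: "state \<phi>" and le: "\<And>e. norm e = 1 \<Longrightarrow> Re (cinner (A *\<^sub>V e) e) \<le> s"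
  shows "Re (\<phi> A) \<le> s"
proof -
  have le': "Re (cinner (A *\<^sub>V x) x) \<le> s * (norm x)\<^sup>2" for x
  proof (cases "x = 0")
    case False
    define e where "e = (1 / norm x) *\<^sub>R x"
    have "norm e = 1" using False by (simp add: e_def)
    from le[OF this] have "Re (cinner (A *\<^sub>V x) x) / (norm x)\<^sup>2 \<le> s"
      by (simp add: e_def op_scaleR cinner_simps power2_eq_square flip: of_real_mult of_real_divide)
    then show ?thesis using False by (simp add: pos_divide_le_eq)
  qed simp
  define H where "H = (1/2) *\<^sub>R (A + adj A)"
  define K where "K = (- \<i> / 2) *\<^sub>C (A - adj A)"
  have lin: "clinear \<phi>" by (rule stateD(1)[OF \<phi>])
  have saH: "adj H = H" by (simp add: H_def adj_scaleR adj_add add.commute)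
  have saK: "adj K = K"
    by (rule op_ext) (simp add: K_def adj_scaleC adj_diff scaleC_diff_right scaleC_minus_left)
  have "A = H + \<i> *\<^sub>C K"
    by (rule op_ext) (simp add: H_def K_def scaleC_scaleC scaleC_diff_right scaleR_scaleC
        scaleC_add_right algebra_simps flip: scaleC_add_left)
  then have "\<phi> A = \<phi> H + \<i> * \<phi> K"
    by (simp add: clinear_add[OF lin] clinear_scaleC[OF lin] scaleC_complex_def)
  moreover have "Im (\<phi> K) = 0"
  proof -
    obtain c where c: "c > 0" "\<And>x. norm (K *\<^sub>V x) \<le> c * norm x" using op_bound[of K] by blast
    have "Re (cinner (K *\<^sub>V x) x) \<le> c * (norm x)\<^sup>2" for x
      using order_trans[OF Re_cinner_le_norm mult_right_mono[OF c(2) norm_ge_zero]]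
      by (simp add: power2_eq_square mult.assoc)
    then show ?thesis by (rule state_self_adjoint(1)[OF \<phi> saK])
  qed
  moreover have "Re (\<phi> H) \<le> s"
  proof (rule state_self_adjoint(2)[OF \<phi> saH])
    fix x
    have "Re (cinner (H *\<^sub>V x) x) = Re (cinner (A *\<^sub>V x) x)"
      using Re_cinner_commute[of x "A *\<^sub>V x"]
      by (simp add: H_def cinner_simps cinner_adj_left)
    then show "Re (cinner (H *\<^sub>V x) x) \<le> s * (norm x)\<^sup>2" using le'[of x] by simp
  qed
  ultimately show ?thesis by simp
qed

lemma state_norm_bound:
  assumes \<phi>: "state \<phi>" and le: "\<And>x. norm (A *\<^sub>V x) \<le> c * norm x"
  shows "cmod (\<phi> A) \<le> c"
proof -
  obtain d where d: "cmod d = 1" "d * \<phi> A = complex_of_real (cmod (\<phi> A))"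
    using complex_phase by blast
  have "Re (\<phi> (d *\<^sub>C A)) \<le> c"
  proof (rule state_numerical_range[OF \<phi>])
    fix e :: 'a assume e: "norm e = 1"
    have "Re (cinner ((d *\<^sub>C A) *\<^sub>V e) e) \<le> norm (d *\<^sub>C (A *\<^sub>V e)) * norm e"
      using Re_cinner_le_norm[of "d *\<^sub>C (A *\<^sub>V e)" e] by simp
    also have "\<dots> \<le> c" using le[of e] e d(1) by (simp add: norm_scaleC)
    finally show "Re (cinner ((d *\<^sub>C A) *\<^sub>V e) e) \<le> c" .
  qed
  then show ?thesis
    using d by (simp add: clinear_scaleC[OF stateD(1)[OF \<phi>]] scaleC_complex_def)
qed

section \<open>Square summable sequences as a tensor product\<close>

lemma coord_add [simp]: "coord (x + y) n = coord x n + coord y n"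
  and coord_scaleC [simp]: "coord (c *\<^sub>C x) n = c *\<^sub>C coord x n"
  and coord_scaleR [simp]: "coord (r *\<^sub>R x) n = r *\<^sub>R coord x n"
  and coord_zero [simp]: "coord 0 n = 0"
  and coord_etensor [simp]: "coord (a \<otimes>\<^sub>v h) n = coord a n *\<^sub>C h"
  by (transfer; simp)+

declare coord_diff [simp]

lemma coord_sum [simp]: "coord (\<Sum>i\<in>I. f i) n = (\<Sum>i\<in>I. coord (f i) n)"
  by (induction I rule: infinite_finite_induct) simp_all

lemma ell2_ext: "(\<And>n. coord x n = coord y n) \<Longrightarrow> x = y"
  by (simp add: coord_inject[symmetric] fun_eq_iff)

lemma cinner_ell2_sums: "(\<lambda>n. cinner (coord x n) (coord y n)) sums cinner x y"
  unfolding cinner_ell2_def by (rule summable_sums[OF summable_cinner_coord])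

lemma norm_ell2_sums: "(\<lambda>n. (norm (coord x n))\<^sup>2) sums (norm x)\<^sup>2"
  unfolding norm_ell2_square by (rule summable_sums[OF coord_summable])

lemma etensor_add_left: "(a + b) \<otimes>\<^sub>v h = a \<otimes>\<^sub>v h + b \<otimes>\<^sub>v h"
  and etensor_add_right: "a \<otimes>\<^sub>v (h + k) = a \<otimes>\<^sub>v h + a \<otimes>\<^sub>v k"
  and etensor_scaleC_left: "(c *\<^sub>C a) \<otimes>\<^sub>v h = c *\<^sub>C (a \<otimes>\<^sub>v h)"
  and etensor_scaleC_right: "a \<otimes>\<^sub>v (c *\<^sub>C h) = c *\<^sub>C (a \<otimes>\<^sub>v h)"
  and etensor_zero_right [simp]: "a \<otimes>\<^sub>v 0 = 0"
  by (rule ell2_ext; simp add: scaleC_add_left scaleC_add_right scaleC_scaleC scaleC_complex_def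
      mult.commute)+

lemma cinner_etensor: "cinner (a \<otimes>\<^sub>v h) (b \<otimes>\<^sub>v k) = cinner a b * cinner h k"
proof -
  have "(\<lambda>n. cinner (coord a n) (coord b n) * cinner h k) sums (cinner a b * cinner h k)"
    by (rule sums_mult2[OF cinner_ell2_sums])
  moreover have "cinner (coord (a \<otimes>\<^sub>v h) n) (coord (b \<otimes>\<^sub>v k) n) = cinner (coord a n) (coord b n) * cinner h k"
    for n by (simp add: cinner_simps cinner_complex_def)
  ultimately show ?thesis
    using sums_unique2[OF cinner_ell2_sums[of "a \<otimes>\<^sub>v h" "b \<otimes>\<^sub>v k"]] by simp
qed

lemma norm_etensor: "norm (a \<otimes>\<^sub>v h) = norm a * norm h"
proof -
  have "complex_of_real ((norm (a \<otimes>\<^sub>v h))\<^sup>2) = complex_of_real ((norm a * norm h)\<^sup>2)"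
    unfolding cinner_self[symmetric] cinner_etensor by (simp add: cinner_self power_mult_distrib)
  then show ?thesis unfolding of_real_eq_iff by simp
qed

lift_definition unit_seq :: "nat \<Rightarrow> complex ell2" is "\<lambda>j n. if n = j then 1 else 0"
  by (rule summable_finite[of "{_}"]) auto

lemma coord_unit_seq: "coord (unit_seq j) n = (if n = j then 1 else 0)"
  by transfer simp

lemma cinner_unit_tensor_right: "cinner z (unit_seq j \<otimes>\<^sub>v h) = cinner (coord z j) h"
proof -
  have "(\<lambda>n. cinner (coord z n) (coord (unit_seq j \<otimes>\<^sub>v h) n)) sums cinner (coord z j) h"
    using sums_single[of j "\<lambda>n. cinner (coord z n) h"]
    by (rule back_subst[of "\<lambda>f. f sums _"]) (auto simp: coord_unit_seq)
  then show ?thesis using sums_unique2[OF cinner_ell2_sums] by blast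
qed

lemma cinner_unit_seq: "cinner (unit_seq i) (unit_seq j) = (if i = j then 1 else 0)"
proof -
  have "cinner (unit_seq i) (unit_seq j) = cinner (unit_seq i \<otimes>\<^sub>v (1::complex)) (unit_seq j \<otimes>\<^sub>v (1::complex))"
    by (simp add: cinner_etensor cinner_complex_def)
  also have "\<dots> = (if i = j then 1 else 0)"
    by (simp add: cinner_unit_tensor_right coord_unit_seq cinner_complex_def scaleC_complex_def)
  finally show ?thesis .
qed

lemma unit_tensor_remainder:
  "(norm ((\<Sum>m<M. unit_seq m \<otimes>\<^sub>v coord z m) - z))\<^sup>2
    = (norm z)\<^sup>2 - (\<Sum>m<M. (norm (coord z m))\<^sup>2)"
proof -
  have c: "coord ((\<Sum>m<M. unit_seq m \<otimes>\<^sub>v coord z m) - z) n = (if n < M then 0 else - coord z n)" for n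
  proof -
    have "(\<Sum>m<M. coord (unit_seq m) n *\<^sub>C coord z m) = (\<Sum>m<M. if m = n then coord z n else 0)"
      by (intro sum.cong) (auto simp: coord_unit_seq)
    then show ?thesis by simp
  qed
  have "(\<lambda>n. (norm (coord z n))\<^sup>2 - (if n \<in> {..<M} then (norm (coord z n))\<^sup>2 else 0)) sums
      ((norm z)\<^sup>2 - (\<Sum>m<M. (norm (coord z m))\<^sup>2))"
    by (intro sums_diff norm_ell2_sums sums_If_finite_set) simp
  moreover have "(norm (coord ((\<Sum>m<M. unit_seq m \<otimes>\<^sub>v coord z m) - z) n))\<^sup>2
      = (norm (coord z n))\<^sup>2 - (if n \<in> {..<M} then (norm (coord z n))\<^sup>2 else 0)" for n
    unfolding c by simp
  ultimately show ?thesis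
    using sums_unique2[OF norm_ell2_sums[of "(\<Sum>m<M. unit_seq m \<otimes>\<^sub>v coord z m) - z"]] by simp
qed

lemma unit_tensor_expansion: "(\<lambda>m. unit_seq m \<otimes>\<^sub>v coord z m) sums z"
  unfolding sums_def
proof (rule LIM_zero_cancel, rule tendsto_norm_zero_cancel)
  have "(\<lambda>M. (norm z)\<^sup>2 - (\<Sum>m<M. (norm (coord z m))\<^sup>2)) \<longlonglongrightarrow> (norm z)\<^sup>2 - (norm z)\<^sup>2"
    by (intro tendsto_intros norm_ell2_sums[unfolded sums_def])
  then have "(\<lambda>M. sqrt ((norm ((\<Sum>m<M. unit_seq m \<otimes>\<^sub>v coord z m) - z))\<^sup>2)) \<longlonglongrightarrow> sqrt 0"
    unfolding unit_tensor_remainder by (intro tendsto_real_sqrt) simp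
  then show "(\<lambda>M. norm ((\<Sum>m<M. unit_seq m \<otimes>\<^sub>v coord z m) - z)) \<longlonglongrightarrow> 0" by simp
qed

lemma op_sums: "f sums s \<Longrightarrow> (\<lambda>n. T *\<^sub>V f n) sums (T *\<^sub>V s)"
  by (rule bounded_linear.sums[OF bounded_linear_op])

lemma op_eq_on_unit_tensors:
  assumes "\<And>m h. S *\<^sub>V (unit_seq m \<otimes>\<^sub>v h) = T *\<^sub>V (unit_seq m \<otimes>\<^sub>v h)"
  shows "S = T"
proof (rule op_ext)
  fix z
  have "(\<lambda>m. T *\<^sub>V (unit_seq m \<otimes>\<^sub>v coord z m)) sums (S *\<^sub>V z)"
    using op_sums[OF unit_tensor_expansion[of z], of S] by (simp add: assms)
  then show "S *\<^sub>V z = T *\<^sub>V z"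
    using op_sums[OF unit_tensor_expansion[of z], of T] sums_unique2 by blast
qed

lemma square_summable_bound:
  assumes "\<And>n. norm (f n) \<le> K * norm (coord z n)"
  shows "coord (Abs_ell2 f) = f" "norm (Abs_ell2 f) \<le> \<bar>K\<bar> * norm z"
proof -
  have le: "(norm (f n))\<^sup>2 \<le> K\<^sup>2 * (norm (coord z n))\<^sup>2" for n
    using power_mono[OF assms[of n], of 2] by (simp add: power_mult_distrib)
  have s: "summable (\<lambda>n. K\<^sup>2 * (norm (coord z n))\<^sup>2)" by (intro summable_mult coord_summable)
  have "summable (\<lambda>n. (norm (f n))\<^sup>2)"
    by (rule summable_comparison_test'[OF s]) (use le in simp)
  then show c: "coord (Abs_ell2 f) = f" by (simp add: Abs_ell2_inverse)
  have "(norm (Abs_ell2 f))\<^sup>2 \<le> K\<^sup>2 * (norm z)\<^sup>2"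
    by (rule sums_le[OF _ norm_ell2_sums sums_mult[OF norm_ell2_sums]]) (use le in \<open>simp add: c\<close>)
  then have "(norm (Abs_ell2 f))\<^sup>2 \<le> (\<bar>K\<bar> * norm z)\<^sup>2" by (simp add: power_mult_distrib)
  then show "norm (Abs_ell2 f) \<le> \<bar>K\<bar> * norm z" by (rule power2_le_imp_le) simp
qed

text \<open>The amplification \<open>1 \<otimes> T\<close>. Its matrix coefficients \<open>\<langle>(1 \<otimes> T) x, y\<rangle>\<close> are the series
  \<open>\<Sum>\<^sub>n \<langle>T x\<^sub>n, y\<^sub>n\<rangle>\<close> that define the ultraweak topology.\<close>

definition amp :: "('a::chilbert_space, 'b::chilbert_space) cblinfun \<Rightarrow> ('a ell2, 'b ell2) cblinfun" where
  "amp T = Abs_cblinfun (\<lambda>z. Abs_ell2 (\<lambda>n. T *\<^sub>V coord z n))"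

lemma coord_amp [simp]: "coord (amp T *\<^sub>V z) n = T *\<^sub>V coord z n"
  and norm_amp: "norm (amp T *\<^sub>V z) \<le> onorm (cblinfun_apply T) * norm z"
proof -
  define f where "f z = Abs_ell2 (\<lambda>n. T *\<^sub>V coord z n)" for z
  let ?K = "onorm (cblinfun_apply T)"
  have K0: "?K \<ge> 0" by (rule onorm_pos_le[OF bounded_linear_op])
  note b = square_summable_bound[of "\<lambda>n. T *\<^sub>V coord _ n", OF op_onorm]
  have cf: "coord (f z) n = T *\<^sub>V coord z n" for z n by (simp add: f_def b(1))
  have bd: "norm (f z) \<le> ?K * norm z" for z using b(2)[of z] K0 by (simp add: f_def)
  have "clinear f"
    unfolding clinear_def by (intro conjI allI; rule ell2_ext) (simp_all add: cf op_linear_simps)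
  from op_exists[OF this bd] have app: "cblinfun_apply (amp T) = f"
    by (simp add: amp_def f_def[abs_def])
  show "coord (amp T *\<^sub>V z) n = T *\<^sub>V coord z n" by (simp add: app cf)
  show "norm (amp T *\<^sub>V z) \<le> ?K * norm z" by (simp add: app bd)
qed

lemma amp_tensor [simp]: "amp T *\<^sub>V (a \<otimes>\<^sub>v h) = a \<otimes>\<^sub>v (T *\<^sub>V h)"
  by (rule ell2_ext) (simp add: op_linear_simps)

lemma amp_add: "amp (S + T) = amp S + amp T"
  and amp_diff: "amp (S - T) = amp S - amp T"
  and amp_scaleC: "amp (c *\<^sub>C T) = c *\<^sub>C amp T"
  and amp_scaleR: "amp (r *\<^sub>R T) = r *\<^sub>R amp T"
  and amp_zero: "amp 0 = 0"
  and amp_id: "amp id_op = id_op"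
  by (rule op_ext, rule ell2_ext, simp)+

lemma amp_comp: "amp (S \<cdot> T) = amp S \<cdot> amp T"
  by (rule op_ext, rule ell2_ext, simp)

lemma adj_amp: "adj (amp T) = amp (adj T)"
proof (rule adjI)
  fix x y
  show "cinner (amp T *\<^sub>V x) y = cinner x (amp (adj T) *\<^sub>V y)"
    using cinner_ell2_sums[of "amp T *\<^sub>V x" y] cinner_ell2_sums[of x "amp (adj T) *\<^sub>V y"]
    by (simp add: cinner_adj sums_unique2)
qed

text \<open>With \<open>R\<close> the square root of \<open>c\<^sup>2 - A\<^sup>* A\<close>, the difference of the squares of the two sides is
  the squared norm of \<open>\<Sum> (R a\<^sub>i) \<otimes> h\<^sub>i\<close>.\<close>

lemma tensor_sum_norm_bound:
  assumes A: "\<And>x. norm (A *\<^sub>V x) \<le> c * norm x" and c: "c \<ge> 0"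
  shows "norm (\<Sum>i\<in>I. (A *\<^sub>V a i) \<otimes>\<^sub>v h i) \<le> c * norm (\<Sum>i\<in>I. a i \<otimes>\<^sub>v h i)"
proof -
  define C where "C = c\<^sup>2 *\<^sub>R id_op - adj A \<cdot> A"
  have qA: "cinner (adj A *\<^sub>V (A *\<^sub>V x)) y = cinner (A *\<^sub>V x) (A *\<^sub>V y)" for x y by (rule cinner_adj_left)
  have "positive_op C"
    unfolding C_def
  proof (rule positive_shift)
    show "adj (adj A \<cdot> A) = adj A \<cdot> A" by (simp add: adj_comp)
    show "Re (cinner ((adj A \<cdot> A) *\<^sub>V x) x) \<le> c\<^sup>2 * (norm x)\<^sup>2" for x
      using power_mono[OF A[of x], of 2] by (simp add: qA power_mult_distrib)
  qed
  then obtain R where R: "positive_op R" "R \<cdot> R = C" using positive_sqrt by blast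
  have RR: "cinner (R *\<^sub>V x) (R *\<^sub>V y) = c\<^sup>2 * cinner x y - cinner (A *\<^sub>V x) (A *\<^sub>V y)" for x y
  proof -
    have "cinner (R *\<^sub>V x) (R *\<^sub>V y) = cinner ((R \<cdot> R) *\<^sub>V x) y"
      using R(1) cinner_adj[of R "R *\<^sub>V x" y] by (simp add: positive_op_def)
    then show ?thesis by (simp add: R(2) C_def cinner_simps qA)
  qed
  have exp: "(norm (\<Sum>i\<in>I. (X *\<^sub>V a i) \<otimes>\<^sub>v h i))\<^sup>2
      = Re (\<Sum>i\<in>I. \<Sum>j\<in>I. cinner (X *\<^sub>V a i) (X *\<^sub>V a j) * cinner (h i) (h j))"
    for X :: "(complex ell2, complex ell2) cblinfun"
    unfolding Re_cinner_self[symmetric] cinner_sum_left unfolding cinner_sum_right cinner_etensor ..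
  have "0 \<le> (norm (\<Sum>i\<in>I. (R *\<^sub>V a i) \<otimes>\<^sub>v h i))\<^sup>2" by simp
  also have "\<dots> = c\<^sup>2 * (norm (\<Sum>i\<in>I. (id_op *\<^sub>V a i) \<otimes>\<^sub>v h i))\<^sup>2 - (norm (\<Sum>i\<in>I. (A *\<^sub>V a i) \<otimes>\<^sub>v h i))\<^sup>2"
    unfolding exp RR
    by (simp add: left_diff_distrib right_diff_distrib sum_subtractf sum_distrib_left mult.assoc flip: of_real_power)
  finally have "(norm (\<Sum>i\<in>I. (A *\<^sub>V a i) \<otimes>\<^sub>v h i))\<^sup>2 \<le> (c * norm (\<Sum>i\<in>I. a i \<otimes>\<^sub>v h i))\<^sup>2"
    by (simp add: power_mult_distrib)
  then show ?thesis by (rule power2_le_imp_le) (use c in simp)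
qed

text \<open>By the preceding bound, applying \<open>A\<close> to the first factors keeps the expansion of a vector in
  unit tensors convergent. This defines \<open>A \<otimes> 1\<close>, and \<open>A \<otimes> B\<close> is its product with \<open>1 \<otimes> B\<close>.\<close>

lemma op_tensor_exists: "\<exists>Z. \<forall>a h. Z *\<^sub>V (a \<otimes>\<^sub>v h) = (A *\<^sub>V a) \<otimes>\<^sub>v (B *\<^sub>V h)"
proof -
  obtain c where c: "c > 0" "\<And>x. norm (A *\<^sub>V x) \<le> c * norm x" using op_bound[of A] by blast
  define f where "f z m = (A *\<^sub>V unit_seq m) \<otimes>\<^sub>v coord z m" for z :: "'b ell2" and m
  have bd: "norm (\<Sum>m\<in>I. f z m) \<le> c * norm (\<Sum>m\<in>I. unit_seq m \<otimes>\<^sub>v coord z m)" for z I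
    unfolding f_def by (rule tensor_sum_norm_bound) (use c in auto)
  have sf: "summable (f z)" for z
    unfolding summable_Cauchy
  proof (intro allI impI)
    fix e :: real assume "e > 0"
    then have "e / c > 0" using c by simp
    then obtain N where N: "\<And>m n. m \<ge> N \<Longrightarrow> norm (\<Sum>m=m..<n. unit_seq m \<otimes>\<^sub>v coord z m) < e / c"
      using sums_summable[OF unit_tensor_expansion[of z]] unfolding summable_Cauchy by meson
    have "norm (sum (f z) {m..<n}) < e" if "m \<ge> N" for m n
    proof -
      have "norm (sum (f z) {m..<n}) \<le> c * norm (\<Sum>m=m..<n. unit_seq m \<otimes>\<^sub>v coord z m)" by (rule bd)
      also have "\<dots> < c * (e / c)" by (rule mult_strict_left_mono[OF N[OF that] c(1)])
      finally show ?thesis using c(1) by simp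
    qed
    then show "\<exists>N. \<forall>m\<ge>N. \<forall>n. norm (sum (f z) {m..<n}) < e" by blast
  qed
  have bound: "norm (suminf (f z)) \<le> c * norm z" for z
  proof (rule LIMSEQ_le)
    show "(\<lambda>M. norm (\<Sum>m<M. f z m)) \<longlonglongrightarrow> norm (suminf (f z))"
      by (intro tendsto_norm summable_LIMSEQ sf)
    show "(\<lambda>M. c * norm (\<Sum>m<M. unit_seq m \<otimes>\<^sub>v coord z m)) \<longlonglongrightarrow> c * norm z"
      by (intro tendsto_intros unit_tensor_expansion[unfolded sums_def])
  qed (use bd in blast)
  have "clinear (\<lambda>z. suminf (f z))"
    unfolding clinear_def
  proof (intro conjI allI)
    show "suminf (f (x + y)) = suminf (f x) + suminf (f y)" for x y
      unfolding suminf_add[OF sf sf]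
      by (rule arg_cong[of _ _ suminf]) (simp add: f_def etensor_add_right fun_eq_iff)
    show "suminf (f (k *\<^sub>C x)) = k *\<^sub>C suminf (f x)" for k x
    proof -
      have "f (k *\<^sub>C x) = (\<lambda>n. k *\<^sub>C f x n)" by (simp add: f_def etensor_scaleC_right fun_eq_iff)
      then show ?thesis using bounded_linear.suminf[OF bounded_linear_scaleC sf, of k x] by simp
    qed
  qed
  from op_exists[OF this bound] obtain Z where Z: "\<And>z. Z *\<^sub>V z = suminf (f z)" by metis
  have "Z *\<^sub>V (a \<otimes>\<^sub>v h) = (A *\<^sub>V a) \<otimes>\<^sub>v h" for a h
  proof -
    have bl: "bounded_linear (\<lambda>a. a \<otimes>\<^sub>v h)"
      by (rule bounded_linear_intro[of _ "norm h"])
        (simp_all add: etensor_add_left scaleR_scaleC etensor_scaleC_left norm_etensor)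
    have "unit_seq m \<otimes>\<^sub>v coord a m = coord a m *\<^sub>C unit_seq m" for m
      by (rule ell2_ext) (simp add: scaleC_complex_def mult.commute)
    then have exp: "(\<lambda>m. coord a m *\<^sub>C unit_seq m) sums a"
      using unit_tensor_expansion[of a] by simp
    have "(\<lambda>m. (A *\<^sub>V (coord a m *\<^sub>C unit_seq m)) \<otimes>\<^sub>v h) sums ((A *\<^sub>V a) \<otimes>\<^sub>v h)"
      by (rule bounded_linear.sums[OF bl op_sums[OF exp]])
    moreover have "f (a \<otimes>\<^sub>v h) = (\<lambda>m. (A *\<^sub>V (coord a m *\<^sub>C unit_seq m)) \<otimes>\<^sub>v h)"
      by (simp add: fun_eq_iff f_def op_scaleC etensor_scaleC_left etensor_scaleC_right)
    ultimately have "f (a \<otimes>\<^sub>v h) sums ((A *\<^sub>V a) \<otimes>\<^sub>v h)" by simp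
    then show ?thesis by (simp add: Z sums_iff)
  qed
  then have "\<forall>a h. (Z \<cdot> amp B) *\<^sub>V (a \<otimes>\<^sub>v h) = (A *\<^sub>V a) \<otimes>\<^sub>v (B *\<^sub>V h)" by simp
  then show ?thesis by blast
qed

lemma op_tensor_apply [simp]: "(A \<otimes>\<^sub>o B) *\<^sub>V (a \<otimes>\<^sub>v h) = (A *\<^sub>V a) \<otimes>\<^sub>v (B *\<^sub>V h)"
proof -
  obtain Z where Z: "\<forall>a h. Z *\<^sub>V (a \<otimes>\<^sub>v h) = (A *\<^sub>V a) \<otimes>\<^sub>v (B *\<^sub>V h)"
    using op_tensor_exists by blast
  have "\<forall>a h. (A \<otimes>\<^sub>o B) *\<^sub>V (a \<otimes>\<^sub>v h) = (A *\<^sub>V a) \<otimes>\<^sub>v (B *\<^sub>V h)"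
    unfolding op_tensor_def
    by (rule theI[where P = "\<lambda>Z. \<forall>a h. Z *\<^sub>V (a \<otimes>\<^sub>v h) = (A *\<^sub>V a) \<otimes>\<^sub>v (B *\<^sub>V h)", OF Z])
      (rule op_eq_on_unit_tensors, simp add: Z)
  then show ?thesis by blast
qed

lemma id_tensor_eq_amp: "id_op \<otimes>\<^sub>o T = amp T"
  by (rule op_eq_on_unit_tensors) simp

lemma sums_prod_decode:
  fixes f :: "nat \<Rightarrow> nat \<Rightarrow> 'x::banach"
  assumes 1: "\<And>i. summable (\<lambda>j. norm (f i j))" and 2: "summable (\<lambda>i. \<Sum>j. norm (f i j))"
  shows "summable (\<lambda>n. norm (f (fst (prod_decode n)) (snd (prod_decode n))))"
    and "(\<Sum>n. f (fst (prod_decode n)) (snd (prod_decode n))) = (\<Sum>i. \<Sum>j. f i j)"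
proof -
  define g where "g = (\<lambda>(i, j). f i j)"
  have infsum_suminf: "infsum h UNIV = suminf h" if "summable (\<lambda>n. norm (h n))" for h :: "nat \<Rightarrow> 'z::banach"
    by (rule infsumI, rule norm_summable_imp_has_sum[OF that summable_sums[OF summable_norm_cancel[OF that]]])
  have inner: "(\<Sum>\<^sub>\<infinity>j. norm (f i j)) = (\<Sum>j. norm (f i j))" for i
    by (rule infsum_suminf) (simp add: 1)
  have abs: "(\<lambda>p. norm (g p)) summable_on (UNIV \<times> UNIV)"
    by (subst Infinite_Sum.abs_summable_on_Sigma_iff)
      (use inner 1 2 in \<open>simp add: g_def summable_on_UNIV_nonneg_real_iff suminf_nonneg\<close>)
  have bij: "bij_betw prod_decode UNIV (UNIV \<times> UNIV)" using bij_prod_decode by simp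
  have "(\<lambda>n. norm (g (prod_decode n))) summable_on UNIV"
    using abs summable_on_reindex_bij_betw[OF bij, of "\<lambda>p. norm (g p)"] by simp
  then show s: "summable (\<lambda>n. norm (f (fst (prod_decode n)) (snd (prod_decode n))))"
    by (simp add: summable_on_UNIV_nonneg_real_iff g_def case_prod_beta)
  have "(\<Sum>n. f (fst (prod_decode n)) (snd (prod_decode n))) = infsum (\<lambda>n. g (prod_decode n)) UNIV"
    using infsum_suminf[OF s] by (simp add: g_def case_prod_beta)
  also have "\<dots> = infsum g (UNIV \<times> UNIV)" by (rule infsum_reindex_bij_betw[OF bij])
  also have "\<dots> = infsum (\<lambda>i. infsum (\<lambda>j. f i j) UNIV) UNIV"
    using infsum_Sigma_banach[OF abs_summable_summable[OF abs]] by (simp add: g_def)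
  also have "\<dots> = infsum (\<lambda>i. \<Sum>j. f i j) UNIV" by (simp add: infsum_suminf 1)
  also have "\<dots> = (\<Sum>i. \<Sum>j. f i j)"
  proof (rule infsum_suminf)
    show "summable (\<lambda>i. norm (\<Sum>j. f i j))"
      by (rule summable_comparison_test'[OF 2, of 0]) (simp add: summable_norm[OF 1])
  qed
  finally show "(\<Sum>n. f (fst (prod_decode n)) (snd (prod_decode n))) = (\<Sum>i. \<Sum>j. f i j)" .
qed

text \<open>The identification of \<open>l\<^sub>2 \<otimes> (l\<^sub>2 \<otimes> K)\<close> with \<open>l\<^sub>2 \<otimes> K\<close> along a bijection of the index sets. It
  turns a series of ultraweak functionals into a single one.\<close>

definition flatten :: "'k::chilbert_space ell2 ell2 \<Rightarrow> 'k ell2" where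
  "flatten w = Abs_ell2 (\<lambda>n. coord (coord w (fst (prod_decode n))) (snd (prod_decode n)))"

lemma coord_flatten: "coord (flatten w) n = coord (coord w (fst (prod_decode n))) (snd (prod_decode n))"
proof -
  let ?f = "\<lambda>i j. (norm (coord (coord w i) j))\<^sup>2"
  have "summable (\<lambda>n. norm (?f (fst (prod_decode n)) (snd (prod_decode n))))"
    by (rule sums_prod_decode(1)) (simp_all add: coord_summable flip: norm_ell2_square)
  then show ?thesis by (simp add: flatten_def Abs_ell2_inverse)
qed

lemma cinner_flatten: "cinner (flatten w) (flatten v) = cinner w v"
proof -
  let ?f = "\<lambda>i j. cinner (coord (coord w i) j) (coord (coord v i) j)"
  let ?g = "\<lambda>i j. (norm (coord (coord w i) j))\<^sup>2 + (norm (coord (coord v i) j))\<^sup>2"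
  have sg: "summable (?g i)" for i by (intro summable_add coord_summable)
  have sf: "summable (\<lambda>j. norm (?f i j))" for i
    by (rule summable_comparison_test'[OF sg[of i], of 0]) (simp add: norm_cinner_le)
  have "(\<lambda>i. \<Sum>j. ?g i j) = (\<lambda>i. (norm (coord w i))\<^sup>2 + (norm (coord v i))\<^sup>2)"
    by (simp add: norm_ell2_square suminf_add coord_summable)
  then have "summable (\<lambda>i. \<Sum>j. ?g i j)" by (simp add: summable_add coord_summable)
  then have "summable (\<lambda>i. \<Sum>j. norm (?f i j))"
    by (rule summable_comparison_test'[of _ 0])
      (simp add: suminf_nonneg[OF sf] suminf_le[OF _ sf sg] norm_cinner_le)
  from sums_prod_decode(2)[of ?f, OF sf this] show ?thesis
    by (simp add: cinner_ell2_def coord_flatten)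
qed

lemma amp_flatten: "amp T *\<^sub>V flatten w = flatten (amp (amp T) *\<^sub>V w)"
  by (rule ell2_ext) (simp add: coord_flatten)

section \<open>Separation and normal functionals\<close>

lemma scaleC_sum_right: "c *\<^sub>C (\<Sum>i\<in>I. f i) = (\<Sum>i\<in>I. c *\<^sub>C (f i :: 'a::complex_vector))"
  by (induction I rule: infinite_finite_induct) (simp_all add: scaleC_add_right)

text \<open>The finitely many coordinates in \<open>I\<close> map \<open>K\<close> and \<open>T0\<close> into a Hilbert space, where the
  nearest point of the closed convex image separates.\<close>

lemma separate_convex:
  fixes K :: "'t::real_vector set" and g :: "'t \<Rightarrow> 'i \<Rightarrow> complex"
  assumes lin: "\<And>i. linear (\<lambda>T. g T i)" and K: "convex K" "K \<noteq> {}"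
    and I: "finite I" and e: "e > 0"
    and far: "\<And>T. T \<in> K \<Longrightarrow> \<exists>i\<in>I. e \<le> dist (g T i) (g T0 i)"
  obtains c s where "\<And>T. T \<in> K \<Longrightarrow> Re (\<Sum>i\<in>I. c i * g T i) \<le> s"
    "s < Re (\<Sum>i\<in>I. c i * g T0 i)"
proof -
  obtain h :: "'i \<Rightarrow> nat" where h: "inj_on h I" using finite_imp_inj_to_nat_seg[OF I] by auto
  define L where "L T = (\<Sum>i\<in>I. g T i *\<^sub>C unit_seq (h i))" for T
  have gadd: "g (S + T) i = g S i + g T i" for S T i using linear_add[OF lin] by blast
  have gscale: "g (r *\<^sub>R T) i = r *\<^sub>R g T i" for r T i using linear_scale[OF lin] by blast
  have linL: "linear L"
    by (rule linearI)
      (simp_all add: L_def gadd gscale scaleC_add_left sum.distrib scaleC_sum_right scaleR_scaleC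
        scaleC_scaleC scaleC_complex_def)
  have coordL: "coord (L T) (h i) = g T i" if "i \<in> I" for T i
  proof -
    have "coord (L T) (h i) = (\<Sum>j\<in>I. if j = i then g T i else 0)"
      using h that by (auto simp: L_def coord_unit_seq scaleC_complex_def inj_on_def intro!: sum.cong)
    then show ?thesis using I that by simp
  qed
  define C where "C = closure (L ` K)"
  have C: "closed C" "convex C" "C \<noteq> {}"
    using K by (auto simp: C_def convex_closure convex_linear_image linL)
  have "L T0 \<notin> C"
  proof
    assume "L T0 \<in> C"
    then obtain T where T: "T \<in> K" "dist (L T) (L T0) < e"
      using e unfolding C_def closure_approachable by blast
    obtain i where i: "i \<in> I" "e \<le> dist (g T i) (g T0 i)" using far[OF T(1)] by blast
    have "dist (g T i) (g T0 i) \<le> dist (L T) (L T0)"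
      using norm_coord_le[of "L T - L T0" "h i"] by (simp add: coordL[OF i(1)] dist_norm)
    then show False using T(2) i(2) by linarith
  qed
  obtain p where p: "p \<in> C" and le: "\<And>c. c \<in> C \<Longrightarrow> Re (cinner (L T0 - p) (c - p)) \<le> 0"
    using nearest_point[OF C] by blast
  define w where "w = L T0 - p"
  have w: "norm w > 0" using \<open>L T0 \<notin> C\<close> p by (auto simp: w_def)
  have form: "(\<Sum>i\<in>I. cinner (unit_seq (h i)) w * g T i) = cinner (L T) w" for T
    by (simp add: L_def cinner_sum_left cinner_scaleC_left mult.commute)
  show ?thesis
  proof (rule that[of "\<lambda>i. cinner (unit_seq (h i)) w" "Re (cinner p w)"])
    fix T assume "T \<in> K"
    then have "L T \<in> C" using closure_subset[of "L ` K"] by (auto simp: C_def)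
    from le[OF this] show "Re (\<Sum>i\<in>I. cinner (unit_seq (h i)) w * g T i) \<le> Re (cinner p w)"
      unfolding form using Re_cinner_commute[of w] by (simp add: w_def[symmetric] cinner_diff_right)
  next
    have "Re (cinner (L T0) w) = Re (cinner p w) + (norm w)\<^sup>2"
      unfolding Re_cinner_self[symmetric] by (simp add: w_def cinner_simps)
    moreover have "(norm w)\<^sup>2 > 0" using w by simp
    ultimately show "Re (cinner p w) < Re (\<Sum>i\<in>I. cinner (unit_seq (h i)) w * g T0 i)"
      unfolding form by linarith
  qed
qed

lemma pullback_neighbourhood:
  fixes g :: "'t \<Rightarrow> 'i \<Rightarrow> 'm::metric_space"
  assumes U: "openin (pullback_topology UNIV g euclidean) U" "T0 \<in> U"
  obtains I e where "finite I" "e > 0" "\<And>T. (\<And>i. i \<in> I \<Longrightarrow> dist (g T i) (g T0 i) < e) \<Longrightarrow> T \<in> U"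
proof -
  obtain V where V: "open V" "U = g -` V" using U(1) by (auto simp: openin_pullback_topology)
  then have "openin (product_topology (\<lambda>i. euclidean) UNIV) V" "g T0 \<in> V"
    using U(2) by (auto simp: euclidean_product_topology)
  from product_topology_open_contains_basis[OF this]
  obtain X where X: "g T0 \<in> (\<Pi>\<^sub>E i\<in>UNIV. X i)" "\<And>i. open (X i)" "finite {i. X i \<noteq> UNIV}"
    "(\<Pi>\<^sub>E i\<in>UNIV. X i) \<subseteq> V" by auto
  define I where "I = {i. X i \<noteq> UNIV}"
  have "\<exists>e>0. ball (g T0 i) e \<subseteq> X i" for i
    using X(1,2) open_contains_ball by (metis PiE_mem UNIV_I)
  then obtain \<epsilon> where \<epsilon>: "\<And>i. \<epsilon> i > 0" "\<And>i. ball (g T0 i) (\<epsilon> i) \<subseteq> X i" by metis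
  define e where "e = Min (insert 1 (\<epsilon> ` I))"
  have fin: "finite I" using X(3) by (simp add: I_def)
  show ?thesis
  proof (rule that[OF fin])
    show "e > 0" using fin \<epsilon>(1) by (simp add: e_def)
    fix T assume T: "\<And>i. i \<in> I \<Longrightarrow> dist (g T i) (g T0 i) < e"
    have "g T i \<in> X i" for i
    proof (cases "i \<in> I")
      case True
      then have "e \<le> \<epsilon> i" using fin by (simp add: e_def)
      then have "g T i \<in> ball (g T0 i) (\<epsilon> i)" using T[OF True] by (simp add: dist_commute)
      then show ?thesis using \<epsilon>(2) by blast
    qed (simp add: I_def)
    then have "g T \<in> V" using X(4) by (auto simp: PiE_UNIV_domain)
    then show "T \<in> U" using V(2) by simp
  qed
qed

lemma ultraweak_eq:
  "ultraweak = pullback_topology UNIV (\<lambda>T (x, y). cinner (amp T *\<^sub>V x) y) euclidean"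
proof -
  have "(\<lambda>(T :: ('a, 'b) cblinfun) (x, y). \<Sum>n. cinner (T *\<^sub>V coord x n) (coord y n))
      = (\<lambda>T (x, y). cinner (amp T *\<^sub>V x) y)"
    by (simp add: fun_eq_iff cinner_ell2_def)
  then show ?thesis unfolding ultraweak_def by simp
qed

lemma topspace_ultraweak [simp]: "topspace ultraweak = UNIV"
  and topspace_WOT [simp]: "topspace WOT = UNIV"
  by (simp_all add: ultraweak_eq WOT_def topspace_pullback_topology)

text \<open>The vectors of the two functionals are placed in orthogonal copies of the space.\<close>

lemma sum_of_vector_functionals:
  fixes x x' :: "'a::chilbert_space ell2" and y y' :: "'b::chilbert_space ell2"
  obtains z w where "\<And>T. cinner (amp T *\<^sub>V z) w = cinner (amp T *\<^sub>V x) y + c * cinner (amp T *\<^sub>V x') y'"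
proof -
  define z where "z = unit_seq 0 \<otimes>\<^sub>v x + unit_seq 1 \<otimes>\<^sub>v (c *\<^sub>C x')"
  define w where "w = unit_seq 0 \<otimes>\<^sub>v y + unit_seq 1 \<otimes>\<^sub>v y'"
  have "cinner (amp T *\<^sub>V flatten z) (flatten w)
      = cinner (amp T *\<^sub>V x) y + c * cinner (amp T *\<^sub>V x') y'" for T
    by (simp add: amp_flatten cinner_flatten z_def w_def op_linear_simps cinner_simps cinner_etensor
        cinner_unit_seq etensor_scaleC_right)
  then show ?thesis using that[of "flatten z" "flatten w"] by blast
qed

lemma finite_sum_of_vector_functionals:
  assumes "finite I"
  shows "\<exists>z w. \<forall>T. cinner (amp T *\<^sub>V z) w = (\<Sum>i\<in>I. c i * cinner (amp T *\<^sub>V x i) (y i))"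
  using assms
proof induction
  case empty
  show ?case by (rule exI[of _ 0]) simp
next
  case (insert i I)
  then obtain z w where zw: "\<And>T. cinner (amp T *\<^sub>V z) w = (\<Sum>i\<in>I. c i * cinner (amp T *\<^sub>V x i) (y i))"
    by blast
  obtain z' w' where "\<And>T. cinner (amp T *\<^sub>V z') w' = cinner (amp T *\<^sub>V z) w + c i * cinner (amp T *\<^sub>V x i) (y i)"
    using sum_of_vector_functionals[of z w "c i" "x i" "y i"] by blast
  then have "cinner (amp T *\<^sub>V z') w' = (\<Sum>i\<in>insert i I. c i * cinner (amp T *\<^sub>V x i) (y i))" for T
    using insert zw by (simp add: add.commute)
  then show ?case by blast
qed

lemma cinner_amp_unit_tensor: "cinner (amp T *\<^sub>V (unit_seq 0 \<otimes>\<^sub>v x)) (unit_seq 0 \<otimes>\<^sub>v y) = cinner (T *\<^sub>V x) y"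
  by (simp add: cinner_etensor cinner_unit_seq)

lemma ultraweak_separation:
  fixes M :: "('a::chilbert_space, 'b::chilbert_space) cblinfun set"
  assumes M: "closedin ultraweak M" "csubspace M" and T0: "T0 \<notin> M"
  obtains x y where "\<And>T. T \<in> M \<Longrightarrow> cinner (amp T *\<^sub>V x) y = 0" "cinner (amp T0 *\<^sub>V x) y \<noteq> 0"
proof -
  define g :: "('a, 'b) cblinfun \<Rightarrow> 'a ell2 \<times> 'b ell2 \<Rightarrow> complex"
    where "g = (\<lambda>T (x, y). cinner (amp T *\<^sub>V x) y)"
  have "openin (pullback_topology UNIV g euclidean) (- M)"
    using M(1) by (simp add: closedin_def ultraweak_eq[symmetric] g_def Compl_eq_Diff_UNIV)
  then obtain I e where I: "finite I" "e > 0"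
    "\<And>T. (\<And>i. i \<in> I \<Longrightarrow> dist (g T i) (g T0 i) < e) \<Longrightarrow> T \<in> - M"
    using pullback_neighbourhood[of g "- M" T0] T0 by blast
  have lin: "linear (\<lambda>T. g T i)" for i
    by (rule linearI) (simp_all add: g_def split_beta amp_add amp_scaleR cinner_simps scaleR_conv_of_real)
  have far: "\<exists>i\<in>I. e \<le> dist (g T i) (g T0 i)" if "T \<in> M" for T
    using I(3)[of T] that by (meson ComplD not_less)
  have "M \<noteq> {}" using M(2) by (auto simp: csubspace_def)
  then obtain c s where cs: "\<And>T. T \<in> M \<Longrightarrow> Re (\<Sum>i\<in>I. c i * g T i) \<le> s"
    "s < Re (\<Sum>i\<in>I. c i * g T0 i)"
    using separate_convex[OF lin csubspace_convex[OF M(2)] _ I(1,2) far] by blast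
  obtain z w where zw: "\<And>T. cinner (amp T *\<^sub>V z) w = (\<Sum>i\<in>I. c i * cinner (amp T *\<^sub>V fst i) (snd i))"
    using finite_sum_of_vector_functionals[OF I(1), where c = c and x = fst and y = snd] by blast
  then have f: "(\<Sum>i\<in>I. c i * g T i) = cinner (amp T *\<^sub>V z) w" for T by (simp add: g_def split_beta)
  have bd: "Re (k * cinner (amp T *\<^sub>V z) w) \<le> s" if "T \<in> M" for T k
    using cs(1)[of "k *\<^sub>C T"] that M(2) unfolding f by (simp add: csubspace_def amp_scaleC cinner_simps)
  \<comment> \<open>A linear functional with bounded real part on a subspace vanishes there.\<close>
  have zero: "cinner (amp T *\<^sub>V z) w = 0" if T: "T \<in> M" for T
  proof (rule ccontr)
    assume n: "\<not> ?thesis"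
    have "Re (complex_of_real (s + 1) / cinner (amp T *\<^sub>V z) w * cinner (amp T *\<^sub>V z) w) \<le> s"
      by (rule bd[OF T])
    then show False using n by simp
  qed
  have "s \<ge> 0" using bd[of _ 0] \<open>M \<noteq> {}\<close> by auto
  then have "cinner (amp T0 *\<^sub>V z) w \<noteq> 0" using cs(2) unfolding f by auto
  with zero show ?thesis by (rule that)
qed

lemma continuous_vector_functional: "continuous_map ultraweak euclidean (\<lambda>T. cinner (amp T *\<^sub>V x) y)"
proof -
  have "continuous_map euclidean euclidean (\<lambda>f :: _ \<Rightarrow> complex. f (x, y))" by simp
  from continuous_map_pullback[OF this, of UNIV "\<lambda>T (x, y). cinner (amp T *\<^sub>V x) y"]
  show ?thesis by (simp add: ultraweak_eq o_def)
qed

lemma normal_vector_functional: "normal_functional (\<lambda>T. cinner (amp T *\<^sub>V x) y)"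
  by (simp add: normal_functional_def continuous_vector_functional clinear_def amp_add amp_scaleC
      cinner_simps scaleC_complex_def)

text \<open>A normal functional is determined up to a factor by its kernel, which is an ultraweakly
  closed subspace.\<close>

lemma normal_functional_vectors:
  assumes \<omega>: "normal_functional \<omega>"
  obtains x y where "\<And>T. \<omega> T = cinner (amp T *\<^sub>V x) y"
proof (cases "\<forall>T. \<omega> T = 0")
  case True
  then show ?thesis using that[of 0 0] by simp
next
  case False
  then obtain T0 where T0: "\<omega> T0 \<noteq> 0" by blast
  have lin: "clinear \<omega>" using \<omega> by (simp add: normal_functional_def)
  define N where "N = {T. \<omega> T = 0}"
  have "closedin ultraweak {T \<in> topspace ultraweak. \<omega> T \<in> {0}}"
    using \<omega> by (intro closedin_continuous_map_preimage[of _ euclidean]) (auto simp: normal_functional_def)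
  then have "closedin ultraweak N" by (simp add: N_def)
  moreover have "csubspace N"
    by (simp add: N_def csubspace_def clinear_zero[OF lin] clinear_add[OF lin] clinear_scaleC[OF lin])
  moreover have "T0 \<notin> N" using T0 by (simp add: N_def)
  ultimately obtain x y where xy: "\<And>T. T \<in> N \<Longrightarrow> cinner (amp T *\<^sub>V x) y = 0" "cinner (amp T0 *\<^sub>V x) y \<noteq> 0"
    using ultraweak_separation[of N T0] by blast
  define k where "k = \<omega> T0 / cinner (amp T0 *\<^sub>V x) y"
  have "\<omega> T = cinner (amp T *\<^sub>V (k *\<^sub>C x)) y" for T
  proof -
    have "\<omega> (T - (\<omega> T / \<omega> T0) *\<^sub>C T0) = 0"
      using T0 by (simp add: clinear_diff[OF lin] clinear_scaleC[OF lin] scaleC_complex_def)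
    then have "cinner (amp (T - (\<omega> T / \<omega> T0) *\<^sub>C T0) *\<^sub>V x) y = 0" by (intro xy(1)) (simp add: N_def)
    then have "cinner (amp T *\<^sub>V x) y = (\<omega> T / \<omega> T0) * cinner (amp T0 *\<^sub>V x) y"
      by (simp add: amp_diff amp_scaleC cinner_simps)
    then show ?thesis using T0 xy(2) by (simp add: k_def op_scaleC cinner_simps)
  qed
  then show ?thesis by (rule that)
qed

text \<open>A weak neighbourhood of \<open>(X, Y)\<close> is determined by finitely many matrix coefficients of the two
  components. Indexing the coefficients of both by a disjoint sum reduces the claim to the
  separation in finitely many coordinates.\<close>

lemma separate_from_Conv:
  fixes S :: "(('a::chilbert_space, 'a) cblinfun \<times> ('b::chilbert_space, 'b) cblinfun) set"
  assumes S: "S \<noteq> {}" and XY: "(X, Y) \<notin> Conv S"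
  obtains u v u' v' s where
    "\<And>P Q. (P, Q) \<in> S \<Longrightarrow> Re (cinner (amp P *\<^sub>V u) v) + Re (cinner (amp Q *\<^sub>V u') v') \<le> s"
    "s < Re (cinner (amp X *\<^sub>V u) v) + Re (cinner (amp Y *\<^sub>V u') v')"
proof -
  define g1 :: "('a, 'a) cblinfun \<Rightarrow> 'a \<times> 'a \<Rightarrow> complex" where "g1 = (\<lambda>T (x, y). cinner (T *\<^sub>V x) y)"
  define g2 :: "('b, 'b) cblinfun \<Rightarrow> 'b \<times> 'b \<Rightarrow> complex" where "g2 = (\<lambda>T (x, y). cinner (T *\<^sub>V x) y)"
  define g where "g = (\<lambda>T. case_sum (g1 (fst T)) (g2 (snd T)))"
  obtain W where W: "openin (prod_topology WOT WOT) W" "(X, Y) \<in> W"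
      "\<not> (\<exists>T. T \<in> convex hull S \<and> T \<in> W)"
    using XY unfolding Conv_def in_closure_of by auto
  from W(1)[unfolded openin_prod_topology_alt, rule_format, OF W(2)]
  obtain U V where UV: "openin WOT U" "openin WOT V" "X \<in> U" "Y \<in> V" "U \<times> V \<subseteq> W"
    by blast
  obtain I1 e1 where I1: "finite I1" "e1 > 0"
    "\<And>T. (\<And>i. i \<in> I1 \<Longrightarrow> dist (g1 T i) (g1 X i) < e1) \<Longrightarrow> T \<in> U"
    using pullback_neighbourhood[of g1 U X] UV(1,3) unfolding WOT_def g1_def by blast
  obtain I2 e2 where I2: "finite I2" "e2 > 0"
    "\<And>T. (\<And>i. i \<in> I2 \<Longrightarrow> dist (g2 T i) (g2 Y i) < e2) \<Longrightarrow> T \<in> V"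
    using pullback_neighbourhood[of g2 V Y] UV(2,4) unfolding WOT_def g2_def by blast
  define I where "I = Inl ` I1 \<union> Inr ` I2"
  define e where "e = min e1 e2"
  have I: "finite I" "e > 0" using I1 I2 by (auto simp: I_def e_def)
  have lin: "linear (\<lambda>T. g T i)" for i
    by (cases i) (auto intro!: linearI simp: g_def g1_def g2_def split_beta cinner_simps scaleR_conv_of_real)
  have far: "\<exists>i\<in>I. e \<le> dist (g T i) (g (X, Y) i)" if T: "T \<in> convex hull S" for T
  proof (rule ccontr)
    assume "\<not> ?thesis"
    then have lt: "\<And>i. i \<in> I \<Longrightarrow> dist (g T i) (g (X, Y) i) < e" by (meson not_less)
    have "fst T \<in> U"
    proof (rule I1(3))
      fix i assume "i \<in> I1"
      then show "dist (g1 (fst T) i) (g1 X i) < e1" using lt[of "Inl i"] by (simp add: I_def e_def g_def)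
    qed
    moreover have "snd T \<in> V"
    proof (rule I2(3))
      fix i assume "i \<in> I2"
      then show "dist (g2 (snd T) i) (g2 Y i) < e2" using lt[of "Inr i"] by (simp add: I_def e_def g_def)
    qed
    ultimately have "T \<in> W" using UV(5) by (auto simp: mem_Times_iff)
    then show False using W(3) T by blast
  qed
  have ne: "convex hull S \<noteq> {}" using S by simp
  obtain c s where cs: "\<And>T. T \<in> convex hull S \<Longrightarrow> Re (\<Sum>i\<in>I. c i * g T i) \<le> s"
    "s < Re (\<Sum>i\<in>I. c i * g (X, Y) i)"
    using separate_convex[OF lin convex_convex_hull ne I far] by blast
  obtain u v where uv: "\<And>T. cinner (amp T *\<^sub>V u) v = (\<Sum>i\<in>I1. c (Inl i) * cinner
      (amp T *\<^sub>V (unit_seq 0 \<otimes>\<^sub>v fst i)) (unit_seq 0 \<otimes>\<^sub>v snd i))"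
    using finite_sum_of_vector_functionals[OF I1(1),
      where c = "\<lambda>i. c (Inl i)" and x = "\<lambda>i. unit_seq 0 \<otimes>\<^sub>v fst i"
        and y = "\<lambda>i. unit_seq 0 \<otimes>\<^sub>v snd i"] by blast
  obtain u' v' where uv': "\<And>T. cinner (amp T *\<^sub>V u') v' = (\<Sum>i\<in>I2. c (Inr i) * cinner
      (amp T *\<^sub>V (unit_seq 0 \<otimes>\<^sub>v fst i)) (unit_seq 0 \<otimes>\<^sub>v snd i))"
    using finite_sum_of_vector_functionals[OF I2(1),
      where c = "\<lambda>i. c (Inr i)" and x = "\<lambda>i. unit_seq 0 \<otimes>\<^sub>v fst i"
        and y = "\<lambda>i. unit_seq 0 \<otimes>\<^sub>v snd i"] by blast
  have "(\<Sum>i\<in>I. c i * g (P, Q) i) = (\<Sum>i\<in>I1. c (Inl i) * g1 P i) + (\<Sum>i\<in>I2. c (Inr i) * g2 Q i)" for P Q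
    unfolding I_def using I1(1) I2(1)
    by (subst sum.union_disjoint) (auto simp: sum.reindex g_def)
  then have eq: "(\<Sum>i\<in>I. c i * g (P, Q) i) = cinner (amp P *\<^sub>V u) v + cinner (amp Q *\<^sub>V u') v'" for P Q
    by (simp add: uv uv' cinner_amp_unit_tensor g1_def g2_def split_beta del: amp_tensor)
  show ?thesis
  proof (rule that[of u v u' v' s])
    show "Re (cinner (amp P *\<^sub>V u) v) + Re (cinner (amp Q *\<^sub>V u') v') \<le> s" if "(P, Q) \<in> S" for P Q
      using cs(1)[of "(P, Q)"] hull_inc[OF that] by (simp add: eq)
    show "s < Re (cinner (amp X *\<^sub>V u) v) + Re (cinner (amp Y *\<^sub>V u') v')" using cs(2) by (simp add: eq)
  qed
qed

section \<open>Slice maps\<close>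

definition left_tensor :: "complex ell2 \<Rightarrow> ('a::chilbert_space, 'a ell2) cblinfun" where
  "left_tensor e = Abs_cblinfun (\<lambda>h. e \<otimes>\<^sub>v h)"

lemma left_tensor_apply [simp]: "left_tensor e *\<^sub>V h = e \<otimes>\<^sub>v h"
proof -
  have "clinear (\<lambda>h::'a. e \<otimes>\<^sub>v h)" by (simp add: clinear_def etensor_add_right etensor_scaleC_right)
  then have "cblinfun_apply (Abs_cblinfun (\<lambda>h::'a. e \<otimes>\<^sub>v h)) = (\<lambda>h. e \<otimes>\<^sub>v h)"
    by (rule op_exists[of _ "norm e"]) (simp add: norm_etensor)
  then show ?thesis by (simp add: left_tensor_def)
qed

lemma adj_left_unit_tensor [simp]: "adj (left_tensor (unit_seq j)) *\<^sub>V z = coord z j"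
  by (rule cinner_ext_left) (simp add: cinner_adj_left cinner_unit_tensor_right)

definition tensor_seq :: "'h::chilbert_space ell2 \<Rightarrow> (complex ell2, 'h ell2 ell2) cblinfun" where
  "tensor_seq u = Abs_cblinfun (\<lambda>a. Abs_ell2 (\<lambda>n. a \<otimes>\<^sub>v coord u n))"

lemma coord_tensor_seq [simp]: "coord (tensor_seq u *\<^sub>V a) n = a \<otimes>\<^sub>v coord u n"
  and norm_tensor_seq: "norm (tensor_seq u *\<^sub>V a) \<le> norm u * norm a"
proof -
  define f where "f a = Abs_ell2 (\<lambda>n. a \<otimes>\<^sub>v coord u n)" for a
  have "norm (a \<otimes>\<^sub>v coord u n) \<le> norm a * norm (coord u n)" for a n by (simp add: norm_etensor)
  note b = square_summable_bound[OF this]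
  have cf: "coord (f a) n = a \<otimes>\<^sub>v coord u n" for a n by (simp add: f_def b(1))
  have bd: "norm (f a) \<le> norm u * norm a" for a using b(2)[of a] by (simp add: f_def mult.commute)
  have "clinear f"
    unfolding clinear_def
    by (intro conjI allI; rule ell2_ext) (simp_all add: cf etensor_add_left etensor_scaleC_left)
  from op_exists[OF this bd] have app: "cblinfun_apply (tensor_seq u) = f"
    by (simp add: tensor_seq_def f_def[abs_def])
  show "coord (tensor_seq u *\<^sub>V a) n = a \<otimes>\<^sub>v coord u n" by (simp add: app cf)
  show "norm (tensor_seq u *\<^sub>V a) \<le> norm u * norm a" by (simp add: app bd)
qed

lemma tensor_seq_add: "tensor_seq (u + v) = tensor_seq u + tensor_seq v"
  and tensor_seq_scaleC: "tensor_seq (c *\<^sub>C u) = c *\<^sub>C tensor_seq u"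
  by (rule op_ext, rule ell2_ext, simp add: etensor_add_right etensor_scaleC_right)+

text \<open>The normal slice map of the functional \<open>T \<mapsto> \<Sum>\<^sub>n \<langle>T u\<^sub>n, v\<^sub>n\<rangle>\<close>, as a compression of the
  amplification; this form makes its boundedness and ultraweak continuity visible.\<close>

definition vector_slice :: "'h::chilbert_space ell2 \<Rightarrow> 'h ell2 \<Rightarrow> ('h ell2, 'h ell2) cblinfun
    \<Rightarrow> (complex ell2, complex ell2) cblinfun" where
  "vector_slice u v Z = adj (tensor_seq v) \<cdot> amp Z \<cdot> tensor_seq u"

lemma vector_slice_sums:
  "(\<lambda>n. cinner (Z *\<^sub>V (a \<otimes>\<^sub>v coord u n)) (b \<otimes>\<^sub>v coord v n)) sums cinner (vector_slice u v Z *\<^sub>V a) b"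
  using cinner_ell2_sums[of "amp Z *\<^sub>V (tensor_seq u *\<^sub>V a)" "tensor_seq v *\<^sub>V b"]
  by (simp add: vector_slice_def cinner_adj_left)

lemma clinear_vector_slice: "clinear (vector_slice u v)"
  unfolding clinear_def
  by (intro conjI allI op_ext) (simp_all add: vector_slice_def amp_add amp_scaleC op_linear_simps)

lemma vector_slice_tensor: "vector_slice u v (A \<otimes>\<^sub>o B) = cinner (amp B *\<^sub>V u) v *\<^sub>C A"
proof (rule op_ext, rule cinner_ext_left)
  fix a b
  have "(\<lambda>n. cinner (A *\<^sub>V a) b * cinner (B *\<^sub>V coord u n) (coord v n))
      sums (cinner (A *\<^sub>V a) b * cinner (amp B *\<^sub>V u) v)"
    using sums_mult[OF cinner_ell2_sums[of "amp B *\<^sub>V u" v]] by simp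
  then have "cinner (vector_slice u v (A \<otimes>\<^sub>o B) *\<^sub>V a) b = cinner (A *\<^sub>V a) b * cinner (amp B *\<^sub>V u) v"
    using vector_slice_sums[of "A \<otimes>\<^sub>o B" a u b v] by (simp add: cinner_etensor sums_unique2)
  then show "cinner (vector_slice u v (A \<otimes>\<^sub>o B) *\<^sub>V a) b = cinner ((cinner (amp B *\<^sub>V u) v *\<^sub>C A) *\<^sub>V a) b"
    by (simp add: cinner_simps)
qed

text \<open>A vector functional composed with the slice map is a double series of matrix coefficients,
  which is a vector functional again after flattening.\<close>

lemma continuous_vector_slice: "continuous_map ultraweak ultraweak (vector_slice u v)"
proof -
  let ?F = "\<lambda>(T :: (complex ell2, complex ell2) cblinfun) (x, y). cinner (amp T *\<^sub>V x) y"
  have comp: "continuous_map ultraweak euclidean (\<lambda>Z. cinner (amp (vector_slice u v Z) *\<^sub>V a) b)" for a b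
  proof -
    have "cinner (amp (vector_slice u v Z) *\<^sub>V a) b
        = cinner (amp Z *\<^sub>V flatten (amp (tensor_seq u) *\<^sub>V a)) (flatten (amp (tensor_seq v) *\<^sub>V b))" for Z
      by (simp add: amp_flatten cinner_flatten vector_slice_def amp_comp adj_amp[symmetric] cinner_adj_left)
    then show ?thesis by (simp add: continuous_vector_functional)
  qed
  have "continuous_map ultraweak (product_topology (\<lambda>_. euclidean) UNIV) (?F \<circ> vector_slice u v)"
    unfolding continuous_map_componentwise_UNIV using comp by (auto simp: o_def)
  then have "continuous_map ultraweak euclidean (?F \<circ> vector_slice u v)"
    by (simp only: euclidean_product_topology)
  then show ?thesis
    by (subst (2) ultraweak_eq) (rule continuous_map_pullback', auto)
qed

definition truncation :: "nat \<Rightarrow> ('a::chilbert_space ell2, 'a ell2) cblinfun" where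
  "truncation N = (\<Sum>i<N. left_tensor (unit_seq i) \<cdot> adj (left_tensor (unit_seq i)))"

lemma truncation_apply: "truncation N *\<^sub>V z = (\<Sum>i<N. unit_seq i \<otimes>\<^sub>v coord z i)"
  by (simp add: truncation_def)

lemma amp_truncation_tendsto: "(\<lambda>N. amp (truncation N) *\<^sub>V \<alpha>) \<longlonglongrightarrow> \<alpha>"
proof (rule LIM_zero_cancel, rule tendsto_norm_zero_cancel)
  define f where "f k N = (norm (truncation N *\<^sub>V coord \<alpha> k - coord \<alpha> k))\<^sup>2" for k N
  have bound: "f k N \<le> (norm (coord \<alpha> k))\<^sup>2" for k N
    unfolding f_def truncation_apply unit_tensor_remainder by (simp add: sum_nonneg)
  have nonneg: "0 \<le> f k N" for k N by (simp add: f_def)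
  have lim: "f k \<longlonglongrightarrow> 0" for k
  proof -
    have "(\<lambda>N. truncation N *\<^sub>V coord \<alpha> k) \<longlonglongrightarrow> coord \<alpha> k"
      unfolding truncation_apply using unit_tensor_expansion by (simp add: sums_def)
    from tendsto_power[OF tendsto_norm_zero[OF LIM_zero[OF this]], of 2]
    show ?thesis by (simp add: f_def[abs_def])
  qed
  have "(\<lambda>N. \<Sum>k. f k N) \<longlonglongrightarrow> (\<Sum>k. 0)"
    by (rule tannerys_theorem[THEN conjunct2, THEN conjunct2, of f "\<lambda>_. 0" sequentially "\<lambda>k. (norm (coord \<alpha> k))\<^sup>2"])
      (use lim bound nonneg in \<open>auto simp: coord_summable intro!: always_eventually\<close>)
  moreover have "(norm (amp (truncation N) *\<^sub>V \<alpha> - \<alpha>))\<^sup>2 = (\<Sum>k. f k N)" for N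
    by (simp add: norm_ell2_square f_def)
  ultimately have "(\<lambda>N. sqrt ((norm (amp (truncation N) *\<^sub>V \<alpha> - \<alpha>))\<^sup>2)) \<longlonglongrightarrow> sqrt 0"
    by (intro tendsto_real_sqrt) simp
  then show "(\<lambda>N. norm (amp (truncation N) *\<^sub>V \<alpha> - \<alpha>)) \<longlonglongrightarrow> 0" by simp
qed

text \<open>Compressing \<open>Z\<close> to finitely many coordinates gives a finite sum of elementary tensors of
  matrix units, and these compressions converge to \<open>Z\<close> ultraweakly.\<close>

lemma normal_functional_eq_on_tensors:
  fixes f f' :: "('h::chilbert_space ell2, 'h ell2) cblinfun \<Rightarrow> complex"
  assumes f: "normal_functional f" and f': "normal_functional f'"
    and eq: "\<And>A B. f (A \<otimes>\<^sub>o B) = f' (A \<otimes>\<^sub>o B)"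
  shows "f Z = f' Z"
proof -
  define V where "V i = (left_tensor (unit_seq i) :: ('h, 'h ell2) cblinfun)" for i
  define V' where "V' i = (left_tensor (unit_seq i) :: (complex, complex ell2) cblinfun)" for i
  have unit: "V i \<cdot> B \<cdot> adj (V j) = (V' i \<cdot> adj (V' j)) \<otimes>\<^sub>o B" for i j B
  proof (rule op_eq_on_unit_tensors)
    fix m h
    have "unit_seq i \<otimes>\<^sub>v (c::complex) = c *\<^sub>C unit_seq i" for c
      by (rule ell2_ext) (simp add: scaleC_complex_def mult.commute)
    then show "(V i \<cdot> B \<cdot> adj (V j)) *\<^sub>V (unit_seq m \<otimes>\<^sub>v h)
        = ((V' i \<cdot> adj (V' j)) \<otimes>\<^sub>o B) *\<^sub>V (unit_seq m \<otimes>\<^sub>v h)"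
      by (simp add: V_def V'_def op_scaleC etensor_scaleC_left etensor_scaleC_right)
  qed
  have comp: "truncation N \<cdot> Z \<cdot> truncation N
      = (\<Sum>i<N. \<Sum>j<N. (V' i \<cdot> adj (V' j)) \<otimes>\<^sub>o (adj (V i) \<cdot> Z \<cdot> V j))" for N
    unfolding unit[symmetric]
    by (rule op_ext) (simp add: truncation_def V_def op_sum, rule sum.swap)
  have lim: "(\<lambda>N. g (truncation N \<cdot> Z \<cdot> truncation N)) \<longlonglongrightarrow> g Z" if g: "normal_functional g" for g
  proof -
    obtain x y where xy: "\<And>T. g T = cinner (amp T *\<^sub>V x) y" using normal_functional_vectors[OF g] by blast
    have "adj (truncation N) = (truncation N :: ('h ell2, 'h ell2) cblinfun)" for N
      by (simp add: truncation_def adj_sum adj_comp)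
    then have "g (truncation N \<cdot> Z \<cdot> truncation N)
        = cinner (amp Z *\<^sub>V (amp (truncation N) *\<^sub>V x)) (amp (truncation N) *\<^sub>V y)" for N
      by (simp add: xy amp_comp cinner_adj adj_amp)
    then show ?thesis unfolding xy by (simp, intro tendsto_intros amp_truncation_tendsto)
  qed
  have lin: "clinear f" "clinear f'" using f f' by (auto simp: normal_functional_def)
  have "f (truncation N \<cdot> Z \<cdot> truncation N) = f' (truncation N \<cdot> Z \<cdot> truncation N)" for N
    unfolding comp by (simp add: clinear_sum[OF lin(1)] clinear_sum[OF lin(2)] eq)
  then show ?thesis using LIMSEQ_unique[OF lim[OF f]] lim[OF f'] by simp
qed

text \<open>For uniqueness, every matrix coefficient of a competitor is a normal functional, and normal
  functionals are determined by their values on elementary tensors.\<close>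

lemma Rslice_vector_functional:
  assumes \<omega>: "\<And>T. \<omega> T = cinner (amp T *\<^sub>V u) v"
  shows "Rslice \<omega> = vector_slice u v"
  unfolding Rslice_def
proof (rule the_equality)
  show "clinear (vector_slice u v) \<and> continuous_map ultraweak ultraweak (vector_slice u v) \<and>
      (\<forall>A B. vector_slice u v (A \<otimes>\<^sub>o B) = \<omega> B *\<^sub>C A)"
    by (simp add: clinear_vector_slice continuous_vector_slice vector_slice_tensor \<omega>)
next
  fix R
  assume R: "clinear R \<and> continuous_map ultraweak ultraweak R \<and> (\<forall>A B. R (A \<otimes>\<^sub>o B) = \<omega> B *\<^sub>C A)"
  have nf: "normal_functional (\<lambda>Z. cinner (r Z *\<^sub>V a) b)"
    if r: "clinear r" "continuous_map ultraweak ultraweak r"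
    for r :: "('a ell2, 'a ell2) cblinfun \<Rightarrow> (complex ell2, complex ell2) cblinfun" and a b
    unfolding normal_functional_def
  proof
    show "clinear (\<lambda>Z. cinner (r Z *\<^sub>V a) b)"
      using r(1) by (simp add: clinear_def cinner_simps scaleC_complex_def)
    have "continuous_map ultraweak euclidean (\<lambda>T. cinner (T *\<^sub>V a) b)"
      using continuous_vector_functional[of "unit_seq 0 \<otimes>\<^sub>v a" "unit_seq 0 \<otimes>\<^sub>v b"]
      unfolding cinner_amp_unit_tensor .
    from continuous_map_compose[OF r(2) this]
    show "continuous_map ultraweak euclidean (\<lambda>Z. cinner (r Z *\<^sub>V a) b)" by (simp add: o_def)
  qed
  show "R = vector_slice u v"
  proof (rule ext, rule op_ext, rule cinner_ext_left)
    fix Z a b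
    show "cinner (R Z *\<^sub>V a) b = cinner (vector_slice u v Z *\<^sub>V a) b"
      by (rule normal_functional_eq_on_tensors[OF nf nf])
        (use R in \<open>simp_all add: clinear_vector_slice continuous_vector_slice vector_slice_tensor \<omega>\<close>)
  qed
qed

lemma vector_slice_bound:
  assumes "\<And>z. norm (Z *\<^sub>V z) \<le> K * norm z" "K \<ge> 0"
  shows "norm (vector_slice u v Z *\<^sub>V a) \<le> (K * norm u * norm v) * norm a"
proof (cases "vector_slice u v Z *\<^sub>V a = 0")
  case False
  let ?w = "vector_slice u v Z *\<^sub>V a"
  have "norm (amp Z *\<^sub>V z) \<le> K * norm z" for z
  proof -
    have "onorm (cblinfun_apply Z) \<le> K" using assms by (intro onorm_bound) auto
    then have "onorm (cblinfun_apply Z) * norm z \<le> K * norm z" by (rule mult_right_mono) simp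
    then show ?thesis by (rule order_trans[OF norm_amp])
  qed
  then have amp_le: "norm (amp Z *\<^sub>V (tensor_seq u *\<^sub>V a)) \<le> K * (norm u * norm a)"
    by (rule order_trans) (rule mult_left_mono[OF norm_tensor_seq assms(2)])
  have "(norm ?w)\<^sup>2 = Re (cinner (amp Z *\<^sub>V (tensor_seq u *\<^sub>V a)) (tensor_seq v *\<^sub>V ?w))"
    unfolding Re_cinner_self[symmetric] by (simp add: vector_slice_def cinner_adj_left)
  also have "\<dots> \<le> norm (amp Z *\<^sub>V (tensor_seq u *\<^sub>V a)) * norm (tensor_seq v *\<^sub>V ?w)"
    by (rule Re_cinner_le_norm)
  also have "\<dots> \<le> K * (norm u * norm a) * (norm v * norm ?w)"
    by (rule mult_mono[OF amp_le norm_tensor_seq]) (use assms(2) in auto)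
  finally show ?thesis using False by (simp add: power2_eq_square mult_ac)
qed (use assms(2) in simp)

text \<open>For fixed \<open>Z\<close> the form \<open>(u, v) \<mapsto> \<phi> (vector_slice u v Z)\<close> is bounded, so it comes from an
  operator on \<open>l\<^sub>2 \<otimes> H\<close>. On elementary tensors of unit vectors the form is diagonal in the first factor, which
  forces that operator to be an amplification.\<close>

lemma left_slice_exists:
  fixes Z :: "('h::chilbert_space ell2, 'h ell2) cblinfun"
  assumes \<phi>: "state \<phi>"
  obtains X where "\<And>u v. cinner (amp X *\<^sub>V u) v = \<phi> (vector_slice u v Z)"
proof -
  have lin: "clinear \<phi>" by (rule stateD(1)[OF \<phi>])
  obtain K where K: "K > 0" "\<And>z. norm (Z *\<^sub>V z) \<le> K * norm z" using op_bound[of Z] by blast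
  have ladd: "vector_slice (u + u') v Z = vector_slice u v Z + vector_slice u' v Z"
    and radd: "vector_slice u (v + v') Z = vector_slice u v Z + vector_slice u v' Z"
    and lscale: "vector_slice (c *\<^sub>C u) v Z = c *\<^sub>C vector_slice u v Z"
    and rscale: "vector_slice u (c *\<^sub>C v) Z = cnj c *\<^sub>C vector_slice u v Z" for u u' v v' c
    by (rule op_ext; simp add: vector_slice_def tensor_seq_add tensor_seq_scaleC adj_add adj_scaleC
        op_linear_simps)+
  obtain Y where Y: "\<And>u v. \<phi> (vector_slice u v Z) = cinner (Y *\<^sub>V u) v"
  proof (rule sesquilinear_form_op[of "\<lambda>u v. \<phi> (vector_slice u v Z)" K])
    show "cmod (\<phi> (vector_slice u v Z)) \<le> K * norm u * norm v" for u v
      by (rule state_norm_bound[OF \<phi> vector_slice_bound]) (use K in auto)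
  qed (auto simp: ladd radd lscale rscale clinear_add[OF lin] clinear_scaleC[OF lin] scaleC_complex_def)
  define X where "X = adj (left_tensor (unit_seq 0)) \<cdot> Y \<cdot> left_tensor (unit_seq 0)"
  have slice: "vector_slice (unit_seq i \<otimes>\<^sub>v x) (unit_seq j \<otimes>\<^sub>v y) Z
      = (if i = j then vector_slice (unit_seq 0 \<otimes>\<^sub>v x) (unit_seq 0 \<otimes>\<^sub>v y) Z else 0)" for i j x y
  proof (rule op_ext, rule cinner_ext_left)
    fix a b
    have "(\<lambda>n. cinner (Z *\<^sub>V (a \<otimes>\<^sub>v coord (unit_seq i \<otimes>\<^sub>v x) n)) (b \<otimes>\<^sub>v coord (unit_seq j \<otimes>\<^sub>v y) n))
        sums (if i = j then cinner (Z *\<^sub>V (a \<otimes>\<^sub>v x)) (b \<otimes>\<^sub>v y) else 0)" for i j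
      using sums_single[of i "\<lambda>n. if i = j then cinner (Z *\<^sub>V (a \<otimes>\<^sub>v x)) (b \<otimes>\<^sub>v y) else 0"]
      by (rule back_subst[of "\<lambda>f. f sums _"]) (auto simp: coord_unit_seq)
    then have "cinner (vector_slice (unit_seq i \<otimes>\<^sub>v x) (unit_seq j \<otimes>\<^sub>v y) Z *\<^sub>V a) b
        = (if i = j then cinner (Z *\<^sub>V (a \<otimes>\<^sub>v x)) (b \<otimes>\<^sub>v y) else 0)" for i j
      by (rule sums_unique2[OF vector_slice_sums])
    then show "cinner (vector_slice (unit_seq i \<otimes>\<^sub>v x) (unit_seq j \<otimes>\<^sub>v y) Z *\<^sub>V a) b = cinner
        ((if i = j then vector_slice (unit_seq 0 \<otimes>\<^sub>v x) (unit_seq 0 \<otimes>\<^sub>v y) Z else 0) *\<^sub>V a) b"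
      by simp
  qed
  have "amp X = Y"
  proof (rule op_eq_on_unit_tensors, rule ell2_ext, rule cinner_ext_left)
    fix i x j y
    have "cinner (coord (amp X *\<^sub>V (unit_seq i \<otimes>\<^sub>v x)) j) y
        = (if i = j then cinner (X *\<^sub>V x) y else 0)"
      by (simp add: coord_unit_seq)
    also have "cinner (X *\<^sub>V x) y = \<phi> (vector_slice (unit_seq 0 \<otimes>\<^sub>v x) (unit_seq 0 \<otimes>\<^sub>v y) Z)"
      by (simp add: X_def Y cinner_unit_tensor_right)
    also have "(if i = j then \<phi> (vector_slice (unit_seq 0 \<otimes>\<^sub>v x) (unit_seq 0 \<otimes>\<^sub>v y) Z) else 0)
        = \<phi> (vector_slice (unit_seq i \<otimes>\<^sub>v x) (unit_seq j \<otimes>\<^sub>v y) Z)"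
      by (simp only: slice[of i x j y] if_distrib[of \<phi>] clinear_zero[OF lin])
    also have "\<dots> = cinner (coord (Y *\<^sub>V (unit_seq i \<otimes>\<^sub>v x)) j) y"
      by (simp add: Y cinner_unit_tensor_right)
    finally show "cinner (coord (amp X *\<^sub>V (unit_seq i \<otimes>\<^sub>v x)) j) y
        = cinner (coord (Y *\<^sub>V (unit_seq i \<otimes>\<^sub>v x)) j) y" .
  qed
  then show ?thesis using that[of X] Y by simp
qed

lemma Lslice_vector_functional:
  fixes Z :: "('h::chilbert_space ell2, 'h ell2) cblinfun"
  assumes \<phi>: "state \<phi>"
  shows "cinner (amp (Lslice \<phi> Z) *\<^sub>V u) v = \<phi> (vector_slice u v Z)"
proof -
  obtain X where X: "\<And>u v. cinner (amp X *\<^sub>V u) v = \<phi> (vector_slice u v Z)"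
    using left_slice_exists[OF \<phi>] by blast
  have "Lslice \<phi> Z = X"
    unfolding Lslice_def
  proof (rule the_equality)
    show "\<forall>\<omega>. normal_functional \<omega> \<longrightarrow> \<omega> X = \<phi> (Rslice \<omega> Z)"
    proof (intro allI impI)
      fix \<omega> :: "('h, 'h) cblinfun \<Rightarrow> complex" assume "normal_functional \<omega>"
      then obtain x y where xy: "\<And>T. \<omega> T = cinner (amp T *\<^sub>V x) y"
        using normal_functional_vectors by blast
      show "\<omega> X = \<phi> (Rslice \<omega> Z)" unfolding Rslice_vector_functional[OF xy] xy X ..
    qed
  next
    fix X' assume X': "\<forall>\<omega>. normal_functional \<omega> \<longrightarrow> \<omega> X' = \<phi> (Rslice \<omega> Z)"
    show "X' = X"
    proof (rule op_ext, rule cinner_ext_left)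
      fix x y
      let ?\<omega> = "\<lambda>T :: ('h, 'h) cblinfun. cinner (amp T *\<^sub>V (unit_seq 0 \<otimes>\<^sub>v x)) (unit_seq 0 \<otimes>\<^sub>v y)"
      have "?\<omega> X' = \<phi> (Rslice ?\<omega> Z)" using X' normal_vector_functional by blast
      also have "\<dots> = ?\<omega> X" unfolding Rslice_vector_functional[OF refl] X ..
      finally show "cinner (X' *\<^sub>V x) y = cinner (X *\<^sub>V x) y" unfolding cinner_amp_unit_tensor .
    qed
  qed
  then show ?thesis by (simp add: X)
qed

text \<open>By the duality of slice maps this means that the left slice of \<open>Z\<close> by the vector state of \<open>e\<close>
  is the compression of \<open>Z\<close> by \<open>h \<mapsto> e \<otimes> h\<close>.\<close>

lemma vector_slice_vector_state:
  "cinner (vector_slice u v Z *\<^sub>V e) e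
    = cinner (amp (adj (left_tensor e) \<cdot> Z \<cdot> left_tensor e) *\<^sub>V u) v"
proof -
  have "(\<lambda>n. cinner (Z *\<^sub>V (e \<otimes>\<^sub>v coord u n)) (e \<otimes>\<^sub>v coord v n)) sums
      cinner (amp (adj (left_tensor e) \<cdot> Z \<cdot> left_tensor e) *\<^sub>V u) v"
    using cinner_ell2_sums[of "amp (adj (left_tensor e) \<cdot> Z \<cdot> left_tensor e) *\<^sub>V u" v]
    by (simp add: cinner_adj_left)
  then show ?thesis by (rule sums_unique2[OF vector_slice_sums])
qed

section \<open>Cyclic projections and the bicommutant theorem\<close>

definition unital_star_algebra :: "('a::chilbert_space, 'a) cblinfun set \<Rightarrow> bool" where
  "unital_star_algebra R \<longleftrightarrow> csubspace R \<and> id_op \<in> R \<and> (\<forall>A\<in>R. \<forall>B\<in>R. A \<cdot> B \<in> R) \<and> (\<forall>A\<in>R. adj A \<in> R)"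

lemma von_neumann_star_algebra: "von_neumann_algebra D \<Longrightarrow> unital_star_algebra D"
  by (simp add: von_neumann_algebra_def unital_star_algebra_def)

lemma commutant_apply: "A \<in> commutant R \<Longrightarrow> B \<in> R \<Longrightarrow> A *\<^sub>V (B *\<^sub>V x) = B *\<^sub>V (A *\<^sub>V x)"
  by (rule op_commute_apply) (simp add: commutant_def)

lemma commutantI: "(\<And>B x. B \<in> R \<Longrightarrow> A *\<^sub>V (B *\<^sub>V x) = B *\<^sub>V (A *\<^sub>V x)) \<Longrightarrow> A \<in> commutant R"
  unfolding commutant_def by (auto intro: op_ext)

lemma commutant_star_algebra:
  assumes "unital_star_algebra R" shows "unital_star_algebra (commutant R)"
  unfolding unital_star_algebra_def csubspace_def
proof (intro conjI ballI allI)
  show "adj A \<in> commutant R" if A: "A \<in> commutant R" for A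
    unfolding commutant_def
  proof (intro CollectI ballI)
    fix B assume "B \<in> R"
    then have "adj B \<in> R" using assms by (simp add: unital_star_algebra_def)
    then have "A \<cdot> adj B = adj B \<cdot> A" using A by (simp add: commutant_def)
    from arg_cong[OF this, of adj] show "adj A \<cdot> B = B \<cdot> adj A" by (simp add: adj_comp)
  qed
next
  fix A B c assume A: "A \<in> commutant R"
  show "c *\<^sub>C A \<in> commutant R" by (rule commutantI) (simp add: op_scaleC commutant_apply[OF A])
  assume B: "B \<in> commutant R"
  show "A + B \<in> commutant R"
    by (rule commutantI) (simp add: op_add commutant_apply[OF A] commutant_apply[OF B])
  show "A \<cdot> B \<in> commutant R"
    by (rule commutantI) (simp add: commutant_apply[OF A] commutant_apply[OF B])
qed (auto intro!: commutantI)

text \<open>The closure of the orbit of \<open>\<xi>\<close> is invariant under the amplified algebra, which is closed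
  under adjoints, so this subspace reduces every amplified operator.\<close>

lemma cyclic_projection:
  assumes R: "unital_star_algebra R"
  obtains P where "P \<in> projections" "P *\<^sub>V \<xi> = \<xi>" "\<And>B. B \<in> R \<Longrightarrow> P \<cdot> amp B = amp B \<cdot> P"
    "\<And>x. P *\<^sub>V x \<in> closure ((\<lambda>B. amp B *\<^sub>V \<xi>) ` R)"
proof -
  let ?N0 = "(\<lambda>B. amp B *\<^sub>V \<xi>) ` R"
  have R': "csubspace R" "id_op \<in> R" "\<And>A B. A \<in> R \<Longrightarrow> B \<in> R \<Longrightarrow> A \<cdot> B \<in> R" "\<And>A. A \<in> R \<Longrightarrow> adj A \<in> R"
    using R by (auto simp: unital_star_algebra_def)
  have "csubspace ?N0"
    unfolding csubspace_def
  proof (intro conjI ballI allI)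
    show "0 \<in> ?N0" using R'(1) by (intro image_eqI[of _ _ 0]) (auto simp: amp_zero csubspace_def)
    show "x + y \<in> ?N0" if "x \<in> ?N0" "y \<in> ?N0" for x y
      using that R'(1) by (auto simp: csubspace_def simp flip: add_op_apply amp_add)
    show "c *\<^sub>C x \<in> ?N0" if "x \<in> ?N0" for c x
      using that R'(1) by (auto simp: csubspace_def simp flip: scaleC_op_apply amp_scaleC)
  qed
  then obtain P where P: "P \<in> projections" "\<And>x. P *\<^sub>V x \<in> closure ?N0" "\<And>x. x \<in> closure ?N0 \<Longrightarrow> P *\<^sub>V x = x"
    using projection_onto[OF closed_closure csubspace_closure] by blast
  have inv: "amp B *\<^sub>V x \<in> closure ?N0" if B: "B \<in> R" and x: "x \<in> closure ?N0" for B x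
  proof -
    obtain X where X: "\<And>n. X n \<in> ?N0" "X \<longlonglongrightarrow> x" using x unfolding closure_sequential by blast
    have "amp B *\<^sub>V X n \<in> ?N0" for n
    proof -
      obtain C where "C \<in> R" "X n = amp C *\<^sub>V \<xi>" using X(1) by blast
      then show ?thesis using R'(3)[OF B] by (intro image_eqI[of _ _ "B \<cdot> C"]) (simp_all add: amp_comp)
    qed
    moreover have "(\<lambda>n. amp B *\<^sub>V X n) \<longlonglongrightarrow> amp B *\<^sub>V x" by (intro tendsto_intros X)
    ultimately show ?thesis
      unfolding closure_sequential by (intro exI[of _ "\<lambda>n. amp B *\<^sub>V X n"]) simp
  qed
  have mem: "x \<in> closure ?N0" if "P *\<^sub>V x = x" for x using P(2)[of x] that by simp
  show ?thesis
  proof (rule that[OF P(1)])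
    have "\<xi> \<in> ?N0" using R'(2) by (intro image_eqI[of _ _ id_op]) (simp_all add: amp_id)
    then show "P *\<^sub>V \<xi> = \<xi>" by (intro P(3) subsetD[OF closure_subset])
    show "P \<cdot> amp B = amp B \<cdot> P" if B: "B \<in> R" for B
    proof (rule projection_commute[OF P(1)])
      show "P *\<^sub>V (amp B *\<^sub>V x) = amp B *\<^sub>V x" if "P *\<^sub>V x = x" for x
        by (rule P(3)[OF inv[OF B mem[OF that]]])
      show "P *\<^sub>V (adj (amp B) *\<^sub>V x) = adj (amp B) *\<^sub>V x" if "P *\<^sub>V x = x" for x
        unfolding adj_amp by (rule P(3)[OF inv[OF R'(4)[OF B] mem[OF that]]])
    qed
  qed (rule P(2))
qed

text \<open>The matrix entries of \<open>P\<close> lie in the commutant of \<open>R\<close>, so they commute with \<open>T\<close>.\<close>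

lemma amp_bicommutant:
  assumes P: "\<And>B. B \<in> R \<Longrightarrow> P \<cdot> amp B = amp B \<cdot> P" and T: "T \<in> commutant (commutant R)"
  shows "P \<cdot> amp T = amp T \<cdot> P"
proof (rule op_eq_on_unit_tensors, rule ell2_ext)
  fix j h i
  define p where "p = adj (left_tensor (unit_seq i)) \<cdot> P \<cdot> left_tensor (unit_seq j)"
  have p: "p *\<^sub>V x = coord (P *\<^sub>V (unit_seq j \<otimes>\<^sub>v x)) i" for x by (simp add: p_def)
  have "p \<in> commutant R"
  proof (rule commutantI)
    fix B x assume "B \<in> R"
    from op_commute_apply[OF P[OF this], of "unit_seq j \<otimes>\<^sub>v x"]
    show "p *\<^sub>V (B *\<^sub>V x) = B *\<^sub>V (p *\<^sub>V x)" by (simp add: p)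
  qed
  from commutant_apply[OF T this]
  show "coord ((P \<cdot> amp T) *\<^sub>V (unit_seq j \<otimes>\<^sub>v h)) i = coord ((amp T \<cdot> P) *\<^sub>V (unit_seq j \<otimes>\<^sub>v h)) i"
    by (simp add: p)
qed

text \<open>A weak neighbourhood of \<open>T\<close> involves finitely many vectors. They are the entries of one
  vector \<open>\<xi>\<close> of \<open>l\<^sub>2 \<otimes> H\<close>, and the amplification of \<open>T\<close> maps \<open>\<xi>\<close> into the cyclic subspace
  generated by \<open>\<xi>\<close>.\<close>

theorem bicommutant:
  assumes D: "von_neumann_algebra D" and T: "T \<in> commutant (commutant D)"
  shows "T \<in> D"
proof (rule ccontr)
  assume "T \<notin> D"
  define g where "g = (\<lambda>(T :: ('a, 'a) cblinfun) (x, y). cinner (T *\<^sub>V x) y)"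
  have "openin (pullback_topology UNIV g euclidean) (- D)"
    using D by (simp add: von_neumann_algebra_def closedin_def WOT_def[symmetric] g_def Compl_eq_Diff_UNIV)
  then obtain I e where I: "finite I" "e > 0"
    "\<And>B. (\<And>i. i \<in> I \<Longrightarrow> dist (g B i) (g T i) < e) \<Longrightarrow> B \<in> - D"
    using pullback_neighbourhood[of g "- D" T] \<open>T \<notin> D\<close> by blast
  obtain h :: "'a \<times> 'a \<Rightarrow> nat" where h: "inj_on h I" using finite_imp_inj_to_nat_seg[OF I(1)] by auto
  define \<xi> where "\<xi> = (\<Sum>i\<in>I. unit_seq (h i) \<otimes>\<^sub>v fst i)"
  have coord_\<xi>: "coord \<xi> (h i) = fst i" if "i \<in> I" for i
  proof -
    have "coord (unit_seq (h j) \<otimes>\<^sub>v fst j) (h i) = (if j = i then fst i else 0)" if "j \<in> I" for j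
      using that \<open>i \<in> I\<close> by (cases "j = i") (simp_all add: coord_unit_seq inj_on_eq_iff[OF h])
    then have "coord \<xi> (h i) = (\<Sum>j\<in>I. if j = i then fst i else 0)"
      by (simp add: \<xi>_def del: coord_etensor)
    then show ?thesis using I(1) that by simp
  qed
  obtain P where P: "P *\<^sub>V \<xi> = \<xi>" "\<And>B. B \<in> D \<Longrightarrow> P \<cdot> amp B = amp B \<cdot> P"
    "\<And>x. P *\<^sub>V x \<in> closure ((\<lambda>B. amp B *\<^sub>V \<xi>) ` D)"
    using cyclic_projection[OF von_neumann_star_algebra[OF D], of \<xi>] by metis
  have "P *\<^sub>V (amp T *\<^sub>V \<xi>) = amp T *\<^sub>V \<xi>"
    using op_commute_apply[OF amp_bicommutant[OF P(2) T], of \<xi>] P(1) by simp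
  then have cl: "amp T *\<^sub>V \<xi> \<in> closure ((\<lambda>B. amp B *\<^sub>V \<xi>) ` D)" using P(3)[of "amp T *\<^sub>V \<xi>"] by simp
  define m where "m = 1 + (\<Sum>i\<in>I. norm (snd i))"
  have m: "m > 0" by (simp add: m_def add_pos_nonneg sum_nonneg)
  then have "e / m > 0" using I(2) by simp
  then obtain B where B: "B \<in> D" "dist (amp B *\<^sub>V \<xi>) (amp T *\<^sub>V \<xi>) < e / m"
    using cl unfolding closure_approachable by blast
  have "dist (g B i) (g T i) < e" if i: "i \<in> I" for i
  proof -
    have "norm (B *\<^sub>V fst i - T *\<^sub>V fst i) < e / m"
      using norm_coord_le[of "amp B *\<^sub>V \<xi> - amp T *\<^sub>V \<xi>" "h i"] B(2) by (simp add: coord_\<xi>[OF i] dist_norm)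
    moreover have "norm (snd i) \<le> (\<Sum>i\<in>I. norm (snd i))" using I(1) i by (intro member_le_sum) auto
    then have "norm (snd i) < m" by (simp add: m_def)
    ultimately have "norm (B *\<^sub>V fst i - T *\<^sub>V fst i) * norm (snd i) < e / m * m"
      using \<open>e / m > 0\<close> by (intro mult_strict_mono) auto
    then have "cmod (cinner (B *\<^sub>V fst i - T *\<^sub>V fst i) (snd i)) < e"
      using cinner_Cauchy_Schwarz m by (smt (verit) nonzero_eq_divide_eq)
    then show ?thesis by (simp add: g_def split_beta dist_norm cinner_diff_left)
  qed
  from I(3)[OF this] B(1) show False by blast
qed


section \<open>The minimal bimodule\<close>

lemma vector_slice_compression:
  assumes R: "R \<in> projections" and e: "norm e = 1"
    and A: "A = adj (left_tensor e) \<cdot> R \<cdot> left_tensor e"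
  shows "cinner (A *\<^sub>V x) x = complex_of_real ((norm (R *\<^sub>V (e \<otimes>\<^sub>v x)))\<^sup>2)"
    and "positive_op A" and "Re (cinner (A *\<^sub>V x) x) \<le> (norm x)\<^sup>2"
    and "R \<cdot> amp C = amp C \<cdot> R \<Longrightarrow> A \<cdot> C = C \<cdot> A"
proof -
  have form: "cinner (A *\<^sub>V x) x = complex_of_real ((norm (R *\<^sub>V (e \<otimes>\<^sub>v x)))\<^sup>2)" for x
    by (simp add: A cinner_adj_left cinner_projection[OF R])
  then show "cinner (A *\<^sub>V x) x = complex_of_real ((norm (R *\<^sub>V (e \<otimes>\<^sub>v x)))\<^sup>2)" .
  have "adj A = A" by (simp add: A adj_comp projectionsD(2)[OF R] comp_op_assoc)
  then show "positive_op A" by (simp add: positive_op_def form)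
  show "Re (cinner (A *\<^sub>V x) x) \<le> (norm x)\<^sup>2"
    using projection_norm_le[OF R, of "e \<otimes>\<^sub>v x"] by (simp add: form norm_etensor e power_mono)
  assume C: "R \<cdot> amp C = amp C \<cdot> R"
  show "A \<cdot> C = C \<cdot> A"
  proof (rule op_ext, rule cinner_ext_left)
    fix x y
    have "cinner ((A \<cdot> C) *\<^sub>V x) y = cinner (R *\<^sub>V (amp C *\<^sub>V (e \<otimes>\<^sub>v x))) (e \<otimes>\<^sub>v y)"
      by (simp add: A cinner_adj_left)
    also have "\<dots> = cinner (R *\<^sub>V (e \<otimes>\<^sub>v x)) (amp (adj C) *\<^sub>V (e \<otimes>\<^sub>v y))"
      unfolding op_commute_apply[OF C] cinner_adj[of "amp C"] adj_amp ..
    also have "\<dots> = cinner ((C \<cdot> A) *\<^sub>V x) y" by (simp add: A cinner_adj_left cinner_adj[of C])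
    finally show "cinner ((A \<cdot> C) *\<^sub>V x) y = cinner ((C \<cdot> A) *\<^sub>V x) y" .
  qed
qed

lemma vector_functional_layer_sum:
  fixes n :: nat
  assumes "\<And>x. norm ((A - (1 / real n) *\<^sub>R (\<Sum>k=1..n. E k)) *\<^sub>V x) \<le> 1 / real n * norm x"
  shows "Re (cinner (amp A *\<^sub>V u) v)
    \<le> 1 / real n * (\<Sum>k=1..n. Re (cinner (amp (E k) *\<^sub>V u) v)) + 1 / real n * (norm u * norm v)"
proof -
  let ?T = "A - (1 / real n) *\<^sub>R (\<Sum>k=1..n. E k)"
  have amp_sum: "amp (\<Sum>k=1..n. E k) = (\<Sum>k=1..n. amp (E k))"
    by (rule op_ext, rule ell2_ext) simp
  have "onorm (cblinfun_apply ?T) \<le> 1 / real n" by (intro onorm_bound assms) simp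
  then have "norm (amp ?T *\<^sub>V u) \<le> 1 / real n * norm u"
    by (rule order_trans[OF norm_amp mult_right_mono]) simp
  then have "norm (amp ?T *\<^sub>V u) * norm v \<le> 1 / real n * norm u * norm v"
    by (rule mult_right_mono) simp
  then have "Re (cinner (amp ?T *\<^sub>V u) v) \<le> 1 / real n * norm u * norm v"
    by (rule order_trans[OF Re_cinner_le_norm])
  then show ?thesis
    unfolding amp_diff amp_scaleR amp_sum by (simp add: cinner_simps cinner_sum_left)
qed

text \<open>The slices of \<open>P\<close> and \<open>Q\<close> by a vector state are the compressions \<open>A\<close> and \<open>B\<close> below. The
  spectral projections of \<open>A\<close> for \<open>[k/n, \<infinity>)\<close> and of \<open>B\<close> for \<open>[(n + 1 - k)/n, \<infinity>)\<close> form a pair in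
  \<open>bil M\<close>, because the two thresholds add up to more than \<open>1\<close>. The averages of these pairs over
  \<open>k\<close> approximate \<open>(A, B)\<close>.\<close>

lemma vector_slices_bound:
  fixes D1 :: "('a::chilbert_space, 'a) cblinfun set" and D2 :: "('b::chilbert_space, 'b) cblinfun set"
  assumes D1: "von_neumann_algebra D1" "commutative D1"
    and D2: "von_neumann_algebra D2" "commutative D2"
    and M: "bimodule (commutant D1) (commutant D2) M"
    and P: "P \<in> projections" "\<And>C. C \<in> commutant D1 \<Longrightarrow> P \<cdot> amp C = amp C \<cdot> P"
    and Q: "Q \<in> projections" "\<And>C. C \<in> commutant D2 \<Longrightarrow> Q \<cdot> amp C = amp C \<cdot> Q"
    and QTP: "\<And>T z. T \<in> M \<Longrightarrow> Q *\<^sub>V (amp T *\<^sub>V (P *\<^sub>V z)) = 0"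
    and e: "norm e = 1"
    and bound: "\<And>E F. (E, F) \<in> bil D1 D2 M \<Longrightarrow>
      Re (cinner (amp E *\<^sub>V u) v) + Re (cinner (amp F *\<^sub>V u') v') \<le> s"
  shows "Re (cinner (amp (adj (left_tensor e) \<cdot> P \<cdot> left_tensor e) *\<^sub>V u) v)
      + Re (cinner (amp (adj (left_tensor e) \<cdot> Q \<cdot> left_tensor e) *\<^sub>V u') v') \<le> s"
proof -
  define A where "A = adj (left_tensor e) \<cdot> P \<cdot> left_tensor e"
  define B where "B = adj (left_tensor e) \<cdot> Q \<cdot> left_tensor e"
  have A: "positive_op A" "\<And>x. cinner (A *\<^sub>V x) x = complex_of_real ((norm (P *\<^sub>V (e \<otimes>\<^sub>v x)))\<^sup>2)"
      "\<And>x. Re (cinner (A *\<^sub>V x) x) \<le> (norm x)\<^sup>2" "\<And>C. C \<in> commutant D1 \<Longrightarrow> A \<cdot> C = C \<cdot> A"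
    using vector_slice_compression[OF P(1) e A_def] P(2) by blast+
  have B: "positive_op B" "\<And>x. cinner (B *\<^sub>V x) x = complex_of_real ((norm (Q *\<^sub>V (e \<otimes>\<^sub>v x)))\<^sup>2)"
      "\<And>x. Re (cinner (B *\<^sub>V x) x) \<le> (norm x)\<^sup>2" "\<And>C. C \<in> commutant D2 \<Longrightarrow> B \<cdot> C = C \<cdot> B"
    using vector_slice_compression[OF Q(1) e B_def] Q(2) by blast+
  define c where "c = norm u * norm v + norm u' * norm v'"
  have main: "Re (cinner (amp A *\<^sub>V u) v) + Re (cinner (amp B *\<^sub>V u') v') \<le> s + c / real n"
    if n: "n > 0" for n :: nat
  proof -
    obtain E where E: "\<And>k. E k \<in> projections" "\<And>k C. A \<cdot> C = C \<cdot> A \<Longrightarrow> E k \<cdot> C = C \<cdot> E k"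
      "\<And>k x. E k *\<^sub>V x = x \<Longrightarrow> real k / real n * (norm x)\<^sup>2 \<le> Re (cinner (A *\<^sub>V x) x)"
      "\<And>x. norm ((A - (1 / real n) *\<^sub>R (\<Sum>k=1..n. E k)) *\<^sub>V x) \<le> 1 / real n * norm x"
      using spectral_layer_sum[OF A(1,3) n] by blast
    obtain F where F: "\<And>k. F k \<in> projections" "\<And>k C. B \<cdot> C = C \<cdot> B \<Longrightarrow> F k \<cdot> C = C \<cdot> F k"
      "\<And>k x. F k *\<^sub>V x = x \<Longrightarrow> real k / real n * (norm x)\<^sup>2 \<le> Re (cinner (B *\<^sub>V x) x)"
      "\<And>x. norm ((B - (1 / real n) *\<^sub>R (\<Sum>k=1..n. F k)) *\<^sub>V x) \<le> 1 / real n * norm x"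
      using spectral_layer_sum[OF B(1,3) n] by blast
    have ED: "E k \<in> D1" for k
      by (rule bicommutant[OF D1(1)]) (use E(2) A(4) in \<open>auto simp: commutant_def\<close>)
    have FD: "F k \<in> D2" for k
      by (rule bicommutant[OF D2(1)]) (use F(2) B(4) in \<open>auto simp: commutant_def\<close>)
    have EC: "E k \<in> commutant D1" and FC: "F k \<in> commutant D2" for k
      using ED FD D1(2) D2(2) by (auto simp: commutative_def commutant_def)
    have pair: "(E k, F l) \<in> bil D1 D2 M" if kl: "k \<le> n" "k + l = Suc n" for k l
    proof -
      have "F l \<cdot> T \<cdot> E k = 0" if T: "T \<in> M" for T
      proof (rule spectral_corner_zero[OF P(1) Q(1) E(1)[of k] F(1)[of l],
            where V = "left_tensor e" and W = "left_tensor e" and U = "amp (F l \<cdot> T \<cdot> E k)"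
              and a = "real k / real n" and b = "real l / real n"])
        have "F l \<cdot> T \<cdot> E k \<in> M" using M T EC FC by (simp add: bimodule_def)
        then show "Q *\<^sub>V (amp (F l \<cdot> T \<cdot> E k) *\<^sub>V (P *\<^sub>V z)) = 0" for z by (rule QTP)
        show "F l \<cdot> (F l \<cdot> T \<cdot> E k) \<cdot> E k = F l \<cdot> T \<cdot> E k"
          by (rule op_ext) (simp add: projectionsD(1)[OF E(1)] projectionsD(1)[OF F(1)])
        show "real k / real n + real l / real n > 1"
          using n kl(2) by (simp add: add_divide_distrib[symmetric] flip: of_nat_add)
        show "real k / real n * (norm x)\<^sup>2 \<le> (norm (P *\<^sub>V (left_tensor e *\<^sub>V x)))\<^sup>2" if "E k *\<^sub>V x = x" for x
          using E(3)[OF that] by (simp add: A(2))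
        show "real l / real n * (norm y)\<^sup>2 \<le> (norm (Q *\<^sub>V (left_tensor e *\<^sub>V y)))\<^sup>2" if "F l *\<^sub>V y = y" for y
          using F(3)[OF that] by (simp add: B(2))
      qed (use n kl in \<open>simp_all add: norm_etensor e norm_amp\<close>)
      then show ?thesis by (simp add: bil_def ED FD E(1) F(1))
    qed
    have "(\<Sum>k=1..n. Re (cinner (amp (E k) *\<^sub>V u) v) + Re (cinner (amp (F (Suc n - k)) *\<^sub>V u') v'))
        \<le> (\<Sum>k=1..n. s)"
      by (intro sum_mono bound pair) auto
    moreover have "(\<Sum>k=1..n. Re (cinner (amp (F (Suc n - k)) *\<^sub>V u') v'))
        = (\<Sum>k=1..n. Re (cinner (amp (F k) *\<^sub>V u') v'))"
      by (rule sum.reindex_bij_witness[of _ "\<lambda>k. Suc n - k" "\<lambda>k. Suc n - k"]) auto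
    ultimately have "(\<Sum>k=1..n. Re (cinner (amp (E k) *\<^sub>V u) v))
        + (\<Sum>k=1..n. Re (cinner (amp (F k) *\<^sub>V u') v')) \<le> real n * s"
      by (simp add: sum.distrib)
    then have avg: "1 / real n * (\<Sum>k=1..n. Re (cinner (amp (E k) *\<^sub>V u) v))
        + 1 / real n * (\<Sum>k=1..n. Re (cinner (amp (F k) *\<^sub>V u') v')) \<le> s"
      using n by (simp add: field_simps)
    show ?thesis
      using avg vector_functional_layer_sum[OF E(4), of u v] vector_functional_layer_sum[OF F(4), of u' v']
      by (simp add: c_def add_divide_distrib)
  qed
  have "(\<lambda>n. s + c / real (Suc n)) \<longlonglongrightarrow> s + 0"
    by (intro tendsto_intros LIMSEQ_Suc[OF lim_const_over_n])
  then have "Re (cinner (amp A *\<^sub>V u) v) + Re (cinner (amp B *\<^sub>V u') v') \<le> s + 0"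
    by (rule LIMSEQ_le_const) (use main in blast)
  then show ?thesis by (simp add: A_def B_def)
qed

theorem theorem3p3:
  fixes D1 :: "('a::chilbert_space, 'a) cblinfun set"
    and D2 :: "('b::chilbert_space, 'b) cblinfun set"
    and S :: "(('a, 'a) cblinfun \<times> ('b, 'b) cblinfun) set"
    and M :: "('a, 'b) cblinfun set"
  assumes "von_neumann_algebra D1" and "commutative D1"
    and "von_neumann_algebra D2" and "commutative D2"
    and "bilattice_over D1 D2 S"
    and "closedin ultraweak M"
    and "bimodule (commutant D1) (commutant D2) M"
    and "bil D1 D2 M = S"
  shows "Mmin S \<subseteq> M \<and> M \<subseteq> Mmax S"
proof
  show "M \<subseteq> Mmax S" using assms(8) by (auto simp: Mmax_def bil_def)
  show "Mmin S \<subseteq> M"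
  proof (rule subsetI, rule ccontr)
    fix T0 assume T0: "T0 \<in> Mmin S" "T0 \<notin> M"
    have subM: "csubspace M" and bimod: "\<And>A T B. A \<in> commutant D2 \<Longrightarrow> T \<in> M \<Longrightarrow> B \<in> commutant D1 \<Longrightarrow> A \<cdot> T \<cdot> B \<in> M"
      using assms(7) by (auto simp: bimodule_def)
    obtain \<xi> \<eta> where zero: "\<And>T. T \<in> M \<Longrightarrow> cinner (amp T *\<^sub>V \<xi>) \<eta> = 0"
      and nonzero: "cinner (amp T0 *\<^sub>V \<xi>) \<eta> \<noteq> 0"
      using ultraweak_separation[OF assms(6) subM T0(2)] by blast
    have alg1: "unital_star_algebra (commutant D1)" and alg2: "unital_star_algebra (commutant D2)"
      using assms(1,3) by (simp_all add: commutant_star_algebra von_neumann_star_algebra)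
    obtain P where P: "P \<in> projections" "P *\<^sub>V \<xi> = \<xi>" "\<And>C. C \<in> commutant D1 \<Longrightarrow> P \<cdot> amp C = amp C \<cdot> P"
      "\<And>x. P *\<^sub>V x \<in> closure ((\<lambda>B. amp B *\<^sub>V \<xi>) ` commutant D1)"
      using cyclic_projection[OF alg1, of \<xi>] by blast
    obtain Q where Q: "Q \<in> projections" "Q *\<^sub>V \<eta> = \<eta>" "\<And>C. C \<in> commutant D2 \<Longrightarrow> Q \<cdot> amp C = amp C \<cdot> Q"
      "\<And>x. Q *\<^sub>V x \<in> closure ((\<lambda>B. amp B *\<^sub>V \<eta>) ` commutant D2)"
      using cyclic_projection[OF alg2, of \<eta>] by blast
    \<comment> \<open>On the orbits of \<open>\<xi>\<close> and \<open>\<eta>\<close> the form of \<open>T\<close> vanishes because \<open>M\<close> is a bimodule;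
      continuity extends this to their closures.\<close>
    have QTP: "Q *\<^sub>V (amp T *\<^sub>V (P *\<^sub>V z)) = 0" if T: "T \<in> M" for T z
    proof (rule cinner_eq_zero_left)
      fix w
      obtain X where X: "\<And>n. X n \<in> (\<lambda>B. amp B *\<^sub>V \<xi>) ` commutant D1" "X \<longlonglongrightarrow> P *\<^sub>V z"
        using P(4)[of z] unfolding closure_sequential by blast
      obtain Y where Y: "\<And>n. Y n \<in> (\<lambda>B. amp B *\<^sub>V \<eta>) ` commutant D2" "Y \<longlonglongrightarrow> Q *\<^sub>V w"
        using Q(4)[of w] unfolding closure_sequential by blast
      have "cinner (amp T *\<^sub>V X n) (Y n) = 0" for n
      proof -
        obtain B where B: "B \<in> commutant D1" "X n = amp B *\<^sub>V \<xi>" using X(1)[of n] by blast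
        obtain A where A: "A \<in> commutant D2" "Y n = amp A *\<^sub>V \<eta>" using Y(1)[of n] by blast
        have "adj A \<in> commutant D2" using alg2 A(1) by (simp add: unital_star_algebra_def)
        from zero[OF bimod[OF this T B(1)]] show ?thesis
          by (simp add: A(2) B(2) amp_comp adj_amp[symmetric] cinner_adj_left)
      qed
      moreover have "(\<lambda>n. cinner (amp T *\<^sub>V X n) (Y n)) \<longlonglongrightarrow> cinner (amp T *\<^sub>V (P *\<^sub>V z)) (Q *\<^sub>V w)"
        by (intro tendsto_intros X(2) Y(2))
      ultimately have "cinner (amp T *\<^sub>V (P *\<^sub>V z)) (Q *\<^sub>V w) = 0"
        by (simp add: LIMSEQ_const_iff)
      then show "cinner (Q *\<^sub>V (amp T *\<^sub>V (P *\<^sub>V z))) w = 0" by (simp add: projectionsD(3)[OF Q(1)])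
    qed
    have "(Lslice \<phi> P, Lslice \<phi> Q) \<in> Conv S" if \<phi>: "state \<phi>" for \<phi>
    proof (rule ccontr)
      assume not: "(Lslice \<phi> P, Lslice \<phi> Q) \<notin> Conv S"
      have "S \<noteq> {}" using assms(5) by (auto simp: bilattice_over_def bilattice_def)
      then obtain u v u' v' s where
        S: "\<And>E F. (E, F) \<in> S \<Longrightarrow> Re (cinner (amp E *\<^sub>V u) v) + Re (cinner (amp F *\<^sub>V u') v') \<le> s"
        and gt: "s < Re (cinner (amp (Lslice \<phi> P) *\<^sub>V u) v) + Re (cinner (amp (Lslice \<phi> Q) *\<^sub>V u') v')"
        using separate_from_Conv[OF _ not] by blast
      \<comment> \<open>Once the separating functionals are chosen, the argument of \<open>\<phi>\<close> is a fixed operator, so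
        it is enough to bound its numerical range.\<close>
      have "Re (\<phi> (vector_slice u v P + vector_slice u' v' Q)) \<le> s"
      proof (rule state_numerical_range[OF \<phi>])
        fix e :: "complex ell2" assume e: "norm e = 1"
        have "Re (cinner (amp (adj (left_tensor e) \<cdot> P \<cdot> left_tensor e) *\<^sub>V u) v)
            + Re (cinner (amp (adj (left_tensor e) \<cdot> Q \<cdot> left_tensor e) *\<^sub>V u') v') \<le> s"
          by (rule vector_slices_bound[OF assms(1-4,7) P(1,3) Q(1,3) QTP e]) (use S assms(8) in auto)
        then show "Re (cinner ((vector_slice u v P + vector_slice u' v' Q) *\<^sub>V e) e) \<le> s"
          by (simp add: cinner_add_left vector_slice_vector_state)
      qed
      then show False
        using gt by (simp add: Lslice_vector_functional[OF \<phi>] clinear_add[OF stateD(1)[OF \<phi>]])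
    qed
    then have "(P, Q) \<in> tilde S" using P(1) Q(1) by (simp add: tilde_def)
    then have "Q \<cdot> amp T0 \<cdot> P = 0" using T0(1) by (auto simp: Mmin_def id_tensor_eq_amp)
    then have "Q *\<^sub>V (amp T0 *\<^sub>V (P *\<^sub>V \<xi>)) = 0" by (metis comp_op_apply zero_op_apply)
    then have "cinner (amp T0 *\<^sub>V \<xi>) (Q *\<^sub>V \<eta>) = 0"
      using projectionsD(3)[OF Q(1), of "amp T0 *\<^sub>V \<xi>" \<eta>] by (simp add: P(2))
    then show False using nonzero by (simp add: Q(2))
  qed
qed

end
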